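(* Let $l \geq 7$ and $d \geq l-1$ be integers. Then \[\dim \mathcal{S}(d,l) = \binom{d+2}{2}-\binom{l}{2}+2l-1.\]
   Context: Let $k$ be an algebraically closed field and $S = k[x_0,x_1,x_2]$, with $\mathbb{P}S_d$ the projective space of plane curves of degree $d$. For $l \geq 2$, let $\mathcal{D}_l \subseteq (\check{\mathbb{P}}^2)^l$ be the quasi-projective variety of $l$-tuples of distinct lines in $\mathbb{P}^2$ no three of which pass through a common point; the star configuration $\mathbb{X}(l)$ of such a tuple is the set of its $\binom{l}{2}$ pairwise intersection points. $\mathcal{S}(d,l)\subseteq \mathbb{P}S_d$ denotes the set of degree-$d$ plane curves containing the star configuration of some tuple in $\mathcal{D}_l$ (the image of the incidence correspondence $\{(\mathcal{C},(\ell_i)) : \mathcal{C}\supseteq \mathbb{X}(l)\}$ under projection to $\mathbb{P}S_d$), and its dimension is that of its Zariski closure. *)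

theory Defs
  imports "HOL-Computational_Algebra.Polynomial" "HOL-Library.Poly_Mapping"
begin

definition mon_eval :: "('v \<Rightarrow>\<^sub>0 nat) \<Rightarrow> ('v \<Rightarrow> 'a::comm_semiring_1) \<Rightarrow> 'a" where
  "mon_eval m x = (\<Prod>v\<in>Poly_Mapping.keys m. x v ^ Poly_Mapping.lookup m v)"

definition peval :: "(('v \<Rightarrow>\<^sub>0 nat) \<Rightarrow>\<^sub>0 'a::comm_semiring_1) \<Rightarrow> ('v \<Rightarrow> 'a) \<Rightarrow> 'a" where
  "peval p x = (\<Sum>m\<in>Poly_Mapping.keys p. Poly_Mapping.lookup p m * mon_eval m x)"

definition homogeneous :: "(('v \<Rightarrow>\<^sub>0 nat) \<Rightarrow>\<^sub>0 'a::zero) \<Rightarrow> bool" where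
  "homogeneous p \<longleftrightarrow> (\<exists>e. \<forall>m\<in>Poly_Mapping.keys p. sum (Poly_Mapping.lookup m) (Poly_Mapping.keys m) = e)"

text \<open>Points of the projective space P(k^V) are represented by the nonzero vectors of k^V
(the affine cone minus the origin); projective subsets are the scale-invariant subsets.\<close>

definition cone_pts :: "'v set \<Rightarrow> ('v \<Rightarrow> 'a::zero) set" where
  "cone_pts V = {x. x \<noteq> (\<lambda>_. 0) \<and> (\<forall>v. v \<notin> V \<longrightarrow> x v = 0)}"

definition proj_closed :: "'v set \<Rightarrow> ('v \<Rightarrow> 'a::comm_semiring_1) set \<Rightarrow> bool" where
  "proj_closed V A \<longleftrightarrow>
     (\<exists>P. (\<forall>p\<in>P. homogeneous p) \<and> A = {x \<in> cone_pts V. \<forall>p\<in>P. peval p x = 0})"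

definition proj_irred :: "'v set \<Rightarrow> ('v \<Rightarrow> 'a::comm_semiring_1) set \<Rightarrow> bool" where
  "proj_irred V A \<longleftrightarrow> proj_closed V A \<and> A \<noteq> {} \<and>
     (\<forall>B C. proj_closed V B \<and> proj_closed V C \<and> A = B \<union> C \<longrightarrow> A = B \<or> A = C)"

definition proj_closure :: "'v set \<Rightarrow> ('v \<Rightarrow> 'a::comm_semiring_1) set \<Rightarrow> ('v \<Rightarrow> 'a) set" where
  "proj_closure V S = \<Inter>{A. proj_closed V A \<and> S \<subseteq> A}"

definition irred_chain :: "'v set \<Rightarrow> ('v \<Rightarrow> 'a::comm_semiring_1) set \<Rightarrow> nat \<Rightarrow> bool" where
  "irred_chain V A n \<longleftrightarrow> (\<exists>Z :: nat \<Rightarrow> ('v \<Rightarrow> 'a) set.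
      (\<forall>i\<le>n. proj_irred V (Z i)) \<and> (\<forall>i<n. Z i \<subset> Z (Suc i)) \<and> Z n \<subseteq> A)"

definition proj_dim_eq :: "'v set \<Rightarrow> ('v \<Rightarrow> 'a::comm_semiring_1) set \<Rightarrow> nat \<Rightarrow> bool" where
  "proj_dim_eq V A n \<longleftrightarrow> irred_chain V A n \<and> \<not> irred_chain V A (Suc n)"

text \<open>Monomials of degree d in x0,x1,x2 (variables indexed 0,1,2).  A plane form of degree d
is a coefficient function on these monomials; P S_d is the projective space with
coordinates indexed by plane_monos d.\<close>

definition plane_monos :: "nat \<Rightarrow> (nat \<Rightarrow>\<^sub>0 nat) set" where
  "plane_monos d = {m. Poly_Mapping.keys m \<subseteq> {0,1,2} \<and> Poly_Mapping.lookup m 0 + Poly_Mapping.lookup m 1 + Poly_Mapping.lookup m 2 = d}"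

definition curve_eval :: "nat \<Rightarrow> ((nat \<Rightarrow>\<^sub>0 nat) \<Rightarrow> 'a::comm_semiring_1) \<Rightarrow> 'a \<times> 'a \<times> 'a \<Rightarrow> 'a" where
  "curve_eval d c p = (\<Sum>m\<in>plane_monos d.
      c m * (fst p ^ Poly_Mapping.lookup m 0 * fst (snd p) ^ Poly_Mapping.lookup m 1 * snd (snd p) ^ Poly_Mapping.lookup m 2))"

text \<open>Lines of P^2 are nonzero linear forms (a0,a1,a2), up to scaling.\<close>
definition lin :: "'a::comm_semiring_1 \<times> 'a \<times> 'a \<Rightarrow> 'a \<times> 'a \<times> 'a \<Rightarrow> 'a" where
  "lin a p = fst a * fst p + fst (snd a) * fst (snd p) + snd (snd a) * snd (snd p)"

definition proportional :: "'a::field \<times> 'a \<times> 'a \<Rightarrow> 'a \<times> 'a \<times> 'a \<Rightarrow> bool" where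
  "proportional a b \<longleftrightarrow> (\<exists>c. c \<noteq> 0 \<and> b = (c * fst a, c * fst (snd a), c * snd (snd a)))"

definition D_tuple :: "nat \<Rightarrow> (nat \<Rightarrow> 'a::field \<times> 'a \<times> 'a) \<Rightarrow> bool" where
  "D_tuple l L \<longleftrightarrow>
     (\<forall>i<l. L i \<noteq> (0,0,0)) \<and>
     (\<forall>i<l. \<forall>j<l. i \<noteq> j \<longrightarrow> \<not> proportional (L i) (L j)) \<and>
     (\<forall>i<l. \<forall>j<l. \<forall>k<l. i \<noteq> j \<and> j \<noteq> k \<and> i \<noteq> k \<longrightarrow>
        \<not> (\<exists>p. p \<noteq> (0,0,0) \<and> lin (L i) p = 0 \<and> lin (L j) p = 0 \<and> lin (L k) p = 0))"

definition contains_star :: "nat \<Rightarrow> nat \<Rightarrow> ((nat \<Rightarrow>\<^sub>0 nat) \<Rightarrow> 'a::field) \<Rightarrow> (nat \<Rightarrow> 'a \<times> 'a \<times> 'a) \<Rightarrow> bool" where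
  "contains_star d l c L \<longleftrightarrow>
     (\<forall>i<l. \<forall>j<l. i < j \<longrightarrow>
        (\<forall>p. p \<noteq> (0,0,0) \<and> lin (L i) p = 0 \<and> lin (L j) p = 0 \<longrightarrow> curve_eval d c p = 0))"

definition S_star :: "nat \<Rightarrow> nat \<Rightarrow> ((nat \<Rightarrow>\<^sub>0 nat) \<Rightarrow> 'a::field) set" where
  "S_star d l = {c \<in> cone_pts (plane_monos d). \<exists>L. D_tuple l L \<and> contains_star d l c L}"

end

theory Submission
  imports Defs "HOL-Library.FuncSet"
begin

text \<open>Projective dimension is read off by counting monomials. A chain of irreducible closed sets of
length \<open>n\<close> yields \<open>n + 1\<close> forms of equal degree without homogeneous relations: each step
contributes a form vanishing on the smaller set only. Forms pulled back to a parameter space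
\<open>k\<^sup>N\<close> satisfy a relation as soon as there are \<open>N + 2\<close> of them, and \<open>S_star d l\<close> is
covered, up to scalars, by finitely many polynomial charts on \<open>k\<^sup>N\<close>: two parameters for each
line, and the coordinates, one of them normalised, of a form in a basis of those vanishing on the
star configuration.

Conversely, a polynomial map \<open>k\<^sup>N \<rightarrow> S_star d l\<close> with linearly independent leading terms
maps a flag of coordinate subspaces to a strict chain of closures. It suffices to have one curve
\<open>\<Sum>\<^sub>i a\<^sub>i \<Prod>\<^sub>j\<^sub>\<noteq>\<^sub>i L\<^sub>j\<close>, times a power of a linear form, whose star configuration does not move to first
order. Six lines with \<open>a\<^sub>i = 1\<close> are enough, the remaining ones getting weight \<open>0\<close>. In
characteristic 2 this rigidity fails, because moving every \<open>L\<^sub>i\<close> by \<open>a\<^sub>i M\<close> changes the curve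
by twice something; in these three directions the second-order term, which is additive in
characteristic 2, takes over.\<close>

section \<open>Linear algebra and polynomial functions\<close>

text \<open>The claimed number is the dimension of the incidence correspondence, so the issue is
  that a general such curve carries only finitely many star configurations. Jets at one curve stand
  in for a theorem on fibre dimension. In degree l - 1 the forms through the star are the sums of
  a_i times the product of the L_j with j \<noteq> i. Moving each L_i by S_i changes the value at
  L_i \<inter> L_j, up to a nonzero factor, by a_i S_j + a_j S_i; rigidity says that if all these
  vanish, every S_i is a multiple of L_i. Six lines give 15 equations in 12 unknowns, and 12 of them
  suffice below. Five lines give 10 in 10, but dependent ones: in characteristic 0 their curves are
  the Lueroth quartics, which fill only a hypersurface. A line of weight 0 comes for free: against
  two core lines the equations say that S_j vanishes at two points of L_j. The factor 2 appears
  because the sum of a_i times the product of the L_j + a_j T, j \<noteq> i, is the T-derivative of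
  the full product, so its coefficients at T and T^2 are 2 and 3 times coefficients of that product;
  in characteristic 2 the 3 is 1.\<close>

lemma infinite_UNIV_alg_closed: "infinite (UNIV :: 'a::alg_closed_field set)"
proof
  assume fin: "finite (UNIV :: 'a set)"
  \<comment> \<open>Over a finite field this nonconstant polynomial would take the value 1
    everywhere.\<close>
  define p :: "'a poly" where "p = (\<Prod>a\<in>UNIV. [:-a, 1:]) + 1"
  have deg: "degree (\<Prod>a\<in>(UNIV :: 'a set). [:-a, 1:]) = card (UNIV :: 'a set)"
    by (subst degree_prod_eq_sum_degree) auto
  have "card (UNIV :: 'a set) > 0"
    using fin by (simp add: card_gt_0_iff)
  then have "degree p > 0"
    unfolding p_def by (subst degree_add_eq_left) (simp_all add: deg)
  then obtain x where "poly p x = 0"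
    using alg_closed_imp_poly_has_root by blast
  moreover have "poly p x = 1"
    using fin by (auto simp: p_def poly_prod)
  ultimately show False by simp
qed

lemma poly_eq_0_if_all_roots:
  fixes p :: "'a::alg_closed_field poly"
  assumes "\<And>t. poly p t = 0"
  shows "p = 0"
  using assms poly_roots_finite[of p] infinite_UNIV_alg_closed[where 'a='a] by auto

lemma common_nonroot:
  fixes f :: "'i \<Rightarrow> 'a::alg_closed_field poly"
  assumes "finite A" "\<And>i. i \<in> A \<Longrightarrow> f i \<noteq> 0" "finite X"
  shows "\<exists>t. t \<notin> X \<and> (\<forall>i\<in>A. poly (f i) t \<noteq> 0)"
proof -
  have "finite (X \<union> (\<Union>i\<in>A. {t. poly (f i) t = 0}))"
    using assms by (auto intro: poly_roots_finite)
  then obtain t where "t \<notin> X \<union> (\<Union>i\<in>A. {t. poly (f i) t = 0})"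
    using infinite_UNIV_alg_closed[where 'a='a] ex_new_if_finite by blast
  then show ?thesis by auto
qed

section \<open>Linear systems and dual functionals\<close>

lemma underdetermined_system:
  fixes u :: "'i \<Rightarrow> 'b \<Rightarrow> 'a::field"
  assumes "finite B" "finite A" "card B < card A"
  shows "\<exists>c. (\<exists>i\<in>A. c i \<noteq> 0) \<and> (\<forall>b\<in>B. (\<Sum>i\<in>A. c i * u i b) = 0)"
  using assms
proof (induction B arbitrary: A u rule: finite_induct)
  case empty
  then have "A \<noteq> {}" by auto
  then show ?case by (intro exI[of _ "\<lambda>_. 1"]) auto
next
  case (insert b B)
  show ?case
  proof (cases "\<forall>i\<in>A. u i b = 0")
    case True
    have "card B < card A" using insert by auto
    then obtain c where "\<exists>i\<in>A. c i \<noteq> 0" "\<forall>b\<in>B. (\<Sum>i\<in>A. c i * u i b) = 0"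
      using insert.IH[OF insert.prems(1), of u] by blast
    then show ?thesis using True by (intro exI[of _ c]) auto
  next
    case False
    then obtain k where k: "k \<in> A" "u k b \<noteq> 0" by auto
    \<comment> \<open>\<open>v\<close> is the system after clearing equation \<open>b\<close> with
      the pivot \<open>k\<close>; a solution of it is extended to \<open>k\<close> by
      back-substitution in \<open>c'\<close>.\<close>
    define v where "v i b' = u i b' - u i b / u k b * u k b'" for i b'
    have "card B < card (A - {k})"
      using insert k by (auto simp: card_Diff_singleton)
    then obtain c where c: "\<exists>i\<in>A-{k}. c i \<noteq> 0" "\<forall>b\<in>B. (\<Sum>i\<in>A-{k}. c i * v i b) = 0"
      using insert.IH[of "A-{k}" v] insert.prems by auto
    define c' where "c' i = (if i = k then - (\<Sum>i\<in>A-{k}. c i * u i b) / u k b else c i)" for i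
    have sum_c': "(\<Sum>i\<in>A. c' i * u i b') = c' k * u k b' + (\<Sum>i\<in>A-{k}. c i * u i b')" for b'
    proof -
      have "(\<Sum>i\<in>A. c' i * u i b') = c' k * u k b' + (\<Sum>i\<in>A-{k}. c' i * u i b')"
        using k insert.prems by (simp add: sum.remove)
      also have "(\<Sum>i\<in>A-{k}. c' i * u i b') = (\<Sum>i\<in>A-{k}. c i * u i b')"
        by (intro sum.cong) (auto simp: c'_def)
      finally show ?thesis .
    qed
    have "(\<Sum>i\<in>A. c' i * u i b') = 0" if "b' \<in> insert b B" for b'
    proof (cases "b' = b")
      case True
      then show ?thesis unfolding sum_c' using k by (simp add: c'_def)
    next
      case False
      then have "(\<Sum>i\<in>A-{k}. c i * v i b') = 0" using c that by auto
      then have "(\<Sum>i\<in>A-{k}. c i * u i b') = (\<Sum>i\<in>A-{k}. c i * u i b) / u k b * u k b'"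
        by (simp add: v_def algebra_simps sum_subtractf sum_distrib_left sum_divide_distrib)
      then show ?thesis unfolding sum_c' by (simp add: c'_def)
    qed
    moreover have "\<exists>i\<in>A. c' i \<noteq> 0" using c by (auto simp: c'_def)
    ultimately show ?thesis by blast
  qed
qed

definition indep_on :: "'b set \<Rightarrow> 'i set \<Rightarrow> ('i \<Rightarrow> 'b \<Rightarrow> 'a::field) \<Rightarrow> bool" where
  "indep_on B A u \<longleftrightarrow> (\<forall>c. (\<forall>b\<in>B. (\<Sum>i\<in>A. c i * u i b) = 0) \<longrightarrow> (\<forall>i\<in>A. c i = 0))"

text \<open>\<open>B\<close> will be either a finite set of monomials or the infinite set of all
  points, on which forms are functions. Finite combinations of values depend polynomially on
  parameters when the values do, and they are linear forms in the coordinates.\<close>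

definition finite_functional :: "'b set \<Rightarrow> (('b \<Rightarrow> 'a::field) \<Rightarrow> 'a) \<Rightarrow> bool" where
  "finite_functional B h \<longleftrightarrow>
     (\<exists>X m. finite X \<and> X \<subseteq> B \<and> (\<forall>f. h f = (\<Sum>b\<in>X. m b * f b)))"

lemma finite_functional_eval: "b \<in> B \<Longrightarrow> finite_functional B (\<lambda>f. f b)"
  unfolding finite_functional_def by (intro exI[of _ "{b}"] exI[of _ "\<lambda>_. 1"]) auto

lemma finite_functional_scale:
  "finite_functional B h \<Longrightarrow> finite_functional B (\<lambda>f. a * h f)"
  unfolding finite_functional_def
  by (elim exE conjE, rule_tac x=X in exI, rule_tac x="\<lambda>b. a * m b" in exI)
    (auto simp: sum_distrib_left mult.assoc)

lemma finite_functional_add: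
  assumes "finite_functional B g" "finite_functional B h"
  shows "finite_functional B (\<lambda>f. g f + h f)"
proof -
  obtain X m where X: "finite X" "X \<subseteq> B" "\<And>f. g f = (\<Sum>b\<in>X. m b * f b)"
    using assms(1) unfolding finite_functional_def by blast
  obtain Y n where Y: "finite Y" "Y \<subseteq> B" "\<And>f. h f = (\<Sum>b\<in>Y. n b * f b)"
    using assms(2) unfolding finite_functional_def by blast
  have "g f + h f = (\<Sum>b\<in>X\<union>Y. ((if b \<in> X then m b else 0) + (if b \<in> Y then n b else 0)) * f b)" for f
  proof -
    have "(\<Sum>b\<in>X\<union>Y. (if b \<in> X then m b else 0) * f b) = (\<Sum>b\<in>X. m b * f b)"
      using X Y by (intro sum.mono_neutral_cong_right) auto
    moreover have "(\<Sum>b\<in>X\<union>Y. (if b \<in> Y then n b else 0) * f b) = (\<Sum>b\<in>Y. n b * f b)"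
      using X Y by (intro sum.mono_neutral_cong_right) auto
    ultimately show ?thesis
      by (simp only: X(3) Y(3) distrib_right sum.distrib)
  qed
  then show ?thesis unfolding finite_functional_def using X Y
    by (intro exI[of _ "X \<union> Y"] exI conjI allI) auto
qed

lemma finite_functional_sum:
  assumes "\<And>i. i \<in> A \<Longrightarrow> finite_functional B (h i)"
  shows "finite_functional B (\<lambda>f. \<Sum>i\<in>A. h i f)"
  using assms
proof (induction A rule: infinite_finite_induct)
  case (insert i A)
  then show ?case by (simp add: finite_functional_add)
qed (auto simp: finite_functional_def intro!: exI[of _ "{}"])

lemma finite_functional_diff:
  assumes "finite_functional B g" "finite_functional B h"
  shows "finite_functional B (\<lambda>f. g f - h f)"
  using finite_functional_add[OF assms(1) finite_functional_scale[OF assms(2), of "-1"]] by simp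

lemma finite_functional_sum_apply:
  assumes "finite_functional B h"
  shows "h (\<lambda>b. \<Sum>i\<in>A. c i * u i b) = (\<Sum>i\<in>A. c i * h (u i))"
proof -
  obtain X m where X: "\<And>f. h f = (\<Sum>b\<in>X. m b * f b)"
    using assms unfolding finite_functional_def by blast
  show ?thesis
    unfolding X sum_distrib_left by (subst sum.swap) (simp add: mult_ac)
qed

text \<open>Induction on \<open>A\<close>: independence gives a point \<open>b\<close> at which the
  new \<open>u k\<close>, freed of its components along the old functions, is nonzero. Evaluation
  there detects \<open>u k\<close>, and the old functionals are corrected by it.\<close>

lemma dual_functionals:
  fixes u :: "'i \<Rightarrow> 'b \<Rightarrow> 'a::field"
  assumes "finite A" "indep_on B A u"
  shows "\<exists>h. \<forall>i\<in>A. finite_functional B (h i) \<and> (\<forall>j\<in>A. h i (u j) = (if i = j then 1 else 0))"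
  using assms
proof (induction A rule: finite_induct)
  case empty
  then show ?case by auto
next
  case (insert k A)
  have "indep_on B A u"
    unfolding indep_on_def
  proof (intro allI impI ballI)
    fix c i assume c: "\<forall>b\<in>B. (\<Sum>i\<in>A. c i * u i b) = 0" and i: "i \<in> A"
    have "(\<Sum>i\<in>insert k A. (c(k := 0)) i * u i b) = (\<Sum>i\<in>A. c i * u i b)" for b
      using insert.hyps by (subst sum.insert) (auto intro!: sum.cong)
    then have "\<forall>i\<in>insert k A. (c(k := 0)) i = 0"
      using insert.prems c unfolding indep_on_def by presburger
    then show "c i = 0" using i insert.hyps by (metis fun_upd_other insertCI)
  qed
  then obtain h where h: "\<And>i. i \<in> A \<Longrightarrow> finite_functional B (h i)"
    "\<And>i j. i \<in> A \<Longrightarrow> j \<in> A \<Longrightarrow> h i (u j) = (if i = j then 1 else 0)"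
    using insert.IH by blast
  define c where "c i = (if i = k then 1 else - h i (u k))" for i
  have c_sum: "(\<Sum>i\<in>insert k A. c i * u i b) = u k b - (\<Sum>i\<in>A. h i (u k) * u i b)" for b
  proof -
    have "(\<Sum>i\<in>A. c i * u i b) = (\<Sum>i\<in>A. - (h i (u k) * u i b))"
      using insert.hyps by (intro sum.cong) (auto simp: c_def)
    then show ?thesis using insert.hyps by (simp add: c_def sum_negf)
  qed
  obtain b where b: "b \<in> B" "(\<Sum>i\<in>insert k A. c i * u i b) \<noteq> 0"
    using insert.prems[unfolded indep_on_def, rule_format, of c k] by (auto simp: c_def)
  define w where "w = u k b - (\<Sum>i\<in>A. h i (u k) * u i b)"
  have w: "w \<noteq> 0" using b by (simp add: w_def c_sum)
  define g where "g f = inverse w * (f b - (\<Sum>i\<in>A. u i b * h i f))" for f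
  have g: "finite_functional B g"
    unfolding g_def using h b
    by (intro finite_functional_scale finite_functional_diff finite_functional_sum
        finite_functional_eval) auto
  have gu: "g (u j) = 0" if "j \<in> A" for j
  proof -
    have "(\<Sum>i\<in>A. u i b * h i (u j)) = (\<Sum>i\<in>A. if i = j then u i b else 0)"
      using that by (intro sum.cong) (auto simp: h)
    then show ?thesis using that insert.hyps by (simp add: g_def)
  qed
  have gk: "g (u k) = 1" using w by (simp add: g_def w_def mult.commute)
  define h' where "h' i = (if i = k then g else (\<lambda>f. h i f - h i (u k) * g f))" for i
  have ff: "finite_functional B (h' i)" if "i \<in> insert k A" for i
    using that g h by (auto simp: h'_def intro: finite_functional_diff finite_functional_scale)
  have "h' i (u j) = (if i = j then 1 else 0)" if "i \<in> insert k A" "j \<in> insert k A" for i j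
    using that insert.hyps by (auto simp: h'_def gu gk h)
  then show ?case using ff by (intro exI[of _ h']) blast
qed

section \<open>Polynomial functions of finitely many parameters\<close>

text \<open>The degree is bounded in each variable separately: the admissible exponents form a box
  with (D + 1)^n elements, which makes the count in \<open>polynomial_dependence\<close>
  explicit.\<close>

definition polyfun :: "nat \<Rightarrow> nat \<Rightarrow> ((nat \<Rightarrow> 'a::comm_ring_1) \<Rightarrow> 'a) \<Rightarrow> bool" where
  "polyfun n D f \<longleftrightarrow>
     (\<exists>c. \<forall>x. f x = (\<Sum>\<alpha>\<in>{..<n} \<rightarrow>\<^sub>E {..D}. c \<alpha> * (\<Prod>i<n. x i ^ \<alpha> i)))"

lemma polyfun_zero: "polyfun n D (\<lambda>_. 0)"
  unfolding polyfun_def by (intro exI[of _ "\<lambda>_. 0"]) auto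

lemma polyfun_add:
  assumes "polyfun n D f" "polyfun n D g"
  shows "polyfun n D (\<lambda>x. f x + g x)"
  using assms unfolding polyfun_def
  by (elim exE, rule_tac x="\<lambda>\<alpha>. c \<alpha> + ca \<alpha>" in exI) (auto simp: algebra_simps sum.distrib)

lemma polyfun_scale: "polyfun n D f \<Longrightarrow> polyfun n D (\<lambda>x. a * f x)"
  unfolding polyfun_def
  by (elim exE, rule_tac x="\<lambda>\<alpha>. a * c \<alpha>" in exI) (auto simp: sum_distrib_left mult.assoc)

lemma polyfun_sum:
  "(\<And>i. i \<in> A \<Longrightarrow> polyfun n D (f i)) \<Longrightarrow> polyfun n D (\<lambda>x. \<Sum>i\<in>A. f i x)"
  by (induction A rule: infinite_finite_induct) (auto intro: polyfun_zero polyfun_add)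

lemma polyfun_monom:
  assumes "\<And>i. i < n \<Longrightarrow> \<alpha> i \<le> D"
  shows "polyfun n D (\<lambda>x. \<Prod>i<n. x i ^ \<alpha> i)"
proof -
  have "restrict \<alpha> {..<n} \<in> {..<n} \<rightarrow>\<^sub>E {..D}" using assms by auto
  moreover have "(\<Prod>i<n. x i ^ \<alpha> i) = (\<Prod>i<n. x i ^ restrict \<alpha> {..<n} i)" for x :: "nat \<Rightarrow> 'a"
    by (intro prod.cong) auto
  ultimately show ?thesis unfolding polyfun_def
    by (intro exI[of _ "\<lambda>\<beta>. if \<beta> = restrict \<alpha> {..<n} then 1 else 0"])
      (auto simp: finite_PiE if_distrib[of "\<lambda>c. c * _"] cong: if_cong)
qed

lemma polyfun_mult:
  assumes "polyfun n D f" "polyfun n D' g"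
  shows "polyfun n (D + D') (\<lambda>x. f x * g x)"
proof -
  obtain c where c: "\<And>x. f x = (\<Sum>\<alpha>\<in>{..<n} \<rightarrow>\<^sub>E {..D}. c \<alpha> * (\<Prod>i<n. x i ^ \<alpha> i))"
    using assms(1) unfolding polyfun_def by blast
  obtain d where d: "\<And>x. g x = (\<Sum>\<alpha>\<in>{..<n} \<rightarrow>\<^sub>E {..D'}. d \<alpha> * (\<Prod>i<n. x i ^ \<alpha> i))"
    using assms(2) unfolding polyfun_def by blast
  have "f x * g x = (\<Sum>\<alpha>\<in>{..<n} \<rightarrow>\<^sub>E {..D}. \<Sum>\<beta>\<in>{..<n} \<rightarrow>\<^sub>E {..D'}.
      (c \<alpha> * d \<beta>) * (\<Prod>i<n. x i ^ (\<alpha> i + \<beta> i)))" for x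
    unfolding c d sum_product
    by (intro sum.cong refl) (simp add: power_add prod.distrib mult_ac)
  moreover have "polyfun n (D + D') (\<lambda>x. \<Sum>\<alpha>\<in>{..<n} \<rightarrow>\<^sub>E {..D}. \<Sum>\<beta>\<in>{..<n} \<rightarrow>\<^sub>E {..D'}.
      (c \<alpha> * d \<beta>) * (\<Prod>i<n. x i ^ (\<alpha> i + \<beta> i)))"
    by (intro polyfun_sum polyfun_scale polyfun_monom add_mono) (auto simp: PiE_iff)
  ultimately show ?thesis by presburger
qed

lemma polyfun_mono:
  assumes "polyfun n D f" "D \<le> D'"
  shows "polyfun n D' f"
proof -
  obtain c where c: "\<And>x. f x = (\<Sum>\<alpha>\<in>{..<n} \<rightarrow>\<^sub>E {..D}. c \<alpha> * (\<Prod>i<n. x i ^ \<alpha> i))"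
    using assms(1) unfolding polyfun_def by blast
  have "polyfun n D' (\<lambda>x. \<Sum>\<alpha>\<in>{..<n} \<rightarrow>\<^sub>E {..D}. c \<alpha> * (\<Prod>i<n. x i ^ \<alpha> i))"
    using assms(2) by (intro polyfun_sum polyfun_scale polyfun_monom) (auto simp: PiE_iff intro: order_trans)
  then show ?thesis using c by presburger
qed

lemma polyfun_const: "polyfun n D (\<lambda>_. a)"
  using polyfun_scale[OF polyfun_monom[of n "\<lambda>_. 0" D], of a] by simp

lemma polyfun_var:
  assumes "i < n" "D \<ge> 1"
  shows "polyfun n D (\<lambda>x. x i)"
proof -
  have "(\<Prod>j<n. x j ^ (if j = i then 1 else 0)) = x i" for x :: "nat \<Rightarrow> 'a"
    using assms by (simp add: if_distrib[of "\<lambda>k. _ ^ k"] cong: if_cong)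
  moreover have "polyfun n D (\<lambda>x :: nat \<Rightarrow> 'a. \<Prod>j<n. x j ^ (if j = i then 1 else 0))"
    using assms by (intro polyfun_monom) auto
  ultimately show ?thesis by (simp only:)
qed

lemma polyfun_power: "polyfun n D f \<Longrightarrow> polyfun n (D * k) (\<lambda>x. f x ^ k)"
  by (induction k) (auto intro: polyfun_const polyfun_mult)

lemma polyfun_prod:
  "(\<And>i. i \<in> A \<Longrightarrow> polyfun n (D i) (f i)) \<Longrightarrow> polyfun n (\<Sum>i\<in>A. D i) (\<lambda>x. \<Prod>i\<in>A. f i x)"
  by (induction A rule: infinite_finite_induct) (auto intro: polyfun_const polyfun_mult)

definition polynomial_map :: "nat \<Rightarrow> ((nat \<Rightarrow> 'a::comm_ring_1) \<Rightarrow> 'a) \<Rightarrow> bool" where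
  "polynomial_map n f \<longleftrightarrow> (\<exists>D. polyfun n D f)"

lemma polynomial_map_const: "polynomial_map n (\<lambda>_. a)"
  unfolding polynomial_map_def using polyfun_const by blast

lemma polynomial_map_var: "i < n \<Longrightarrow> polynomial_map n (\<lambda>x. x i)"
  unfolding polynomial_map_def using polyfun_var by blast

lemma polynomial_map_add:
  assumes "polynomial_map n f" "polynomial_map n g"
  shows "polynomial_map n (\<lambda>x. f x + g x)"
proof -
  obtain D D' where "polyfun n D f" "polyfun n D' g"
    using assms unfolding polynomial_map_def by blast
  then have "polyfun n (max D D') f" "polyfun n (max D D') g"
    by (auto intro: polyfun_mono)
  then show ?thesis unfolding polynomial_map_def using polyfun_add by blast
qed

lemma polynomial_map_mult:
  "polynomial_map n f \<Longrightarrow> polynomial_map n g \<Longrightarrow> polynomial_map n (\<lambda>x. f x * g x)"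
  unfolding polynomial_map_def using polyfun_mult by blast

lemma polynomial_map_sum:
  "(\<And>i. i \<in> A \<Longrightarrow> polynomial_map n (f i)) \<Longrightarrow> polynomial_map n (\<lambda>x. \<Sum>i\<in>A. f i x)"
  by (induction A rule: infinite_finite_induct)
    (auto intro: polynomial_map_const polynomial_map_add)

lemma polynomial_map_prod:
  "(\<And>i. i \<in> A \<Longrightarrow> polynomial_map n (f i)) \<Longrightarrow> polynomial_map n (\<lambda>x. \<Prod>i\<in>A. f i x)"
  by (induction A rule: infinite_finite_induct)
    (auto intro: polynomial_map_const polynomial_map_mult)

lemma polynomial_map_power: "polynomial_map n f \<Longrightarrow> polynomial_map n (\<lambda>x. f x ^ k)"
  unfolding polynomial_map_def using polyfun_power by blast

lemma polynomial_map_uniform_degree: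
  assumes "finite A" "\<And>i. i \<in> A \<Longrightarrow> polynomial_map n (f i)"
  shows "\<exists>D. \<forall>i\<in>A. polyfun n D (f i)"
proof -
  obtain D where D: "\<And>i. i \<in> A \<Longrightarrow> polyfun n (D i) (f i)"
    using assms(2) unfolding polynomial_map_def by metis
  have "polyfun n (Max (D ` A)) (f i)" if "i \<in> A" for i
    using assms(1) that by (intro polyfun_mono[OF D]) auto
  then show ?thesis by blast
qed

text \<open>Reduces density arguments in \<open>n\<close> variables to the finiteness of roots in
  one variable.\<close>

lemma polynomial_map_line:
  assumes "polynomial_map n f"
  shows "\<exists>p. \<forall>t. f (\<lambda>i. x i + t * y i) = poly p t"
proof -
  obtain D c where c: "\<And>x. f x = (\<Sum>\<alpha>\<in>{..<n} \<rightarrow>\<^sub>E {..D}. c \<alpha> * (\<Prod>i<n. x i ^ \<alpha> i))"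
    using assms unfolding polynomial_map_def polyfun_def by blast
  show ?thesis
    by (intro exI[of _ "\<Sum>\<alpha>\<in>{..<n} \<rightarrow>\<^sub>E {..D}. smult (c \<alpha>) (\<Prod>i<n. [:x i, y i:] ^ \<alpha> i)"])
      (simp add: c poly_sum poly_prod)
qed

lemma polynomial_map_truncate:
  assumes "polynomial_map n f" "r \<le> n"
  shows "polynomial_map r (\<lambda>x. f (\<lambda>i. if i < r then x i else 0))"
proof -
  obtain D c where c: "\<And>x. f x = (\<Sum>\<alpha>\<in>{..<n} \<rightarrow>\<^sub>E {..D}. c \<alpha> * (\<Prod>i<n. x i ^ \<alpha> i))"
    using assms unfolding polynomial_map_def polyfun_def by blast
  have "polynomial_map r (\<lambda>x. if i < r then x i else 0)" for i
    by (cases "i < r") (auto intro: polynomial_map_const polynomial_map_var)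
  then show ?thesis unfolding c
    by (intro polynomial_map_sum polynomial_map_mult polynomial_map_prod polynomial_map_power
        polynomial_map_const)
qed

text \<open>Induction on the number of variables, comparing coefficients of a power of the last one.
  Exponents enter through \<open>g\<close>, so that the index set may consist of plane monomials, of
  pairs, or of exponent vectors rescaled by positive factors.\<close>

lemma monomials_independent:
  fixes c :: "'e \<Rightarrow> 'a::alg_closed_field" and g :: "'e \<Rightarrow> nat \<Rightarrow> nat"
  assumes "finite E" "inj_on (\<lambda>\<alpha>. restrict (g \<alpha>) {..<n}) E"
    and "\<And>x. (\<Sum>\<alpha>\<in>E. c \<alpha> * (\<Prod>i<n. x i ^ g \<alpha> i)) = 0"
    and "\<alpha> \<in> E"
  shows "c \<alpha> = 0"
  using assms
proof (induction n arbitrary: E \<alpha>)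
  case 0
  have "restrict (g \<beta>) {..<0} = restrict (g \<alpha>) {..<0}" for \<beta> by (auto simp: restrict_def)
  then have "E = {\<alpha>}" using "0.prems"(2,4) unfolding inj_on_def by blast
  then show ?case using "0.prems"(3) by simp
next
  case (Suc n)
  define E' where "E' = {\<beta>\<in>E. g \<beta> n = g \<alpha> n}"
  have "(\<Sum>\<beta>\<in>E'. c \<beta> * (\<Prod>i<n. x i ^ g \<beta> i)) = 0" for x
  proof -
    define p where "p = (\<Sum>\<beta>\<in>E. monom (c \<beta> * (\<Prod>i<n. x i ^ g \<beta> i)) (g \<beta> n))"
    have "poly p t = 0" for t
    proof -
      have "(\<Prod>i<n. (x(n := t)) i ^ g \<beta> i) = (\<Prod>i<n. x i ^ g \<beta> i)" for \<beta>
        by (intro prod.cong) auto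
      then have "poly p t = (\<Sum>\<beta>\<in>E. c \<beta> * (\<Prod>i<Suc n. (x(n := t)) i ^ g \<beta> i))"
        by (simp add: p_def poly_sum poly_monom mult_ac)
      then show ?thesis using Suc.prems(3)[of "x(n := t)"] by (simp only:)
    qed
    then have "p = 0" by (rule poly_eq_0_if_all_roots)
    then have "coeff p (g \<alpha> n) = 0" by simp
    moreover have "coeff p (g \<alpha> n) =
        (\<Sum>\<beta>\<in>E. if g \<beta> n = g \<alpha> n then c \<beta> * (\<Prod>i<n. x i ^ g \<beta> i) else 0)"
      unfolding p_def coeff_sum by (intro sum.cong) (auto simp: coeff_monom)
    ultimately show ?thesis unfolding E'_def sum.inter_filter[OF Suc.prems(1)] by (simp only:)
  qed
  moreover have "inj_on (\<lambda>\<beta>. restrict (g \<beta>) {..<n}) E'"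
  proof (rule inj_onI)
    fix \<beta> \<gamma> assume *: "\<beta> \<in> E'" "\<gamma> \<in> E'" "restrict (g \<beta>) {..<n} = restrict (g \<gamma>) {..<n}"
    have "g \<beta> n = g \<gamma> n" using *(1,2) unfolding E'_def by (simp only: mem_Collect_eq)
    moreover have "g \<beta> i = g \<gamma> i" if "i < n" for i
      using that fun_cong[OF *(3), of i] by simp
    ultimately have "g \<beta> i = g \<gamma> i" if "i < Suc n" for i
      using that less_Suc_eq by blast
    then have "restrict (g \<beta>) {..<Suc n} = restrict (g \<gamma>) {..<Suc n}"
      by (auto simp: restrict_def)
    then show "\<beta> = \<gamma>" using * Suc.prems(2) unfolding inj_on_def E'_def by blast
  qed
  moreover have "finite E'" "\<alpha> \<in> E'" unfolding E'_def using Suc.prems(1,4) by auto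
  ultimately show ?case by (intro Suc.IH[of E' \<alpha>])
qed

text \<open>A count: exponent vectors of one total degree in \<open>n + 2\<close> slots number about
  t^(n+1), while the products lie in spaces of dimension O(t^n). The relation has to be homogeneous
  in order to define a form, and common to all \<open>s\<close> in order to hold on every chart at
  once.\<close>

lemma polynomial_dependence:
  fixes f :: "'s \<Rightarrow> nat \<Rightarrow> (nat \<Rightarrow> 'a::field) \<Rightarrow> 'a"
  assumes "finite S" "\<And>s i. s \<in> S \<Longrightarrow> i \<le> Suc n \<Longrightarrow> polynomial_map n (f s i)"
  obtains E T \<alpha> c where "finite E" "\<And>\<alpha>. \<alpha> \<in> E \<Longrightarrow> (\<Sum>i\<le>Suc n. \<alpha> i) = T"
    "\<And>\<alpha> i. \<alpha> \<in> E \<Longrightarrow> i > Suc n \<Longrightarrow> \<alpha> i = 0" "\<alpha> \<in> E" "c \<alpha> \<noteq> 0"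
    "\<And>s x. s \<in> S \<Longrightarrow> (\<Sum>\<alpha>\<in>E. c \<alpha> * (\<Prod>i\<le>Suc n. f s i x ^ \<alpha> i)) = 0"
proof -
  have "\<exists>D. \<forall>i\<in>S \<times> {..Suc n}. polyfun n D (case_prod f i)"
    using assms by (intro polynomial_map_uniform_degree) auto
  then obtain D where D: "\<And>s i. s \<in> S \<Longrightarrow> i \<le> Suc n \<Longrightarrow> polyfun n D (f s i)" by auto
  \<comment> \<open>Since \<open>D * T + 1 \<le> C * (t + 1)\<close>, there are at most
    \<open>t * (t + 1) ^ n\<close> conditions, just below the number \<open>(t + 1) ^ Suc n\<close>
    of monomials.\<close>
  define C where "C = D * Suc n + 1"
  define t where "t = card S * C ^ n"
  define T where "T = Suc n * t"
  define B where "B = ({..n} \<rightarrow>\<^sub>E {..t})"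
  \<comment> \<open>The first \<open>n + 1\<close> exponents range over a box of side
    \<open>t\<close>; the last one fills up the total degree, which is possible because
    \<open>T\<close> is the largest sum in the box.\<close>
  define ext where "ext \<beta> i = (if i \<le> n then \<beta> i else if i = Suc n then T - (\<Sum>i\<le>n. \<beta> i) else 0)"
    for \<beta> :: "nat \<Rightarrow> nat" and i
  define E where "E = ext ` B"
  have finE: "finite E" by (simp add: E_def B_def finite_PiE)
  have "inj_on ext B"
  proof (rule inj_onI)
    fix \<beta> \<gamma> assume *: "\<beta> \<in> B" "\<gamma> \<in> B" "ext \<beta> = ext \<gamma>"
    have "\<beta> i = \<gamma> i" if "i \<le> n" for i
      using that fun_cong[OF *(3), of i] by (simp add: ext_def)
    then show "\<beta> = \<gamma>" using * by (intro PiE_ext) (auto simp: B_def)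
  qed
  then have cardE: "card E = (t + 1) ^ Suc n"
    by (simp add: E_def card_image B_def card_PiE)
  have sumE: "(\<Sum>i\<le>Suc n. \<alpha> i) = T" if mem: "\<alpha> \<in> E" for \<alpha>
  proof -
    obtain \<beta> where \<beta>: "\<beta> \<in> B" "\<alpha> = ext \<beta>" using mem unfolding E_def by blast
    have "(\<Sum>i\<le>n. \<beta> i) \<le> (\<Sum>i\<le>n. t)"
      using \<beta> by (intro sum_mono) (auto simp: B_def PiE_iff)
    then have le: "(\<Sum>i\<le>n. \<beta> i) \<le> T" by (simp add: T_def)
    have "(\<Sum>i\<le>n. \<alpha> i) = (\<Sum>i\<le>n. \<beta> i)"
      by (intro sum.cong) (auto simp: \<beta> ext_def)
    then show ?thesis using le by (simp add: \<beta>(2) ext_def)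
  qed
  have "polyfun n (D * T) (\<lambda>x. \<Prod>i\<le>Suc n. f s i x ^ \<alpha> i)" if "\<alpha> \<in> E" "s \<in> S" for \<alpha> s
  proof -
    have "polyfun n (\<Sum>i\<le>Suc n. D * \<alpha> i) (\<lambda>x. \<Prod>i\<le>Suc n. f s i x ^ \<alpha> i)"
      using that D by (intro polyfun_prod polyfun_power) auto
    then show ?thesis by (simp only: sum_distrib_left[symmetric] sumE[OF that(1)])
  qed
  then have "\<forall>\<alpha> s. \<exists>h. \<alpha> \<in> E \<longrightarrow> s \<in> S \<longrightarrow> (\<forall>x. (\<Prod>i\<le>Suc n. f s i x ^ \<alpha> i) =
      (\<Sum>\<beta>\<in>{..<n} \<rightarrow>\<^sub>E {..D * T}. h \<beta> * (\<Prod>i<n. x i ^ \<beta> i)))"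
    unfolding polyfun_def by blast
  then have "\<exists>g. \<forall>\<alpha> s. \<alpha> \<in> E \<longrightarrow> s \<in> S \<longrightarrow> (\<forall>x. (\<Prod>i\<le>Suc n. f s i x ^ \<alpha> i) =
      (\<Sum>\<beta>\<in>{..<n} \<rightarrow>\<^sub>E {..D * T}. g \<alpha> s \<beta> * (\<Prod>i<n. x i ^ \<beta> i)))"
    by (simp only: choice_iff)
  then obtain g where g: "\<And>\<alpha> s x. \<alpha> \<in> E \<Longrightarrow> s \<in> S \<Longrightarrow> (\<Prod>i\<le>Suc n. f s i x ^ \<alpha> i) =
      (\<Sum>\<beta>\<in>{..<n} \<rightarrow>\<^sub>E {..D * T}. g \<alpha> s \<beta> * (\<Prod>i<n. x i ^ \<beta> i))"
    by blast
  let ?R = "S \<times> ({..<n} \<rightarrow>\<^sub>E {..D * T})"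
  have "card ?R = card S * (D * T + 1) ^ n"
    by (simp add: card_cartesian_product card_PiE)
  also have "\<dots> \<le> card S * (C * (t + 1)) ^ n"
    by (intro mult_left_mono power_mono) (auto simp: C_def T_def algebra_simps)
  also have "\<dots> = t * (t + 1) ^ n" unfolding power_mult_distrib by (simp add: t_def)
  also have "\<dots> < card E" by (simp add: cardE)
  finally have card: "card ?R < card E" .
  have "finite ?R" using assms by (simp add: finite_PiE)
  from underdetermined_system[OF this finE card, of "\<lambda>\<alpha> (s, \<beta>). g \<alpha> s \<beta>"]
  obtain c where c: "\<exists>\<alpha>\<in>E. c \<alpha> \<noteq> 0" "\<forall>b\<in>?R. (\<Sum>\<alpha>\<in>E. c \<alpha> * (case b of (s, \<beta>) \<Rightarrow> g \<alpha> s \<beta>)) = 0"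
    by blast
  have "(\<Sum>\<alpha>\<in>E. c \<alpha> * (\<Prod>i\<le>Suc n. f s i x ^ \<alpha> i)) = 0" if "s \<in> S" for s x
  proof -
    have "(\<Sum>\<alpha>\<in>E. c \<alpha> * (\<Prod>i\<le>Suc n. f s i x ^ \<alpha> i)) =
      (\<Sum>\<alpha>\<in>E. \<Sum>\<beta>\<in>{..<n} \<rightarrow>\<^sub>E {..D * T}. (c \<alpha> * g \<alpha> s \<beta>) * (\<Prod>i<n. x i ^ \<beta> i))"
      using that by (intro sum.cong refl) (simp only: g sum_distrib_left mult.assoc)
    also have "\<dots> = (\<Sum>\<beta>\<in>{..<n} \<rightarrow>\<^sub>E {..D * T}. (\<Sum>\<alpha>\<in>E. c \<alpha> * g \<alpha> s \<beta>) * (\<Prod>i<n. x i ^ \<beta> i))"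
      by (subst sum.swap) (simp add: sum_distrib_right)
    also have "\<dots> = 0" using c(2) that by (intro sum.neutral) force
    finally show ?thesis .
  qed
  moreover have "\<alpha> i = 0" if "\<alpha> \<in> E" "i > Suc n" for \<alpha> i
    using that by (auto simp: E_def ext_def)
  moreover obtain \<alpha> where "\<alpha> \<in> E" "c \<alpha> \<noteq> 0" using c(1) by blast
  ultimately show thesis using that[OF finE sumE] by blast
qed

section \<open>Chains of irreducible closed sets\<close>

text \<open>Unlike \<open>homogeneous\<close>, this fixes the degree, so that forms of equal degree
  can be added, and it speaks of the function, so that no polynomial identities are needed.\<close>

definition hform :: "nat \<Rightarrow> (('v \<Rightarrow> 'a::comm_ring_1) \<Rightarrow> 'a) \<Rightarrow> bool" where
  "hform e f \<longleftrightarrow>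
     (\<exists>p. (\<forall>m\<in>Poly_Mapping.keys p. sum (Poly_Mapping.lookup m) (Poly_Mapping.keys m) = e) \<and>
          f = peval p)"

lemma peval_superset:
  assumes "finite X" "Poly_Mapping.keys p \<subseteq> X"
  shows "peval p x = (\<Sum>m\<in>X. Poly_Mapping.lookup p m * mon_eval m x)"
  unfolding peval_def using assms
  by (intro sum.mono_neutral_left) (auto simp: in_keys_iff)

lemma mon_eval_superset:
  assumes "finite X" "Poly_Mapping.keys m \<subseteq> X"
  shows "mon_eval m x = (\<Prod>v\<in>X. x v ^ Poly_Mapping.lookup m v)"
  unfolding mon_eval_def using assms
  by (intro prod.mono_neutral_left) (auto simp: in_keys_iff)

lemma peval_add: "peval (p + q) x = peval p x + peval q x"
proof -
  let ?X = "Poly_Mapping.keys p \<union> Poly_Mapping.keys q"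
  have "Poly_Mapping.keys (p + q) \<subseteq> ?X" by (rule keys_add)
  then show ?thesis
    using peval_superset[of ?X "p + q" x] peval_superset[of ?X p x] peval_superset[of ?X q x]
    by (simp add: lookup_add algebra_simps sum.distrib)
qed

lemma peval_single: "peval (Poly_Mapping.single m a) x = a * mon_eval m x"
  using peval_superset[of "{m}" "Poly_Mapping.single m a" x] by (simp split: if_splits)

lemma mon_eval_add: "mon_eval (m + m') x = mon_eval m x * mon_eval m' x"
proof -
  let ?X = "Poly_Mapping.keys m \<union> Poly_Mapping.keys m'"
  have "Poly_Mapping.keys (m + m') \<subseteq> ?X" by (rule keys_add)
  then show ?thesis
    using mon_eval_superset[of ?X "m + m'" x] mon_eval_superset[of ?X m x]
      mon_eval_superset[of ?X m' x]
    by (simp add: lookup_add power_add prod.distrib)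
qed

lemma monomial_degree_superset:
  assumes "finite X" "Poly_Mapping.keys m \<subseteq> X"
  shows "sum (Poly_Mapping.lookup m) (Poly_Mapping.keys m) = (\<Sum>v\<in>X. Poly_Mapping.lookup m v)"
  using assms by (intro sum.mono_neutral_left) (auto simp: in_keys_iff)

lemma monomial_degree_add:
  "sum (Poly_Mapping.lookup (m + m')) (Poly_Mapping.keys (m + m')) =
     sum (Poly_Mapping.lookup m) (Poly_Mapping.keys m) +
     sum (Poly_Mapping.lookup m') (Poly_Mapping.keys (m' :: 'v \<Rightarrow>\<^sub>0 nat))"
proof -
  let ?X = "Poly_Mapping.keys m \<union> Poly_Mapping.keys m'"
  have "Poly_Mapping.keys (m + m') \<subseteq> ?X" by (rule keys_add)
  then show ?thesis
    using monomial_degree_superset[of ?X "m + m'"] monomial_degree_superset[of ?X m]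
      monomial_degree_superset[of ?X m']
    by (simp add: lookup_add sum.distrib)
qed

lemma hform_homogeneous: "hform e f \<Longrightarrow> \<exists>p. homogeneous p \<and> f = peval p"
  unfolding hform_def homogeneous_def by blast

lemma homogeneous_hform: "homogeneous p \<Longrightarrow> \<exists>e. hform e (peval p)"
  unfolding hform_def homogeneous_def by blast

lemma hform_zero: "hform e (\<lambda>_. 0)"
  unfolding hform_def by (intro exI[of _ 0]) (auto simp: peval_def)

lemma hform_add:
  assumes "hform e f" "hform e g"
  shows "hform e (\<lambda>x. f x + g x)"
proof -
  obtain p q where
    p: "\<forall>m\<in>Poly_Mapping.keys p. sum (Poly_Mapping.lookup m) (Poly_Mapping.keys m) = e" "f = peval p"
    and q: "\<forall>m\<in>Poly_Mapping.keys q. sum (Poly_Mapping.lookup m) (Poly_Mapping.keys m) = e" "g = peval q"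
    using assms unfolding hform_def by blast
  then show ?thesis unfolding hform_def
    using keys_add[of p q] by (intro exI[of _ "p + q"]) (auto simp: peval_add)
qed

lemma hform_sum: "(\<And>i. i \<in> A \<Longrightarrow> hform e (f i)) \<Longrightarrow> hform e (\<lambda>x. \<Sum>i\<in>A. f i x)"
  by (induction A rule: infinite_finite_induct) (auto intro: hform_zero hform_add)

lemma hform_monomial:
  "hform (sum (Poly_Mapping.lookup m) (Poly_Mapping.keys m)) (\<lambda>x. a * mon_eval m x)"
  unfolding hform_def
  by (intro exI[of _ "Poly_Mapping.single m a"]) (auto simp: fun_eq_iff peval_single simp del: single_zero)

lemma hform_mult:
  assumes "hform e f" "hform e' g"
  shows "hform (e + e') (\<lambda>x. f x * g x)"
proof -
  obtain p q where
    p: "\<forall>m\<in>Poly_Mapping.keys p. sum (Poly_Mapping.lookup m) (Poly_Mapping.keys m) = e" "f = peval p"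
    and q: "\<forall>m\<in>Poly_Mapping.keys q. sum (Poly_Mapping.lookup m) (Poly_Mapping.keys m) = e'" "g = peval q"
    using assms unfolding hform_def by blast
  have "hform (e + e') (\<lambda>x. (Poly_Mapping.lookup p m * Poly_Mapping.lookup q m') * mon_eval (m + m') x)"
    if "m \<in> Poly_Mapping.keys p" "m' \<in> Poly_Mapping.keys q" for m m'
    using hform_monomial[of "m + m'"] p(1) q(1) that by (simp add: monomial_degree_add)
  then have "hform (e + e') (\<lambda>x. \<Sum>m\<in>Poly_Mapping.keys p. \<Sum>m'\<in>Poly_Mapping.keys q.
      (Poly_Mapping.lookup p m * Poly_Mapping.lookup q m') * mon_eval (m + m') x)"
    by (intro hform_sum) auto
  moreover have "f x * g x = (\<Sum>m\<in>Poly_Mapping.keys p. \<Sum>m'\<in>Poly_Mapping.keys q.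
      (Poly_Mapping.lookup p m * Poly_Mapping.lookup q m') * mon_eval (m + m') x)" for x
    unfolding p(2) q(2) peval_def sum_product
    by (intro sum.cong refl) (simp add: mon_eval_add mult_ac)
  ultimately show ?thesis by presburger
qed

lemma hform_const: "hform 0 (\<lambda>_. a)"
  using hform_monomial[of 0 a] by (simp add: mon_eval_def)

lemma hform_scale: "hform e f \<Longrightarrow> hform e (\<lambda>x. a * f x)"
  using hform_mult[OF hform_const] by fastforce

lemma hform_var: "hform 1 (\<lambda>x. x v)"
  using hform_monomial[of "Poly_Mapping.single v 1" 1] by (simp add: mon_eval_def)

lemma hform_power: "hform e f \<Longrightarrow> hform (e * k) (\<lambda>x. f x ^ k)"
  by (induction k) (auto intro: hform_const hform_mult)

lemma hform_prod:
  "(\<And>i. i \<in> A \<Longrightarrow> hform (e i) (f i)) \<Longrightarrow> hform (\<Sum>i\<in>A. e i) (\<lambda>x. \<Prod>i\<in>A. f i x)"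
  by (induction A rule: infinite_finite_induct) (auto intro: hform_const hform_mult)

lemma hform_scaling:
  assumes "hform e f"
  shows "f (\<lambda>v. a * x v) = a ^ e * f x"
proof -
  obtain p where
    p: "\<forall>m\<in>Poly_Mapping.keys p. sum (Poly_Mapping.lookup m) (Poly_Mapping.keys m) = e" "f = peval p"
    using assms unfolding hform_def by blast
  have "mon_eval m (\<lambda>v. a * x v) = a ^ e * mon_eval m x" if "m \<in> Poly_Mapping.keys p" for m
    unfolding mon_eval_def p(1)[rule_format, OF that, symmetric] power_sum
    by (simp add: power_mult_distrib prod.distrib)
  then show ?thesis
    unfolding p(2) peval_def by (simp add: sum_distrib_left mult_ac)
qed

lemma hform_polynomial_map:
  assumes "hform e f" "\<And>v. polynomial_map n (\<lambda>x. \<phi> x v)"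
  shows "polynomial_map n (\<lambda>x. f (\<phi> x))"
proof -
  obtain p where "f = peval p" using assms(1) unfolding hform_def by blast
  then show ?thesis using assms(2) unfolding peval_def mon_eval_def
    by (auto intro!: polynomial_map_sum polynomial_map_mult polynomial_map_const
        polynomial_map_prod polynomial_map_power)
qed

lemma hform_combination:
  assumes "\<And>i. i \<le> n \<Longrightarrow> hform e (f i)" "\<And>\<alpha>. \<alpha> \<in> E \<Longrightarrow> (\<Sum>i\<le>n. \<alpha> i) = T"
  shows "hform (e * T) (\<lambda>x. \<Sum>\<alpha>\<in>E. c \<alpha> * (\<Prod>i\<le>n. f i x ^ \<alpha> i))"
proof (intro hform_sum hform_scale)
  fix \<alpha> assume "\<alpha> \<in> E"
  have "hform (\<Sum>i\<le>n. e * \<alpha> i) (\<lambda>x. \<Prod>i\<le>n. f i x ^ \<alpha> i)"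
    using assms(1) by (intro hform_prod hform_power) auto
  then show "hform (e * T) (\<lambda>x. \<Prod>i\<le>n. f i x ^ \<alpha> i)"
    by (simp only: sum_distrib_left[symmetric] assms(2)[OF \<open>\<alpha> \<in> E\<close>])
qed

section \<open>Closed and irreducible subsets of the cone\<close>

lemma proj_closed_subset_cone: "proj_closed V A \<Longrightarrow> A \<subseteq> cone_pts V"
  unfolding proj_closed_def by auto

lemma proj_closed_zeros:
  assumes "proj_closed V A" "hform e f"
  shows "proj_closed V {x \<in> A. f x = 0}"
proof -
  obtain P where P: "\<forall>p\<in>P. homogeneous p" "A = {x \<in> cone_pts V. \<forall>p\<in>P. peval p x = 0}"
    using assms(1) unfolding proj_closed_def by blast
  obtain q where "homogeneous q" "f = peval q" using hform_homogeneous[OF assms(2)] by blast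
  then show ?thesis unfolding proj_closed_def using P
    by (intro exI[of _ "insert q P"]) auto
qed

lemma proj_closed_cone: "proj_closed V (cone_pts V)"
  unfolding proj_closed_def by (intro exI[of _ "{}"]) auto

lemma proj_closed_separate:
  assumes "proj_closed V A" "x \<in> cone_pts V" "x \<notin> A"
  shows "\<exists>e f. hform e f \<and> (\<forall>y\<in>A. f y = 0) \<and> f x \<noteq> 0"
proof -
  obtain P where P: "\<forall>p\<in>P. homogeneous p" "A = {x \<in> cone_pts V. \<forall>p\<in>P. peval p x = 0}"
    using assms(1) unfolding proj_closed_def by blast
  then obtain p where "p \<in> P" "peval p x \<noteq> 0" using assms by blast
  then show ?thesis using P homogeneous_hform by blast
qed

lemma proj_irred_closed: "proj_irred V A \<Longrightarrow> proj_closed V A"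
  unfolding proj_irred_def by (rule conjunct1)

lemma proj_irred_nonempty: "proj_irred V A \<Longrightarrow> A \<noteq> {}"
  unfolding proj_irred_def by (elim conjE)

text \<open>The homogeneous vanishing ideal of an irreducible set is prime; the chain argument uses
  irreducibility in this shape.\<close>

lemma proj_irred_mult:
  assumes "proj_irred V Z" "hform e f" "hform e' g" "\<And>x. x \<in> Z \<Longrightarrow> f x * g x = 0"
  shows "(\<forall>x\<in>Z. f x = 0) \<or> (\<forall>x\<in>Z. g x = (0::'a::idom))"
proof -
  have Z: "proj_closed V Z" using assms(1) by (rule proj_irred_closed)
  have "Z = {x\<in>Z. f x = 0} \<union> {x\<in>Z. g x = 0}" using assms(4) by force
  then have "Z = {x\<in>Z. f x = 0} \<or> Z = {x\<in>Z. g x = 0}"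
    using assms(1) proj_closed_zeros[OF Z] assms(2,3) unfolding proj_irred_def by blast
  then show ?thesis by blast
qed

lemma proj_closure_vanish:
  assumes "S \<subseteq> cone_pts V" "hform e f" "\<And>x. x \<in> S \<Longrightarrow> f x = 0" "x \<in> proj_closure V S"
  shows "f x = 0"
proof -
  have "proj_closed V {x \<in> cone_pts V. f x = 0}"
    using proj_closed_zeros[OF proj_closed_cone assms(2)] by simp
  then show ?thesis using assms unfolding proj_closure_def by blast
qed

section \<open>Chains and algebraic independence\<close>

text \<open>Induction along the chain. From a relation on \<open>Z (Suc n)\<close> the lowest power
  of \<open>f (Suc n)\<close> is divided off, as irreducibility permits; on \<open>Z n\<close> the
  cofactor keeps only the terms of lowest exponent, which is a relation among the earlier
  forms.\<close>

lemma chain_monomials_independent: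
  fixes f :: "nat \<Rightarrow> ('v \<Rightarrow> 'a::field) \<Rightarrow> 'a"
  assumes "\<And>i. i \<le> n \<Longrightarrow> proj_irred V (Z i)"
    and "\<And>i. i \<le> n \<Longrightarrow> hform e (f i)"
    and "\<And>i. i \<le> n \<Longrightarrow> \<exists>x\<in>Z i. f i x \<noteq> 0"
    and "\<And>i. i < n \<Longrightarrow> Z i \<subseteq> Z (Suc i)"
    and "\<And>i x. i < n \<Longrightarrow> x \<in> Z i \<Longrightarrow> f (Suc i) x = 0"
    and "finite E" "\<And>\<alpha>. \<alpha> \<in> E \<Longrightarrow> (\<Sum>i\<le>n. \<alpha> i) = T"
    and "inj_on (\<lambda>\<alpha>. restrict \<alpha> {..n}) E"
    and "\<And>x. x \<in> Z n \<Longrightarrow> (\<Sum>\<alpha>\<in>E. c \<alpha> * (\<Prod>i\<le>n. f i x ^ \<alpha> i)) = 0"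
    and "\<alpha> \<in> E"
  shows "c \<alpha> = 0"
  using assms
proof (induction n arbitrary: E T \<alpha>)
  case 0
  have "restrict \<beta> {..0} = restrict \<alpha> {..0}" if "\<beta> \<in> E" for \<beta>
    using "0.prems"(7)[OF that] "0.prems"(7)[OF \<open>\<alpha> \<in> E\<close>] by (auto simp: restrict_def)
  then have "E = {\<alpha>}"
    using "0.prems"(8,10) unfolding inj_on_def by blast
  moreover obtain x where "x \<in> Z 0" "f 0 x \<noteq> 0" using "0.prems"(3) by blast
  ultimately show ?case using "0.prems"(9)[of x] by simp
next
  case (Suc n)
  show ?case
  proof (rule ccontr)
    assume "c \<alpha> \<noteq> 0"
    define S where "S = {\<alpha>\<in>E. c \<alpha> \<noteq> 0}"
    have S: "finite S" "\<alpha> \<in> S" using Suc.prems(6,10) \<open>c \<alpha> \<noteq> 0\<close> by (auto simp: S_def)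
    \<comment> \<open>\<open>k\<close> is the lowest exponent of the last form among the terms with
      nonzero coefficient; \<open>g\<close> below is the cofactor of its \<open>k\<close>-th
      power.\<close>
    define k where "k = Min ((\<lambda>\<alpha>. \<alpha> (Suc n)) ` S)"
    have kmin: "k \<le> \<beta> (Suc n)" if "\<beta> \<in> S" for \<beta>
      using S that by (auto simp: k_def)
    have "k \<in> (\<lambda>\<alpha>. \<alpha> (Suc n)) ` S"
      unfolding k_def using S by (intro Min_in) auto
    then obtain \<gamma> where \<gamma>: "\<gamma> \<in> S" "\<gamma> (Suc n) = k" by auto
    define g where "g x = (\<Sum>\<beta>\<in>S. c \<beta> * (\<Prod>i\<le>Suc n. f i x ^ (\<beta>(Suc n := \<beta> (Suc n) - k)) i))" for x
    have degT: "(\<Sum>i\<le>Suc n. (\<beta>(Suc n := \<beta> (Suc n) - k)) i) = T - k" if "\<beta> \<in> S" for \<beta>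
    proof -
      have "(\<Sum>i\<le>n. (\<beta>(Suc n := \<beta> (Suc n) - k)) i) = (\<Sum>i\<le>n. \<beta> i)"
        by (intro sum.cong) auto
      then show ?thesis using Suc.prems(7)[of \<beta>] kmin[OF that] that by (simp add: S_def)
    qed
    have g: "hform (e * (T - k)) g"
    proof -
      have "hform (e * (T - k))
          (\<lambda>x. \<Sum>\<beta>'\<in>S. c \<beta>' * (\<Prod>i\<le>Suc n. f i x ^ (\<beta>'(Suc n := \<beta>' (Suc n) - k)) i))"
      proof (intro hform_sum hform_scale)
        fix \<beta> assume "\<beta> \<in> S"
        have "hform (\<Sum>i\<le>Suc n. e * (\<beta>(Suc n := \<beta> (Suc n) - k)) i)
            (\<lambda>x. \<Prod>i\<le>Suc n. f i x ^ (\<beta>(Suc n := \<beta> (Suc n) - k)) i)"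
          using Suc.prems(2) by (intro hform_prod hform_power) auto
        then show "hform (e * (T - k)) (\<lambda>x. \<Prod>i\<le>Suc n. f i x ^ (\<beta>(Suc n := \<beta> (Suc n) - k)) i)"
          by (simp only: sum_distrib_left[symmetric] degT[OF \<open>\<beta> \<in> S\<close>])
      qed
      then show ?thesis unfolding g_def .
    qed
    have prod_eq: "(\<Prod>i\<le>Suc n. f i x ^ (\<beta>(Suc n := j)) i) = (\<Prod>i\<le>n. f i x ^ \<beta> i) * f (Suc n) x ^ j"
      for x \<beta> j
    proof -
      have "(\<Prod>i\<le>n. f i x ^ (\<beta>(Suc n := j)) i) = (\<Prod>i\<le>n. f i x ^ \<beta> i)"
        by (intro prod.cong) auto
      then show ?thesis by simp
    qed
    have "f (Suc n) x ^ k * g x = 0" if "x \<in> Z (Suc n)" for x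
    proof -
      have "f (Suc n) x ^ k * g x = (\<Sum>\<beta>\<in>S. c \<beta> * (\<Prod>i\<le>Suc n. f i x ^ \<beta> i))"
        unfolding g_def sum_distrib_left
      proof (intro sum.cong refl)
        fix \<beta> assume "\<beta> \<in> S"
        have "f (Suc n) x ^ k * f (Suc n) x ^ (\<beta> (Suc n) - k) = f (Suc n) x ^ \<beta> (Suc n)"
          using kmin[OF \<open>\<beta> \<in> S\<close>] by (simp flip: power_add)
        then show "f (Suc n) x ^ k * (c \<beta> * (\<Prod>i\<le>Suc n. f i x ^ (\<beta>(Suc n := \<beta> (Suc n) - k)) i)) =
            c \<beta> * (\<Prod>i\<le>Suc n. f i x ^ \<beta> i)"
          unfolding prod_eq by (simp add: mult_ac)
      qed
      also have "\<dots> = (\<Sum>\<beta>\<in>E. c \<beta> * (\<Prod>i\<le>Suc n. f i x ^ \<beta> i))"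
        using Suc.prems(6) by (intro sum.mono_neutral_left) (auto simp: S_def)
      finally show ?thesis using Suc.prems(9)[OF that] by simp
    qed
    moreover have "hform (e * k) (\<lambda>x. f (Suc n) x ^ k)"
      using Suc.prems(2) by (intro hform_power) auto
    ultimately have "(\<forall>x\<in>Z (Suc n). f (Suc n) x ^ k = 0) \<or> (\<forall>x\<in>Z (Suc n). g x = 0)"
      using g Suc.prems(1)[of "Suc n"] by (intro proj_irred_mult) auto
    moreover obtain y where "y \<in> Z (Suc n)" "f (Suc n) y \<noteq> 0"
      using Suc.prems(3)[of "Suc n"] by auto
    ultimately have g0: "\<forall>x\<in>Z (Suc n). g x = 0" by auto
    define E' where "E' = {\<beta>\<in>S. \<beta> (Suc n) = k}"
    have finE': "finite E'" using S by (simp add: E'_def)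
    have "(\<Sum>\<beta>\<in>E'. c \<beta> * (\<Prod>i\<le>n. f i x ^ \<beta> i)) = 0" if x: "x \<in> Z n" for x
    proof -
      \<comment> \<open>Terms with a positive remaining exponent vanish on \<open>Z n\<close>; those
        with exponent 0 survive, because \<open>0 ^ 0 = 1\<close>.\<close>
      have fx: "f (Suc n) x = 0" using Suc.prems(5) x by blast
      have "g x = (\<Sum>\<beta>\<in>S. if \<beta> (Suc n) = k then c \<beta> * (\<Prod>i\<le>n. f i x ^ \<beta> i) else 0)"
        unfolding g_def prod_eq using kmin
        by (intro sum.cong) (auto simp: fx power_0_left dest: le_antisym)
      also have "\<dots> = (\<Sum>\<beta>\<in>E'. c \<beta> * (\<Prod>i\<le>n. f i x ^ \<beta> i))"
        using S(1) by (simp add: E'_def sum.inter_filter)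
      finally show ?thesis using g0 x Suc.prems(4)[of n] by auto
    qed
    moreover have "inj_on (\<lambda>\<beta>. restrict \<beta> {..n}) E'"
    proof (rule inj_onI)
      fix \<beta> \<delta> assume *: "\<beta> \<in> E'" "\<delta> \<in> E'" "restrict \<beta> {..n} = restrict \<delta> {..n}"
      have "\<beta> i = \<delta> i" if "i \<le> Suc n" for i
        using that *(1,2) fun_cong[OF *(3), of i]
        by (cases "i = Suc n") (auto simp: E'_def)
      then have "restrict \<beta> {..Suc n} = restrict \<delta> {..Suc n}"
        by (auto simp: restrict_def)
      then show "\<beta> = \<delta>" using * Suc.prems(8) unfolding inj_on_def E'_def S_def by blast
    qed
    moreover have "(\<Sum>i\<le>n. \<beta> i) = T - k" if "\<beta> \<in> E'" for \<beta>
      using that Suc.prems(7)[of \<beta>] by (auto simp: E'_def S_def)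
    moreover have "\<gamma> \<in> E'" using \<gamma> by (simp add: E'_def)
    ultimately have "c \<gamma> = 0"
      by (intro Suc.IH[OF Suc.prems(1)[OF le_SucI] Suc.prems(2)[OF le_SucI]
            Suc.prems(3)[OF le_SucI] Suc.prems(4)[OF less_SucI] Suc.prems(5)[OF less_SucI] finE',
            where T = "T - k"])
    then show False using \<gamma> by (simp add: S_def)
  qed
qed

text \<open>Relations have one total degree, so that each is itself a form. Exponents are functions
  on all naturals; demanding zeros beyond \<open>n\<close> makes distinct elements of
  \<open>E\<close> distinct monomials.\<close>

definition forms_independent ::
    "nat \<Rightarrow> (nat \<Rightarrow> ('v \<Rightarrow> 'a::field) \<Rightarrow> 'a) \<Rightarrow> ('v \<Rightarrow> 'a) set \<Rightarrow> bool" where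
  "forms_independent n f A \<longleftrightarrow>
    (\<forall>T E c. finite E \<longrightarrow> (\<forall>\<alpha>\<in>E. (\<Sum>i\<le>n. \<alpha> i) = T) \<longrightarrow> (\<forall>\<alpha>\<in>E. \<forall>i>n. \<alpha> i = 0) \<longrightarrow>
      (\<forall>x\<in>A. (\<Sum>\<alpha>\<in>E. c \<alpha> * (\<Prod>i\<le>n. f i x ^ \<alpha> i)) = 0) \<longrightarrow> (\<forall>\<alpha>\<in>E. c \<alpha> = 0))"

text \<open>The form for the bottom of the chain is a coordinate; each later one comes from
  separating a point of \<open>Z i\<close> from the preceding set. Passing to powers gives all of
  them the common degree \<open>D\<close>, the product of the degrees, without changing where they
  vanish.\<close>

lemma irred_chain_independent_forms:
  fixes A :: "('v \<Rightarrow> 'a::field) set"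
  assumes "irred_chain V A n"
  shows "\<exists>e f. (\<forall>i\<le>n. hform e (f i)) \<and> forms_independent n f A"
proof -
  from assms obtain Z :: "nat \<Rightarrow> ('v \<Rightarrow> 'a) set" where
    Z0: "(\<forall>i\<le>n. proj_irred V (Z i)) \<and> (\<forall>i<n. Z i \<subset> Z (Suc i)) \<and> Z n \<subseteq> A"
    unfolding irred_chain_def by (rule exE)
  then have Z: "\<And>i. i \<le> n \<Longrightarrow> proj_irred V (Z i)"
    "\<And>i. i < n \<Longrightarrow> Z i \<subset> Z (Suc i)" "Z n \<subseteq> A"
    by simp_all
  have Zcone: "Z i \<subseteq> cone_pts V" if "i \<le> n" for i
    using Z(1)[OF that] by (intro proj_closed_subset_cone proj_irred_closed)
  have Zne: "Z i \<noteq> {}" if "i \<le> n" for i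
    using Z(1)[OF that] by (rule proj_irred_nonempty)
  have "\<exists>e f. hform e f \<and> 0 < e \<and> (\<exists>x\<in>Z i. f x \<noteq> 0) \<and> (\<forall>j. i = Suc j \<longrightarrow> (\<forall>x\<in>Z j. f x = 0))"
    if "i \<le> n" for i
  proof (cases i)
    case 0
    obtain x where x: "x \<in> Z 0" using Zne[of 0] by auto
    then have "x \<noteq> (\<lambda>_. 0)" using Zcone[of 0] by (auto simp: cone_pts_def)
    then obtain v where "x v \<noteq> 0" by auto
    then show ?thesis using x 0 hform_var[of v] by (intro exI[of _ 1] exI[of _ "\<lambda>x. x v"]) auto
  next
    case (Suc j)
    then have "Z j \<subset> Z i" using Z(2) that by auto
    then obtain x where x: "x \<in> Z i" "x \<notin> Z j" by blast
    have "proj_closed V (Z j)" using that Suc by (intro proj_irred_closed Z(1)) auto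
    then obtain e f where f: "hform e f" "\<forall>y\<in>Z j. f y = 0" "f x \<noteq> 0"
      using proj_closed_separate[of V "Z j" x] x Zcone[of i] \<open>i \<le> n\<close> by blast
    \<comment> \<open>A form of degree 0 is constant and would be 0 at \<open>x\<close> as well.
      Positive degrees are what allows the degrees to be equalised by powers.\<close>
    have "e \<noteq> 0"
    proof
      assume "e = 0"
      obtain y where "y \<in> Z j" using Zne[of j] \<open>i \<le> n\<close> Suc by auto
      then have "f y = 0" using f by blast
      then show False
        using hform_scaling[OF f(1), of 0 x] hform_scaling[OF f(1), of 0 y] f(3) \<open>e = 0\<close> by simp
    qed
    then show ?thesis using f x Suc by blast
  qed
  then obtain e f where ef: "\<And>i. i \<le> n \<Longrightarrow> hform (e i) (f i)" "\<And>i. i \<le> n \<Longrightarrow> 0 < e i"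
    "\<And>i. i \<le> n \<Longrightarrow> \<exists>x\<in>Z i. f i x \<noteq> 0" "\<And>j x. Suc j \<le> n \<Longrightarrow> x \<in> Z j \<Longrightarrow> f (Suc j) x = 0"
    by metis
  define D where "D = (\<Prod>i\<le>n. e i)"
  have D: "e i dvd D" "D > 0" if "i \<le> n" for i
    using that ef(2) unfolding D_def by (auto intro!: dvd_prodI prod_pos)
  define k where "k i = D div e i" for i
  have k: "e i * k i = D" "k i > 0" if "i \<le> n" for i
    using D[OF that] ef(2)[OF that] by (auto simp: k_def dvd_imp_le div_greater_zero_iff)
  define g where "g i x = f i x ^ k i" for i x
  have g: "hform D (g i)" if "i \<le> n" for i
    using hform_power[OF ef(1)[OF that], of "k i"] k(1)[OF that] by (simp add: g_def[abs_def])
  have "\<forall>\<alpha>\<in>E. c \<alpha> = 0" if E: "finite E" "\<forall>\<alpha>\<in>E. (\<Sum>i\<le>n. \<alpha> i) = T" "\<forall>\<alpha>\<in>E. \<forall>i>n. \<alpha> i = 0"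
      "\<forall>x\<in>A. (\<Sum>\<alpha>\<in>E. c \<alpha> * (\<Prod>i\<le>n. g i x ^ \<alpha> i)) = 0" for T E c
  proof
    fix \<alpha> assume "\<alpha> \<in> E"
    have "inj_on (\<lambda>\<alpha>. restrict \<alpha> {..n}) E"
    proof (rule inj_onI)
      fix \<beta> \<delta> :: "nat \<Rightarrow> nat"
      assume *: "\<beta> \<in> E" "\<delta> \<in> E" "restrict \<beta> {..n} = restrict \<delta> {..n}"
      show "\<beta> = \<delta>"
      proof
        fix i show "\<beta> i = \<delta> i"
          using fun_cong[OF *(3), of i] E(3)[rule_format, OF *(1), of i] E(3)[rule_format, OF *(2), of i]
          by (cases "i \<le> n") auto
      qed
    qed
    then show "c \<alpha> = 0"
      using Z g E \<open>\<alpha> \<in> E\<close> ef(3,4) k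
      by (intro chain_monomials_independent[of n V Z D g E T c \<alpha>])
        (auto simp: g_def psubset_imp_subset)
  qed
  then have "forms_independent n g A" unfolding forms_independent_def by (intro allI impI)
  then show ?thesis using g by (intro exI[of _ D] exI[of _ g]) simp
qed

text \<open>Pulled back to every chart, the forms of a chain that is too long satisfy one common
  relation. Being homogeneous, it is insensitive to the scalar \<open>a\<close>, so it holds on
  \<open>S\<close> and then on the closure, against independence.\<close>

theorem not_irred_chain_of_charts:
  fixes \<phi> :: "'s \<Rightarrow> (nat \<Rightarrow> 'a::field) \<Rightarrow> 'v \<Rightarrow> 'a"
  assumes "finite I" "\<And>s v. s \<in> I \<Longrightarrow> polynomial_map n (\<lambda>x. \<phi> s x v)"
    and "S \<subseteq> cone_pts V"
    and "\<And>c. c \<in> S \<Longrightarrow> \<exists>s\<in>I. \<exists>x a. c = (\<lambda>v. a * \<phi> s x v)"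
  shows "\<not> irred_chain V (proj_closure V S) (Suc n)"
proof
  assume "irred_chain V (proj_closure V S) (Suc n)"
  from irred_chain_independent_forms[OF this] obtain e f where
    f: "\<And>i. i \<le> Suc n \<Longrightarrow> hform e (f i)" and
    indep: "forms_independent (Suc n) f (proj_closure V S)"
    by blast
  have "polynomial_map n (\<lambda>x. f i (\<phi> s x))" if "s \<in> I" "i \<le> Suc n" for s i
    using that assms(2) by (intro hform_polynomial_map[OF f]) auto
  then show False
  proof (rule polynomial_dependence[OF assms(1)])
    fix E T \<alpha> c assume
      E: "finite E" "\<And>\<alpha>. \<alpha> \<in> E \<Longrightarrow> (\<Sum>i\<le>Suc n. \<alpha> i) = T"
        "\<And>\<alpha> i. \<alpha> \<in> E \<Longrightarrow> i > Suc n \<Longrightarrow> \<alpha> i = 0" "\<alpha> \<in> E" "c \<alpha> \<noteq> (0::'a)"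
      and c: "\<And>s x. s \<in> I \<Longrightarrow> (\<Sum>\<alpha>\<in>E. c \<alpha> * (\<Prod>i\<le>Suc n. f i (\<phi> s x) ^ \<alpha> i)) = 0"
    define G where "G x = (\<Sum>\<alpha>\<in>E. c \<alpha> * (\<Prod>i\<le>Suc n. f i x ^ \<alpha> i))" for x
    have G: "hform (e * T) G"
      unfolding G_def[abs_def] using f E(2) by (intro hform_combination) auto
    have "G x = 0" if x: "x \<in> S" for x
    proof -
      obtain s y a where s: "s \<in> I" "x = (\<lambda>v. a * \<phi> s y v)" using assms(4)[OF x] by blast
      have "G (\<phi> s y) = 0" using c s(1) by (simp add: G_def)
      then show ?thesis unfolding s(2) hform_scaling[OF G] by simp
    qed
    then have "\<forall>x\<in>proj_closure V S. G x = 0"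
      using proj_closure_vanish[OF assms(3) G] by blast
    then have "c \<alpha> = 0"
      using E(1-4) unfolding G_def
      by (intro indep[unfolded forms_independent_def, rule_format, of E T c \<alpha>]) auto
    then show False using E(5) by blast
  qed
qed

section \<open>Closures of images of parameter spaces\<close>

text \<open>On the line joining \<open>x\<close> and \<open>y\<close> both functions are nonzero
  polynomials in \<open>t\<close>. This expresses the irreducibility of the parameter space.\<close>

lemma polynomial_map_common_nonzero:
  fixes f g :: "(nat \<Rightarrow> 'a::alg_closed_field) \<Rightarrow> 'a"
  assumes "polynomial_map n f" "polynomial_map n g" "f x \<noteq> 0" "g y \<noteq> 0"
  shows "\<exists>t. f (\<lambda>i. x i + t * (y i - x i)) \<noteq> 0 \<and> g (\<lambda>i. x i + t * (y i - x i)) \<noteq> 0"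
proof -
  obtain p where p: "\<And>t. f (\<lambda>i. x i + t * (y i - x i)) = poly p t"
    using polynomial_map_line[OF assms(1), of x "\<lambda>i. y i - x i"] by blast
  obtain q where q: "\<And>t. g (\<lambda>i. x i + t * (y i - x i)) = poly q t"
    using polynomial_map_line[OF assms(2), of x "\<lambda>i. y i - x i"] by blast
  have "p \<noteq> 0" using p[of 0] assms(3) by auto
  moreover have "q \<noteq> 0" using q[of 1] assms(4) by auto
  ultimately have "p * q \<noteq> 0" by simp
  then obtain t where "poly (p * q) t \<noteq> 0"
    using poly_eq_0_if_all_roots[of "p * q"] by blast
  then show ?thesis using p q by (intro exI[of _ t]) auto
qed

lemma finite_functional_hform: "finite_functional V h \<Longrightarrow> hform 1 h"
proof -
  assume "finite_functional V h"
  then obtain X m where "h = (\<lambda>f. \<Sum>b\<in>X. m b * f b)"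
    unfolding finite_functional_def by blast
  then show ?thesis by (simp only:) (intro hform_sum hform_scale hform_var)
qed

text \<open>Weighting the parameters, the leading terms of linear forms dual to \<open>u\<close> along the curve
  \<open>t \<mapsto> \<phi> (\<lambda>i. t ^ w i * x i)\<close> are powers of distinct parameters, hence algebraically
  independent.\<close>

lemma leading_terms_independent:
  fixes \<phi> :: "(nat \<Rightarrow> 'a::alg_closed_field) \<Rightarrow> 'v \<Rightarrow> 'a"
  assumes h: "\<And>i. i \<le> r \<Longrightarrow> finite_functional V (h i)"
    and dual: "\<And>i j. i \<le> r \<Longrightarrow> j \<le> N \<Longrightarrow> h i (u j) = (if i = j then 1 else 0)"
    and "r \<le> N" and e: "\<And>i. e i \<ge> 1"
    and expand: "\<And>x v. v \<in> V \<Longrightarrow> \<exists>p. \<forall>t. \<phi> (\<lambda>i. t ^ w i * x i) v =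
        u 0 v + t\<^sup>2 * ((\<Sum>i<N. x i ^ e i * u (Suc i) v) + t * poly p t)"
    and E: "finite E" "\<And>\<alpha>. \<alpha> \<in> E \<Longrightarrow> (\<Sum>i\<le>r. \<alpha> i) = T" "\<And>\<alpha> i. \<alpha> \<in> E \<Longrightarrow> i > r \<Longrightarrow> \<alpha> i = 0"
    and zero: "\<And>x. (\<forall>i\<ge>r. x i = 0) \<Longrightarrow> (\<Sum>\<alpha>\<in>E. c \<alpha> * (\<Prod>i\<le>r. h i (\<phi> x) ^ \<alpha> i)) = 0"
    and "\<alpha> \<in> E"
  shows "c \<alpha> = 0"
proof (rule ccontr)
  assume "c \<alpha> \<noteq> 0"
  define S where "S = {\<alpha>\<in>E. c \<alpha> \<noteq> 0}"
  have S: "finite S" "\<alpha> \<in> S" using E(1) \<open>\<alpha> \<in> E\<close> \<open>c \<alpha> \<noteq> 0\<close> by (auto simp: S_def)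
  \<comment> \<open>A monomial \<open>\<beta>\<close> has order at least
    \<open>2 * (T - \<beta> 0)\<close> in \<open>t\<close>, because only the slot 0 is of order 0.
    The lowest order thus belongs to the largest exponent \<open>A\<close> in that slot, and its
    coefficient is a polynomial in the \<open>x i\<close>.\<close>
  define A where "A = Max ((\<lambda>\<alpha>. \<alpha> 0) ` S)"
  have Amax: "\<beta> 0 \<le> A" if "\<beta> \<in> S" for \<beta> using S that by (auto simp: A_def)
  have "A \<in> (\<lambda>\<alpha>. \<alpha> 0) ` S" unfolding A_def using S by (intro Max_in) auto
  then obtain \<gamma> where \<gamma>: "\<gamma> \<in> S" "\<gamma> 0 = A" by auto
  have sumT: "(\<Sum>i<r. \<beta> (Suc i)) = T - \<beta> 0" "\<beta> 0 \<le> T" if "\<beta> \<in> E" for \<beta>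
    using E(2)[OF that] by (simp_all add: sum.atMost_shift)
  define E0 where "E0 = {\<beta>\<in>S. \<beta> 0 = A}"
  have "(\<Sum>\<beta>\<in>E0. c \<beta> * (\<Prod>i<r. x i ^ (e i * \<beta> (Suc i)))) = 0" for x :: "nat \<Rightarrow> 'a"
  proof -
    \<comment> \<open>Only the first \<open>r\<close> parameters are switched on, which keeps the
      point in the subspace where the relation is assumed.\<close>
    define x' where "x' i = (if i < r then x i else 0)" for i
    have "\<forall>v. \<exists>p. v \<in> V \<longrightarrow> (\<forall>t. \<phi> (\<lambda>i. t ^ w i * x' i) v =
        u 0 v + t\<^sup>2 * ((\<Sum>i<N. x' i ^ e i * u (Suc i) v) + t * poly p t))"
      using expand[of _ x'] by blast
    then have "\<exists>P. \<forall>v. v \<in> V \<longrightarrow> (\<forall>t. \<phi> (\<lambda>i. t ^ w i * x' i) v =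
        u 0 v + t\<^sup>2 * ((\<Sum>i<N. x' i ^ e i * u (Suc i) v) + t * poly (P v) t))"
      by (simp only: choice_iff)
    then obtain P where P: "\<And>v t. v \<in> V \<Longrightarrow> \<phi> (\<lambda>i. t ^ w i * x' i) v =
        u 0 v + t\<^sup>2 * ((\<Sum>i<N. x' i ^ e i * u (Suc i) v) + t * poly (P v) t)" by blast
    have "\<exists>R. \<forall>t. h j (\<phi> (\<lambda>i. t ^ w i * x' i)) =
        h j (u 0) + t\<^sup>2 * ((\<Sum>i<N. x' i ^ e i * h j (u (Suc i))) + t * poly R t)" if j: "j \<le> r" for j
    proof -
      obtain X m where X: "finite X" "X \<subseteq> V" "\<And>f. h j f = (\<Sum>b\<in>X. m b * f b)"
        using h[OF j] unfolding finite_functional_def by blast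
      have "h j (\<phi> (\<lambda>i. t ^ w i * x' i)) =
        h j (u 0) + t\<^sup>2 * ((\<Sum>i<N. x' i ^ e i * h j (u (Suc i))) + t * poly (\<Sum>b\<in>X. smult (m b) (P b)) t)"
        for t
      proof -
        have "h j (\<phi> (\<lambda>i. t ^ w i * x' i)) =
            (\<Sum>b\<in>X. m b * (u 0 b + t\<^sup>2 * ((\<Sum>i<N. x' i ^ e i * u (Suc i) b) + t * poly (P b) t)))"
          unfolding X(3) using X(2) by (intro sum.cong refl) (auto simp: P)
        also have "\<dots> = (\<Sum>b\<in>X. m b * u 0 b) +
            t\<^sup>2 * ((\<Sum>b\<in>X. m b * (\<Sum>i<N. x' i ^ e i * u (Suc i) b)) + t * (\<Sum>b\<in>X. m b * poly (P b) t))"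
          by (simp add: algebra_simps sum.distrib sum_distrib_left)
        also have "(\<Sum>b\<in>X. m b * (\<Sum>i<N. x' i ^ e i * u (Suc i) b)) = (\<Sum>i<N. x' i ^ e i * h j (u (Suc i)))"
          unfolding X(3)[symmetric] by (rule finite_functional_sum_apply[OF h[OF j]])
        finally show ?thesis by (simp add: X(3) poly_sum)
      qed
      then show ?thesis by blast
    qed
    then have "\<forall>j. \<exists>R. j \<le> r \<longrightarrow> (\<forall>t. h j (\<phi> (\<lambda>i. t ^ w i * x' i)) =
        h j (u 0) + t\<^sup>2 * ((\<Sum>i<N. x' i ^ e i * h j (u (Suc i))) + t * poly R t))" by blast
    then have "\<exists>R. \<forall>j. j \<le> r \<longrightarrow> (\<forall>t. h j (\<phi> (\<lambda>i. t ^ w i * x' i)) =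
        h j (u 0) + t\<^sup>2 * ((\<Sum>i<N. x' i ^ e i * h j (u (Suc i))) + t * poly (R j) t))"
      by (simp only: choice_iff)
    then obtain R where R: "\<And>j t. j \<le> r \<Longrightarrow> h j (\<phi> (\<lambda>i. t ^ w i * x' i)) =
        h j (u 0) + t\<^sup>2 * ((\<Sum>i<N. x' i ^ e i * h j (u (Suc i))) + t * poly (R j) t)" by blast
    \<comment> \<open>By duality \<open>h 0\<close> is 1 + O(t^3) along the curve and
      \<open>h (Suc i)\<close> is t^2 (x_i^(e_i) + O(t)); \<open>p\<close> collects these with the
      factor t^2 removed.\<close>
    define p where "p j = (case j of 0 \<Rightarrow> 1 + monom 1 3 * R 0
        | Suc i \<Rightarrow> [:x' i ^ e i:] + monom 1 1 * R j)" for j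
    have h0: "h 0 (\<phi> (\<lambda>i. t ^ w i * x' i)) = poly (p 0) t" for t
      using R[of 0 t] dual[of 0] by (simp add: p_def poly_monom power2_eq_square power3_eq_cube)
    have hSuc: "h (Suc j) (\<phi> (\<lambda>i. t ^ w i * x' i)) = t\<^sup>2 * poly (p (Suc j)) t" if "j < r" for j t
    proof -
      have "(\<Sum>i<N. x' i ^ e i * h (Suc j) (u (Suc i))) = (\<Sum>i<N. if i = j then x' i ^ e i else 0)"
        using that by (intro sum.cong) (auto simp: dual)
      also have "\<dots> = x' j ^ e j" using that \<open>r \<le> N\<close> by simp
      finally show ?thesis
        using R[of "Suc j" t] that dual[of "Suc j" 0] by (simp add: p_def poly_monom)
    qed
    define q where "q = (\<Sum>\<beta>\<in>E. smult (c \<beta>) (monom 1 (2 * (T - \<beta> 0)) * (\<Prod>i\<le>r. p i ^ \<beta> i)))"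
    have "poly q t = 0" for t
    proof -
      have "poly q t = (\<Sum>\<beta>\<in>E. c \<beta> * (\<Prod>i\<le>r. h i (\<phi> (\<lambda>i. t ^ w i * x' i)) ^ \<beta> i))"
        unfolding q_def poly_sum
      proof (intro sum.cong refl)
        fix \<beta> assume \<beta>: "\<beta> \<in> E"
        have "(\<Prod>i\<le>r. h i (\<phi> (\<lambda>i. t ^ w i * x' i)) ^ \<beta> i) =
            poly (p 0) t ^ \<beta> 0 * (\<Prod>i<r. (t\<^sup>2 * poly (p (Suc i)) t) ^ \<beta> (Suc i))"
          by (simp add: prod.atMost_shift h0 hSuc)
        also have "\<dots> = t ^ (2 * (T - \<beta> 0)) * (poly (p 0) t ^ \<beta> 0 * (\<Prod>i<r. poly (p (Suc i)) t ^ \<beta> (Suc i)))"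
          by (simp add: power_mult_distrib prod.distrib power_sum[symmetric] sumT(1)[OF \<beta>, symmetric]
              sum_distrib_left flip: power_mult)
        finally show "poly (smult (c \<beta>) (monom 1 (2 * (T - \<beta> 0)) * (\<Prod>i\<le>r. p i ^ \<beta> i))) t =
            c \<beta> * (\<Prod>i\<le>r. h i (\<phi> (\<lambda>i. t ^ w i * x' i)) ^ \<beta> i)"
          by (simp add: poly_monom poly_prod prod.atMost_shift)
      qed
      also have "\<dots> = 0" by (rule zero) (simp add: x'_def)
      finally show ?thesis .
    qed
    then have "q = 0" by (rule poly_eq_0_if_all_roots)
    then have "coeff q (2 * (T - A)) = 0" by simp
    moreover have "coeff q (2 * (T - A)) =
        (\<Sum>\<beta>\<in>S. if \<beta> 0 = A then c \<beta> * (\<Prod>i<r. x i ^ (e i * \<beta> (Suc i))) else 0)"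
    proof -
      have "coeff q (2 * (T - A)) =
          (\<Sum>\<beta>\<in>S. c \<beta> * coeff (monom 1 (2 * (T - \<beta> 0)) * (\<Prod>i\<le>r. p i ^ \<beta> i)) (2 * (T - A)))"
        unfolding q_def coeff_sum coeff_smult using E(1)
        by (intro sum.mono_neutral_right) (auto simp: S_def)
      also have "\<dots> = (\<Sum>\<beta>\<in>S. if \<beta> 0 = A then c \<beta> * (\<Prod>i<r. x i ^ (e i * \<beta> (Suc i))) else 0)"
      proof (intro sum.cong refl)
        fix \<beta> assume \<beta>: "\<beta> \<in> S"
        then have "\<beta> \<in> E" by (simp add: S_def)
        show "c \<beta> * coeff (monom 1 (2 * (T - \<beta> 0)) * (\<Prod>i\<le>r. p i ^ \<beta> i)) (2 * (T - A)) =
            (if \<beta> 0 = A then c \<beta> * (\<Prod>i<r. x i ^ (e i * \<beta> (Suc i))) else 0)"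
        proof (cases "\<beta> 0 = A")
          case True
          have "coeff (\<Prod>i\<le>r. p i ^ \<beta> i) 0 = (\<Prod>i<r. x i ^ (e i * \<beta> (Suc i)))"
            by (simp add: poly_0_coeff_0[symmetric] poly_prod prod.atMost_shift p_def poly_monom
                x'_def power_mult)
          then show ?thesis using True by (simp add: coeff_monom_mult)
        next
          case False
          then have "T - A < T - \<beta> 0" using Amax[OF \<beta>] sumT(2)[OF \<open>\<beta> \<in> E\<close>] sumT(2)[of \<gamma>] \<gamma>
            by (auto simp: S_def)
          then show ?thesis using False by (simp add: coeff_monom_mult)
        qed
      qed
      finally show ?thesis .
    qed
    ultimately show ?thesis unfolding E0_def sum.inter_filter[OF S(1)] by (simp only:)
  qed
  moreover have "inj_on (\<lambda>\<beta>. restrict (\<lambda>i. e i * \<beta> (Suc i)) {..<r}) E0"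
  proof (rule inj_onI)
    fix \<beta> \<delta> :: "nat \<Rightarrow> nat"
    assume *: "\<beta> \<in> E0" "\<delta> \<in> E0"
      "restrict (\<lambda>i. e i * \<beta> (Suc i)) {..<r} = restrict (\<lambda>i. e i * \<delta> (Suc i)) {..<r}"
    show "\<beta> = \<delta>"
    proof
      fix i
      consider "i = 0" | j where "i = Suc j" "j < r" | "i > r"
        by (metis Suc_less_SucD not_less_eq not0_implies_Suc)
      then show "\<beta> i = \<delta> i"
      proof cases
        case 1
        then show ?thesis using *(1,2) by (simp add: E0_def)
      next
        case 2
        then show ?thesis using fun_cong[OF *(3), of j] e[of j] by simp
      next
        case 3
        then show ?thesis using *(1,2) E(3)[of \<beta> i] E(3)[of \<delta> i] by (simp add: E0_def S_def)
      qed
    qed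
  qed
  moreover have "finite E0" "\<gamma> \<in> E0" using S \<gamma> by (auto simp: E0_def)
  ultimately have "c \<gamma> = 0"
    by (intro monomials_independent[of E0 "\<lambda>\<beta> i. e i * \<beta> (Suc i)" r c \<gamma>])
  then show False using \<gamma> by (simp add: S_def)
qed

text \<open>The terms of the chain are the closures of the images of a flag of coordinate subspaces.\<close>

theorem irred_chain_of_immersion:
  fixes \<phi> :: "(nat \<Rightarrow> 'a::alg_closed_field) \<Rightarrow> 'v \<Rightarrow> 'a"
  assumes poly: "\<And>v. polynomial_map N (\<lambda>x. \<phi> x v)"
    and supp: "\<And>x v. v \<notin> V \<Longrightarrow> \<phi> x v = 0"
    and indep: "indep_on V {..N} u"
    and e: "\<And>i. e i \<ge> 1"
    and expand: "\<And>x v. v \<in> V \<Longrightarrow> \<exists>p. \<forall>t. \<phi> (\<lambda>i. t ^ w i * x i) v =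
        u 0 v + t\<^sup>2 * ((\<Sum>i<N. x i ^ e i * u (Suc i) v) + t * poly p t)"
    and mem: "\<And>x f k. hform k f \<Longrightarrow> (\<And>c. c \<in> S \<Longrightarrow> f c = 0) \<Longrightarrow> f (\<phi> x) = 0"
  shows "irred_chain V (proj_closure V S) N"
proof -
  define X where "X r = {x :: nat \<Rightarrow> 'a. \<forall>i\<ge>r. x i = 0}" for r :: nat
  \<comment> \<open>The closure of the image of \<open>X r\<close>, written as the zero set of all
    forms vanishing on the image.\<close>
  define Z where "Z r = {c \<in> cone_pts V. \<forall>p. homogeneous p \<and> (\<forall>x\<in>X r. peval p (\<phi> x) = 0) \<longrightarrow> peval p c = 0}"
    for r
  have X0: "(\<lambda>_. 0) \<in> X r" for r by (simp add: X_def)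
  have Xline: "(\<lambda>i. x i + t * (y i - x i)) \<in> X r" if "x \<in> X r" "y \<in> X r" for x y t r
    using that by (simp add: X_def)
  obtain v0 where v0: "v0 \<in> V" "u 0 v0 \<noteq> 0"
  proof -
    have "(\<Sum>i\<in>{..N}. (if i = 0 then 1 else 0) * u i b) = u 0 b" for b
      by (simp add: if_distrib[of "\<lambda>c. c * _"] cong: if_cong)
    then show thesis
      using indep[unfolded indep_on_def, rule_format, of "\<lambda>i. if i = 0 then 1 else 0" 0] that by auto
  qed
  \<comment> \<open>At the origin \<open>\<phi>\<close> equals \<open>u 0\<close>. So one coordinate
    is nonzero for general parameters, and those with \<open>\<phi> x = 0\<close>, which give no
    point, are handled by density.\<close>
  have \<phi>0: "\<phi> (\<lambda>_. 0) v0 \<noteq> 0"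
  proof -
    obtain p where p: "\<And>t. \<phi> (\<lambda>i. t ^ w i * 0) v0 =
        u 0 v0 + t\<^sup>2 * ((\<Sum>i<N. 0 ^ e i * u (Suc i) v0) + t * poly p t)"
      using expand[OF v0(1), of "\<lambda>_. 0"] by blast
    show ?thesis using p[of 0] v0(2) by simp
  qed
  have inZ: "\<phi> x \<in> Z r" if "x \<in> X r" "\<phi> x v0 \<noteq> 0" for x r
    using that supp by (auto simp: Z_def cone_pts_def)
  have vanish: "f (\<phi> x) = 0"
    if f: "hform k f" "\<And>c. c \<in> Z r \<Longrightarrow> f c = 0" and x: "x \<in> X r" for f k x r
  proof (rule ccontr)
    assume "f (\<phi> x) \<noteq> 0"
    moreover have "polynomial_map N (\<lambda>x. f (\<phi> x))" by (rule hform_polynomial_map[OF f(1) poly])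
    ultimately obtain t where
      "f (\<phi> (\<lambda>i. x i + t * (0 - x i))) \<noteq> 0" "\<phi> (\<lambda>i. x i + t * (0 - x i)) v0 \<noteq> 0"
      using polynomial_map_common_nonzero[OF _ poly[of v0] _ \<phi>0] by blast
    then show False using f(2) inZ[OF Xline[OF x X0, of t]] by auto
  qed
  have closed: "proj_closed V (Z r)" for r
    unfolding proj_closed_def
    by (intro exI[of _ "{p. homogeneous p \<and> (\<forall>x\<in>X r. peval p (\<phi> x) = 0)}"]) (auto simp: Z_def)
  have irred: "proj_irred V (Z r)" for r
    unfolding proj_irred_def
  proof (intro conjI allI impI closed)
    show "Z r \<noteq> {}" using inZ[OF X0 \<phi>0] by blast
  next
    fix B C assume BC: "proj_closed V B \<and> proj_closed V C \<and> Z r = B \<union> C"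
    show "Z r = B \<or> Z r = C"
    proof (rule ccontr)
      assume "\<not> (Z r = B \<or> Z r = C)"
      then obtain b c where bc: "b \<in> Z r" "b \<notin> B" "c \<in> Z r" "c \<notin> C" using BC by blast
      then have cone: "b \<in> cone_pts V" "c \<in> cone_pts V" by (auto simp: Z_def)
      obtain k f where f: "hform k f" "\<forall>y\<in>B. f y = 0" "f b \<noteq> 0"
        using proj_closed_separate[of V B b] BC bc cone by blast
      obtain k' g where g: "hform k' g" "\<forall>y\<in>C. g y = 0" "g c \<noteq> 0"
        using proj_closed_separate[of V C c] BC bc cone by blast
      obtain x where x: "x \<in> X r" "f (\<phi> x) \<noteq> 0"
        using bc(1) hform_homogeneous[OF f(1)] f(3) by (auto simp: Z_def)
      obtain y where y: "y \<in> X r" "g (\<phi> y) \<noteq> 0"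
        using bc(3) hform_homogeneous[OF g(1)] g(3) by (auto simp: Z_def)
      obtain t where t: "f (\<phi> (\<lambda>i. x i + t * (y i - x i))) \<noteq> 0" "g (\<phi> (\<lambda>i. x i + t * (y i - x i))) \<noteq> 0"
        using polynomial_map_common_nonzero[OF hform_polynomial_map[OF f(1) poly]
            hform_polynomial_map[OF g(1) poly] x(2) y(2)] by blast
      have "hform (k + k') (\<lambda>x. f x * g x)" using f g by (intro hform_mult)
      moreover have "f z * g z = 0" if "z \<in> Z r" for z
        using that BC f g by auto
      ultimately have "f (\<phi> (\<lambda>i. x i + t * (y i - x i))) * g (\<phi> (\<lambda>i. x i + t * (y i - x i))) = 0"
        using vanish[of "k + k'" "\<lambda>x. f x * g x" r] Xline[OF x(1) y(1)] by blast
      then show False using t by simp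
    qed
  qed
  obtain h where h: "\<And>i. i \<le> N \<Longrightarrow> finite_functional V (h i)"
    "\<And>i j. i \<le> N \<Longrightarrow> j \<le> N \<Longrightarrow> h i (u j) = (if i = j then 1 else 0)"
    using dual_functionals[OF _ indep] by auto
  have strict: "Z r \<subset> Z (Suc r)" if r: "r < N" for r
  proof
    have "X r \<subseteq> X (Suc r)" by (auto simp: X_def)
    then show "Z r \<subseteq> Z (Suc r)" unfolding Z_def by blast
    show "Z r \<noteq> Z (Suc r)"
    proof
      \<comment> \<open>On the image of the \<open>r\<close>-dimensional \<open>X r\<close> the
        \<open>r + 2\<close> linear forms \<open>h i\<close> satisfy a relation. If the closures
        agreed, it would hold on the image of \<open>X (Suc r)\<close>, where the leading terms
        forbid it.\<close>
      assume eq: "Z r = Z (Suc r)"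
      have "polynomial_map r (\<lambda>x. h i (\<phi> (\<lambda>i. if i < r then x i else 0)))" if "i \<le> Suc r" for i
        using that r polynomial_map_truncate[OF hform_polynomial_map[OF finite_functional_hform[OF h(1)] poly], of i r]
        by auto
      then have pm: "polynomial_map r (\<lambda>x. h i (\<phi> (\<lambda>i. if i < r then x i else 0)))"
        if "s \<in> {()}" "i \<le> Suc r" for s i
        using that by blast
      show False
      proof (rule polynomial_dependence[OF _ pm])
        fix E T \<alpha> c
        assume E: "finite E" "\<And>\<alpha>. \<alpha> \<in> E \<Longrightarrow> (\<Sum>i\<le>Suc r. \<alpha> i) = T"
          "\<And>\<alpha> i. \<alpha> \<in> E \<Longrightarrow> i > Suc r \<Longrightarrow> \<alpha> i = 0" "\<alpha> \<in> E" "c \<alpha> \<noteq> (0::'a)"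
        and c: "\<And>s x. s \<in> {()} \<Longrightarrow>
            (\<Sum>\<alpha>\<in>E. c \<alpha> * (\<Prod>i\<le>Suc r. h i (\<phi> (\<lambda>i. if i < r then x i else 0)) ^ \<alpha> i)) = 0"
        define G where "G x = (\<Sum>\<alpha>\<in>E. c \<alpha> * (\<Prod>i\<le>Suc r. h i x ^ \<alpha> i))" for x
        have G: "hform (1 * T) G"
          unfolding G_def[abs_def] using r E(2)
          by (intro hform_combination finite_functional_hform[OF h(1)]) auto
        have "G (\<phi> x) = 0" if "x \<in> X r" for x
        proof -
          have "(\<lambda>i. if i < r then x i else 0) = x" using that by (auto simp: X_def)
          then show ?thesis using c[of "()" x] by (simp only: G_def insertI1)
        qed
        then have "G x = 0" if "x \<in> Z r" for x
          using that hform_homogeneous[OF G] by (auto simp: Z_def)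
        then have "G (\<phi> x) = 0" if "x \<in> X (Suc r)" for x
          using vanish[OF G, of "Suc r"] that eq by blast
        then have "c \<alpha> = 0"
          using E h r e expand
          by (intro leading_terms_independent[of "Suc r" V h N u e \<phi> w E T c \<alpha>])
            (auto simp: G_def X_def)
        then show False using E(5) by blast
      qed auto
    qed
  qed
  have "Z N \<subseteq> proj_closure V S"
    unfolding proj_closure_def
  proof (intro Inter_greatest, clarify)
    fix A c assume A: "proj_closed V A" "S \<subseteq> A" and c: "c \<in> Z N"
    show "c \<in> A"
    proof (rule ccontr)
      assume "c \<notin> A"
      moreover have "c \<in> cone_pts V" using c by (simp add: Z_def)
      ultimately obtain k f where f: "hform k f" "\<forall>y\<in>A. f y = 0" "f c \<noteq> 0"
        using proj_closed_separate[OF A(1)] by blast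
      then have "f (\<phi> x) = 0" for x using mem[OF f(1)] A(2) by blast
      then show False using c f hform_homogeneous[OF f(1)] by (auto simp: Z_def)
    qed
  qed
  then show ?thesis unfolding irred_chain_def
    using irred strict by (intro exI[of _ Z]) auto
qed

section \<open>Plane forms and lines\<close>

text \<open>Every index from 2 on yields the third coordinate, so that facts about coordinates need
  no bound on the index.\<close>

definition coord :: "nat \<Rightarrow> 'a \<times> 'a \<times> 'a \<Rightarrow> 'a" where
  "coord i P = (if i = 0 then fst P else if i = 1 then fst (snd P) else snd (snd P))"

lemma coord_simps [simp]:
  "coord 0 (a, b, c) = a" "coord (Suc 0) (a, b, c) = b" "coord 2 (a, b, c) = c"
  by (simp_all add: coord_def)

definition mono3 :: "(nat \<Rightarrow>\<^sub>0 nat) \<Rightarrow> 'a::comm_ring_1 \<times> 'a \<times> 'a \<Rightarrow> 'a" where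
  "mono3 m P = (\<Prod>i<3. coord i P ^ Poly_Mapping.lookup m i)"

lemma mono3_eq: "mono3 m P = fst P ^ Poly_Mapping.lookup m 0 *
    fst (snd P) ^ Poly_Mapping.lookup m 1 * snd (snd P) ^ Poly_Mapping.lookup m 2"
  by (simp add: mono3_def coord_def numeral_3_eq_3 numeral_2_eq_2)

lemma curve_eval_mono3: "curve_eval d c P = (\<Sum>m\<in>plane_monos d. c m * mono3 m P)"
  by (simp add: curve_eval_def mono3_eq)

definition expo :: "nat \<Rightarrow> nat \<Rightarrow> nat \<Rightarrow> nat \<Rightarrow>\<^sub>0 nat" where
  "expo a b c = Poly_Mapping.single 0 a + Poly_Mapping.single 1 b + Poly_Mapping.single 2 c"

lemma lookup_expo:
  "Poly_Mapping.lookup (expo a b c) i = (if i = 0 then a else if i = 1 then b else if i = 2 then c else 0)"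
  by (simp add: expo_def lookup_add lookup_single when_def)

lemma expo_in_plane_monos: "expo a b c \<in> plane_monos (a + b + c)"
  by (auto simp: plane_monos_def lookup_expo in_keys_iff split: if_splits)

lemma plane_monos_expo:
  assumes "m \<in> plane_monos d"
  shows "m = expo (Poly_Mapping.lookup m 0) (Poly_Mapping.lookup m 1) (Poly_Mapping.lookup m 2)"
proof (rule poly_mapping_eqI)
  fix i :: nat
  show "Poly_Mapping.lookup m i = Poly_Mapping.lookup
      (expo (Poly_Mapping.lookup m 0) (Poly_Mapping.lookup m 1) (Poly_Mapping.lookup m 2)) i"
    using assms by (auto simp: plane_monos_def lookup_expo not_in_keys_iff_lookup_eq_zero[symmetric])
qed

text \<open>The pairs are the first two exponents of the ternary monomials of degree
  \<open>n - 1\<close>, the third being forced; for \<open>n = 0\<close> there are none.\<close>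

lemma card_pairs_sum_less: "card {(a, b). a + b < (n::nat)} = (n + 1 choose 2)"
  "finite {(a, b). a + b < n}"
proof (induction n)
  case (Suc n)
  have eq: "{(a, b). a + b < Suc n} = {(a, b). a + b < n} \<union> (\<lambda>a. (a, n - a)) ` {..n}"
    by (auto simp: image_iff)
  { case 2 then show ?case using Suc.IH(2) by (simp only: eq) simp }
  { case 1
    have "card ((\<lambda>a. (a, n - a)) ` {..n}) = Suc n"
      by (subst card_image) (auto simp: inj_on_def)
    moreover have "{(a, b). a + b < n} \<inter> (\<lambda>a. (a, n - a)) ` {..n} = {}" by auto
    ultimately show ?case
      using Suc.IH unfolding eq
      by (subst card_Un_disjoint) (auto simp: numeral_2_eq_2) }
qed auto

lemma plane_monos_image:
  "plane_monos d = (\<lambda>(a, b). expo a b (d - a - b)) ` {(a, b). a + b < Suc d}"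
proof (intro equalityI subsetI)
  fix m assume m: "m \<in> plane_monos d"
  then have "Poly_Mapping.lookup m 0 + Poly_Mapping.lookup m 1 + Poly_Mapping.lookup m 2 = d"
    by (simp add: plane_monos_def)
  then show "m \<in> (\<lambda>(a, b). expo a b (d - a - b)) ` {(a, b). a + b < Suc d}"
    using plane_monos_expo[OF m]
    by (intro image_eqI[of _ _ "(Poly_Mapping.lookup m 0, Poly_Mapping.lookup m 1)"]) auto
next
  fix m assume "m \<in> (\<lambda>(a, b). expo a b (d - a - b)) ` {(a, b). a + b < Suc d}"
  then obtain a b where "m = expo a b (d - a - b)" "a + b \<le> d" by auto
  then show "m \<in> plane_monos d" using expo_in_plane_monos[of a b "d - a - b"] by simp
qed

lemma finite_plane_monos: "finite (plane_monos d)"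
  unfolding plane_monos_image using card_pairs_sum_less(2) by (intro finite_imageI)

lemma card_plane_monos: "card (plane_monos d) = (d + 2 choose 2)"
proof -
  have "inj_on (\<lambda>(a, b). expo a b (d - a - b)) {(a, b). a + b < Suc d}"
  proof (rule inj_onI, clarify)
    fix a b a' b'
    assume "expo a b (d - a - b) = expo a' b' (d - a' - b')"
    then have "Poly_Mapping.lookup (expo a b (d - a - b)) i =
        Poly_Mapping.lookup (expo a' b' (d - a' - b')) i" for i by simp
    from this[of 0] this[of 1] show "a = a' \<and> b = b'" by (simp add: lookup_expo)
  qed
  then show ?thesis
    unfolding plane_monos_image by (simp add: card_image card_pairs_sum_less)
qed

section \<open>Plane forms as functions of a point\<close>

text \<open>Working with functions lets products of lines be written as such;
  \<open>form_coeff\<close> leads back to coefficient vectors.\<close>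

definition pform :: "nat \<Rightarrow> ('a::comm_ring_1 \<times> 'a \<times> 'a \<Rightarrow> 'a) \<Rightarrow> bool" where
  "pform d f \<longleftrightarrow> (\<exists>c. f = curve_eval d c)"

lemma pform_zero: "pform d (\<lambda>_. 0)"
  unfolding pform_def by (intro exI[of _ "\<lambda>_. 0"]) (auto simp: curve_eval_def)

lemma pform_add: "pform d f \<Longrightarrow> pform d g \<Longrightarrow> pform d (\<lambda>P. f P + g P)"
  unfolding pform_def
  by (elim exE, rule_tac x="\<lambda>m. c m + ca m" in exI)
    (auto simp: curve_eval_def fun_eq_iff algebra_simps sum.distrib)

lemma pform_scale: "pform d f \<Longrightarrow> pform d (\<lambda>P. a * f P)"
  unfolding pform_def
  by (elim exE, rule_tac x="\<lambda>m. a * c m" in exI)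
    (auto simp: curve_eval_def fun_eq_iff sum_distrib_left mult.assoc)

lemma pform_sum: "(\<And>i. i \<in> A \<Longrightarrow> pform d (f i)) \<Longrightarrow> pform d (\<lambda>P. \<Sum>i\<in>A. f i P)"
  by (induction A rule: infinite_finite_induct) (auto intro: pform_zero pform_add)

lemma pform_monomial: "pform (a + b + c) (\<lambda>P. fst P ^ a * fst (snd P) ^ b * snd (snd P) ^ c)"
  unfolding pform_def
proof (intro exI ext)
  fix P :: "'a \<times> 'a \<times> 'a"
  show "fst P ^ a * fst (snd P) ^ b * snd (snd P) ^ c =
      curve_eval (a + b + c) (\<lambda>m. if m = expo a b c then 1 else 0) P"
    using finite_plane_monos[of "a + b + c"] expo_in_plane_monos[of a b c]
    by (simp add: curve_eval_mono3 mono3_eq lookup_expo if_distrib[of "\<lambda>c. c * _"] cong: if_cong)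
qed

lemma pform_mult:
  assumes "pform d f" "pform d' g"
  shows "pform (d + d') (\<lambda>P. f P * g P)"
proof -
  obtain c c' where f: "f = curve_eval d c" and g: "g = curve_eval d' c'"
    using assms unfolding pform_def by blast
  have "pform (d + d') (\<lambda>P. (c m * c' m') * (mono3 m P * mono3 m' P))"
    if "m \<in> plane_monos d" "m' \<in> plane_monos d'" for m m'
  proof -
    have deg: "Poly_Mapping.lookup m 0 + Poly_Mapping.lookup m' 0 +
        (Poly_Mapping.lookup m 1 + Poly_Mapping.lookup m' 1) +
        (Poly_Mapping.lookup m 2 + Poly_Mapping.lookup m' 2) = d + d'"
      using that by (auto simp: plane_monos_def)
    have "pform (d + d') (\<lambda>P. fst P ^ (Poly_Mapping.lookup m 0 + Poly_Mapping.lookup m' 0) *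
        fst (snd P) ^ (Poly_Mapping.lookup m 1 + Poly_Mapping.lookup m' 1) *
        snd (snd P) ^ (Poly_Mapping.lookup m 2 + Poly_Mapping.lookup m' 2))"
      using pform_monomial[of "Poly_Mapping.lookup m 0 + Poly_Mapping.lookup m' 0"
          "Poly_Mapping.lookup m 1 + Poly_Mapping.lookup m' 1"
          "Poly_Mapping.lookup m 2 + Poly_Mapping.lookup m' 2"]
      by (simp only: deg)
    then have "pform (d + d') (\<lambda>P. mono3 m P * mono3 m' P)"
      by (simp add: mono3_eq power_add mult_ac)
    then show ?thesis by (rule pform_scale)
  qed
  then have "pform (d + d') (\<lambda>P. \<Sum>m\<in>plane_monos d. \<Sum>m'\<in>plane_monos d'.
      (c m * c' m') * (mono3 m P * mono3 m' P))"
    by (intro pform_sum)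
  moreover have "f P * g P = (\<Sum>m\<in>plane_monos d. \<Sum>m'\<in>plane_monos d'.
      (c m * c' m') * (mono3 m P * mono3 m' P))" for P
    unfolding f g curve_eval_mono3 sum_product by (intro sum.cong refl) (simp add: mult_ac)
  ultimately show ?thesis by presburger
qed

lemma pform_const: "pform 0 (\<lambda>_. a)"
  using pform_scale[OF pform_monomial[of 0 0 0], of a] by simp

lemma pform_coord: "pform 1 (coord i)"
  using pform_monomial[of 1 0 0, where 'a='a] pform_monomial[of 0 1 0, where 'a='a]
    pform_monomial[of 0 0 1, where 'a='a]
  by (cases "i = 0"; cases "i = 1") (simp_all add: coord_def[abs_def])

lemma lin_coord: "lin a P = coord 0 a * coord 0 P + coord 1 a * coord 1 P + coord 2 a * coord 2 P"
  by (simp add: lin_def coord_def)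

lemma pform_lin: "pform 1 (lin a)"
  unfolding lin_coord[abs_def] by (intro pform_add pform_scale pform_coord)

lemma pform_power: "pform d f \<Longrightarrow> pform (d * k) (\<lambda>P. f P ^ k)"
  by (induction k) (auto intro: pform_const pform_mult)

lemma pform_prod:
  "(\<And>i. i \<in> A \<Longrightarrow> pform (d i) (f i)) \<Longrightarrow> pform (\<Sum>i\<in>A. d i) (\<lambda>P. \<Prod>i\<in>A. f i P)"
  by (induction A rule: infinite_finite_induct) (auto intro: pform_const pform_mult)

lemma pform_prod_lin: "finite A \<Longrightarrow> pform (card A) (\<lambda>P. \<Prod>i\<in>A. lin (L i) P)"
  using pform_prod[of A "\<lambda>_. 1" "\<lambda>i. lin (L i)", OF pform_lin] by simp

lemma mono3_independent:
  "indep_on UNIV (plane_monos d) (mono3 :: _ \<Rightarrow> 'a::alg_closed_field \<times> 'a \<times> 'a \<Rightarrow> 'a)"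
  unfolding indep_on_def
proof (intro allI impI ballI)
  fix c :: "(nat \<Rightarrow>\<^sub>0 nat) \<Rightarrow> 'a" and m
  assume c: "\<forall>P\<in>UNIV. (\<Sum>m\<in>plane_monos d. c m * mono3 m P) = 0" and m: "m \<in> plane_monos d"
  have "inj_on (\<lambda>m. restrict (Poly_Mapping.lookup m) {..<3}) (plane_monos d)"
  proof (rule inj_onI)
    fix m m'
    assume *: "m \<in> plane_monos d" "m' \<in> plane_monos d"
      "restrict (Poly_Mapping.lookup m) {..<3} = restrict (Poly_Mapping.lookup m') {..<3}"
    have "Poly_Mapping.lookup m i = Poly_Mapping.lookup m' i" if "i < 3" for i
      using fun_cong[OF *(3), of i] that by simp
    then show "m = m'"
      using plane_monos_expo[OF *(1)] plane_monos_expo[OF *(2)] by simp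
  qed
  moreover have "(\<Sum>m\<in>plane_monos d. c m * (\<Prod>i<3. x i ^ Poly_Mapping.lookup m i)) = 0"
    for x :: "nat \<Rightarrow> 'a"
    using c[rule_format, of "(x 0, x 1, x 2)"]
    by (simp add: mono3_def numeral_3_eq_3 numeral_2_eq_2 coord_def)
  ultimately show "c m = 0"
    using m finite_plane_monos
    by (intro monomials_independent[of "plane_monos d" Poly_Mapping.lookup 3 c m])
qed

text \<open>Coefficients are recovered from finitely many values, so they depend polynomially on
  parameters as soon as the values do.\<close>

definition form_coeff ::
    "nat \<Rightarrow> ('a::alg_closed_field \<times> 'a \<times> 'a \<Rightarrow> 'a) \<Rightarrow> (nat \<Rightarrow>\<^sub>0 nat) \<Rightarrow> 'a" where
  "form_coeff d f m = (if m \<in> plane_monos d then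
     (SOME h. \<forall>i\<in>plane_monos d. finite_functional UNIV (h i) \<and>
        (\<forall>j\<in>plane_monos d. h i (mono3 j) = (if i = j then 1 else 0))) m f else 0)"

lemma form_coeff:
  fixes d :: nat
  shows finite_functional_form_coeff:
      "finite_functional UNIV (\<lambda>f :: 'a::alg_closed_field \<times> 'a \<times> 'a \<Rightarrow> 'a. form_coeff d f m)"
    and form_coeff_mono3: "m \<in> plane_monos d \<Longrightarrow> m' \<in> plane_monos d \<Longrightarrow>
      form_coeff d (mono3 m' :: 'a \<times> 'a \<times> 'a \<Rightarrow> 'a) m = (if m = m' then 1 else 0)"
proof -
  have *: "\<exists>h. \<forall>i\<in>plane_monos d. finite_functional UNIV (h i) \<and>
        (\<forall>j\<in>plane_monos d. h i (mono3 j :: 'a \<times> 'a \<times> 'a \<Rightarrow> 'a) = (if i = j then 1 else 0))"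
    by (intro dual_functionals finite_plane_monos mono3_independent)
  note h = someI_ex[OF *]
  show "finite_functional UNIV (\<lambda>f :: 'a \<times> 'a \<times> 'a \<Rightarrow> 'a. form_coeff d f m)"
  proof (cases "m \<in> plane_monos d")
    case True
    then show ?thesis using h unfolding form_coeff_def by (simp only: if_True)
  next
    case False
    then show ?thesis unfolding form_coeff_def finite_functional_def
      by (intro exI[of _ "{}"]) auto
  qed
  show "m \<in> plane_monos d \<Longrightarrow> m' \<in> plane_monos d \<Longrightarrow>
      form_coeff d (mono3 m' :: 'a \<times> 'a \<times> 'a \<Rightarrow> 'a) m = (if m = m' then 1 else 0)"
    using h unfolding form_coeff_def by simp
qed

lemma form_coeff_outside: "m \<notin> plane_monos d \<Longrightarrow> form_coeff d f m = 0"
  by (simp add: form_coeff_def)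

lemma form_coeff_sum:
  "form_coeff d (\<lambda>P. \<Sum>i\<in>A. c i * u i P) m = (\<Sum>i\<in>A. c i * form_coeff d (u i) m)"
  by (rule finite_functional_sum_apply[OF finite_functional_form_coeff])

lemma form_coeff_curve_eval:
  assumes "m \<in> plane_monos d"
  shows "form_coeff d (curve_eval d c) m = c m"
proof -
  have "form_coeff d (curve_eval d c) m = (\<Sum>m'\<in>plane_monos d. c m' * form_coeff d (mono3 m') m)"
    unfolding curve_eval_mono3[abs_def] by (rule form_coeff_sum)
  also have "\<dots> = (\<Sum>m'\<in>plane_monos d. if m = m' then c m' else 0)"
    using assms by (intro sum.cong) (auto simp: form_coeff_mono3)
  finally show ?thesis using assms finite_plane_monos by simp
qed

lemma curve_eval_form_coeff:
  assumes "pform d f"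
  shows "curve_eval d (form_coeff d f) = f"
proof -
  obtain c where c: "f = curve_eval d c" using assms unfolding pform_def by blast
  show ?thesis unfolding c
    by (rule ext) (simp add: curve_eval_mono3 form_coeff_curve_eval cong: sum.cong)
qed

lemma form_coeff_polynomial_map:
  assumes "\<And>P. polynomial_map n (\<lambda>x. f x P)"
  shows "polynomial_map n (\<lambda>x. form_coeff d (f x) m)"
proof -
  obtain X c where X: "\<And>f :: 'a \<times> 'a \<times> 'a \<Rightarrow> 'a. form_coeff d f m = (\<Sum>b\<in>X. c b * f b)"
    using finite_functional_form_coeff[of d m, where 'a='a] unfolding finite_functional_def by blast
  show ?thesis unfolding X
    by (intro polynomial_map_sum polynomial_map_mult polynomial_map_const assms)
qed

section \<open>Lines in general position\<close>

text \<open>As a point, this is the intersection of two distinct lines, and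
  \<open>lin c (cross a b)\<close> is the determinant of three lines.\<close>

definition cross :: "'a::comm_ring_1 \<times> 'a \<times> 'a \<Rightarrow> 'a \<times> 'a \<times> 'a \<Rightarrow> 'a \<times> 'a \<times> 'a" where
  "cross a b = (coord 1 a * coord 2 b - coord 2 a * coord 1 b,
     coord 2 a * coord 0 b - coord 0 a * coord 2 b,
     coord 0 a * coord 1 b - coord 1 a * coord 0 b)"

lemma lin_cross [simp]: "lin a (cross a b) = 0" "lin b (cross a b) = 0"
  by (simp_all add: lin_coord cross_def coord_def algebra_simps)

text \<open>The polynomial counterpart of \<open>D_tuple\<close>: no 3 by 3 determinant vanishes,
  which is an open condition on parameters.\<close>

definition general_position :: "nat \<Rightarrow> (nat \<Rightarrow> 'a::comm_ring_1 \<times> 'a \<times> 'a) \<Rightarrow> bool" where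
  "general_position l L \<longleftrightarrow> (\<forall>i<l. \<forall>j<l. \<forall>k<l. i \<noteq> j \<and> j \<noteq> k \<and> i \<noteq> k \<longrightarrow>
     lin (L k) (cross (L i) (L j)) \<noteq> 0)"

lemma cross_eq_0_proportional:
  fixes a b :: "'a::field \<times> 'a \<times> 'a"
  assumes "a \<noteq> (0, 0, 0)" "b \<noteq> (0, 0, 0)" "cross a b = (0, 0, 0)"
  shows "proportional a b"
proof -
  obtain a0 a1 a2 b0 b1 b2 where ab: "a = (a0, a1, a2)" "b = (b0, b1, b2)"
    by (metis surj_pair)
  have eqs: "a1 * b2 = a2 * b1" "a2 * b0 = a0 * b2" "a0 * b1 = a1 * b0"
    using assms(3) by (auto simp: ab cross_def coord_def)
  consider "a0 \<noteq> 0" | "a1 \<noteq> 0" | "a2 \<noteq> 0" using assms(1) ab by auto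
  then obtain c where c: "b = (c * a0, c * a1, c * a2)"
  proof cases
    case 1
    then show thesis using eqs ab by (intro that[of "b0 / a0"]) (auto simp: field_simps)
  next
    case 2
    then show thesis using eqs ab by (intro that[of "b1 / a1"]) (auto simp: field_simps)
  next
    case 3
    then show thesis using eqs ab by (intro that[of "b2 / a2"]) (auto simp: field_simps)
  qed
  moreover have "c \<noteq> 0" using assms(2) c by auto
  ultimately show ?thesis unfolding proportional_def using ab by auto
qed

lemma D_tuple_general_position:
  assumes "D_tuple l L"
  shows "general_position l L"
  unfolding general_position_def
proof (intro allI impI)
  fix i j k assume *: "i < l" "j < l" "k < l" "i \<noteq> j \<and> j \<noteq> k \<and> i \<noteq> k"
  note D = assms[unfolded D_tuple_def]
  have "\<not> proportional (L i) (L j)" "L i \<noteq> (0, 0, 0)" "L j \<noteq> (0, 0, 0)"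
    using D[THEN conjunct1] D[THEN conjunct2, THEN conjunct1] * by simp_all
  then have nz: "cross (L i) (L j) \<noteq> (0, 0, 0)" using cross_eq_0_proportional by blast
  have "\<not> (\<exists>p. p \<noteq> (0, 0, 0) \<and> lin (L i) p = 0 \<and> lin (L j) p = 0 \<and> lin (L k) p = 0)"
    using D[THEN conjunct2, THEN conjunct2] * by simp
  from this[unfolded not_ex, rule_format, of "cross (L i) (L j)"] nz
  show "lin (L k) (cross (L i) (L j)) \<noteq> 0" by simp
qed

text \<open>Cramer's rule: the determinant times each coordinate of the common point is 0.\<close>

lemma concurrent_det:
  fixes a b c P :: "'a::field \<times> 'a \<times> 'a"
  assumes "lin a P = 0" "lin b P = 0" "lin c P = 0" "P \<noteq> (0, 0, 0)"
  shows "lin c (cross a b) = 0"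
proof -
  obtain a0 a1 a2 b0 b1 b2 c0 c1 c2 p0 p1 p2 where
    ab: "a = (a0, a1, a2)" "b = (b0, b1, b2)" "c = (c0, c1, c2)" "P = (p0, p1, p2)"
    by (metis surj_pair)
  have eqs: "a0 * p0 + a1 * p1 + a2 * p2 = 0" "b0 * p0 + b1 * p1 + b2 * p2 = 0"
    "c0 * p0 + c1 * p1 + c2 * p2 = 0"
    using assms by (auto simp: ab lin_def)
  define D where "D = c0 * (a1 * b2 - a2 * b1) + c1 * (a2 * b0 - a0 * b2) + c2 * (a0 * b1 - a1 * b0)"
  have "D * p0 = 0" "D * p1 = 0" "D * p2 = 0" using eqs unfolding D_def by algebra+
  then have "D = 0" using assms(4) ab by auto
  then show ?thesis by (simp add: ab lin_def cross_def coord_def D_def)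
qed

text \<open>A zero line or two proportional lines would kill every determinant containing them;
  \<open>l \<ge> 3\<close> ensures that there is one.\<close>

lemma general_position_D_tuple:
  assumes "general_position l L" "l \<ge> 3"
  shows "D_tuple l (L :: nat \<Rightarrow> 'a::field \<times> 'a \<times> 'a)"
proof -
  have gp: "lin (L k) (cross (L i) (L j)) \<noteq> 0"
    if "i < l" "j < l" "k < l" "i \<noteq> j" "j \<noteq> k" "i \<noteq> k" for i j k
    using assms(1) that unfolding general_position_def by blast
  have third: "\<exists>k<l. k \<noteq> i \<and> k \<noteq> j" for i j
  proof -
    have "card ({..<l} - {i, j}) > 0"
      using assms(2) diff_card_le_card_Diff[of "{i, j}" "{..<l}"] card_insert_le_m1[of 2 "{j}" i] by simp
    then have "{..<l} - {i, j} \<noteq> {}" by (metis card.empty less_numeral_extra(3))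
    then show ?thesis by auto
  qed
  have "L i \<noteq> (0, 0, 0)" if "i < l" for i
  proof
    assume "L i = (0, 0, 0)"
    obtain j where j: "j < l" "j \<noteq> i" using third by blast
    obtain k where k: "k < l" "k \<noteq> i" "k \<noteq> j" using third by blast
    have "lin (L i) (cross (L j) (L k)) = 0" using \<open>L i = (0, 0, 0)\<close> by (simp add: lin_def)
    then show False using gp[of j k i] j k that by blast
  qed
  moreover have "\<not> proportional (L i) (L j)" if "i < l" "j < l" "i \<noteq> j" for i j
  proof
    assume "proportional (L i) (L j)"
    then have "cross (L i) (L j) = (0, 0, 0)"
      by (auto simp: proportional_def cross_def coord_def algebra_simps)
    then have "lin (L k) (cross (L i) (L j)) = 0" for k by (simp add: lin_def)
    then show False using gp[of i j] third[of i j] that by blast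
  qed
  moreover have "\<not> (\<exists>p. p \<noteq> (0, 0, 0) \<and> lin (L i) p = 0 \<and> lin (L j) p = 0 \<and> lin (L k) p = 0)"
    if "i < l" "j < l" "k < l" "i \<noteq> j" "j \<noteq> k" "i \<noteq> k" for i j k
    using concurrent_det[of "L i" _ "L j" "L k"] gp[of i j k] that by blast
  ultimately show ?thesis unfolding D_tuple_def by (intro conjI allI impI) auto
qed

section \<open>Forms vanishing on a star configuration\<close>

text \<open>With \<open>compl2\<close>, the two coordinates other than \<open>s\<close>. They are
  homogeneous coordinates on any line whose \<open>s\<close>-th coefficient is nonzero.\<close>

definition compl1 :: "nat \<Rightarrow> nat" where "compl1 s = (if s = 0 then 1 else 0)"
definition compl2 :: "nat \<Rightarrow> nat" where "compl2 s = (if s = 2 then 1 else 2)"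

definition line_point :: "nat \<Rightarrow> 'a::field \<times> 'a \<times> 'a \<Rightarrow> 'a \<Rightarrow> 'a \<Rightarrow> 'a \<times> 'a \<times> 'a" where
  "line_point s a p q = (let r = - (coord (compl1 s) a * p + coord (compl2 s) a * q) / coord s a in
     if s = 0 then (r, p, q) else if s = 1 then (p, r, q) else (p, q, r))"

lemma line_point_coord:
  "s \<le> 2 \<Longrightarrow> coord (compl1 s) (line_point s a p q) = p"
  "s \<le> 2 \<Longrightarrow> coord (compl2 s) (line_point s a p q) = q"
  by (auto simp: line_point_def compl1_def compl2_def coord_def Let_def)

lemma lin_line_point:
  "s \<le> 2 \<Longrightarrow> coord s a \<noteq> 0 \<Longrightarrow> lin a (line_point s a p q) = 0"
  by (auto simp: line_point_def compl1_def compl2_def coord_def Let_def lin_def le_Suc_eq numeral_2_eq_2)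

lemma lin_line_point_linear:
  "lin b (line_point s a p q) = lin b (line_point s a 1 0) * p + lin b (line_point s a 0 1) * q"
  by (simp add: line_point_def Let_def lin_def algebra_simps add_divide_distrib diff_divide_distrib)

lemma point_on_line:
  assumes "s \<le> 2" "coord s a \<noteq> 0" "lin a P = 0"
  shows "P = line_point s a (coord (compl1 s) P) (coord (compl2 s) P)"
proof -
  obtain p0 p1 p2 a0 a1 a2 where P: "P = (p0, p1, p2)" "a = (a0, a1, a2)" by (metis surj_pair)
  have eq: "a0 * p0 + a1 * p1 + a2 * p2 = 0" using assms(3) by (simp add: P lin_def)
  consider "s = 0" | "s = 1" | "s = 2" using assms(1) by linarith
  then show ?thesis
  proof cases
    case 1
    have "a0 * p0 = - (a1 * p1 + a2 * p2)"
      using eq by (simp add: eq_neg_iff_add_eq_0 algebra_simps)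
    then have "p0 = - (a1 * p1 + a2 * p2) / a0"
      using 1 assms(2) by (simp add: P coord_def eq_divide_eq mult.commute)
    then show ?thesis using 1 by (simp add: P line_point_def compl1_def compl2_def coord_def)
  next
    case 2
    have "a1 * p1 = - (a0 * p0 + a2 * p2)"
      using eq by (simp add: eq_neg_iff_add_eq_0 algebra_simps)
    then have "p1 = - (a0 * p0 + a2 * p2) / a1"
      using 2 assms(2) by (simp add: P coord_def eq_divide_eq mult.commute)
    then show ?thesis using 2 by (simp add: P line_point_def compl1_def compl2_def coord_def)
  next
    case 3
    have "a2 * p2 = - (a0 * p0 + a1 * p1)"
      using eq by (simp add: eq_neg_iff_add_eq_0 algebra_simps)
    then have "p2 = - (a0 * p0 + a1 * p1) / a2"
      using 3 assms(2) by (simp add: P coord_def eq_divide_eq mult.commute)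
    then show ?thesis using 3 by (simp add: P line_point_def compl1_def compl2_def coord_def)
  qed
qed

section \<open>A basis of the forms through a star configuration\<close>

type_synonym star_index = "nat \<times> nat + nat \<times> nat"

text \<open>\<open>Inl (i, j)\<close> is a binary monomial of degree \<open>e\<close> on line
  \<open>i\<close>, and \<open>Inr (a, b)\<close> is a ternary monomial of degree
  \<open>e - 1\<close>. For \<open>e = 0\<close> the second kind is absent, so the truncated
  \<open>e - 1\<close> in \<open>star_form\<close> does no harm.\<close>

definition star_indices :: "nat \<Rightarrow> nat \<Rightarrow> star_index set" where
  "star_indices l e = ({..<l} \<times> {..e}) <+> {(a, b). a + b < e}"

text \<open>A basis of the forms of degree \<open>l + e - 1\<close> vanishing on the star configuration of \<open>L\<close>:
  on each line \<open>L i\<close> such a form is divisible by the product of the other lines, with a quotient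
  determined by its restriction to \<open>L i\<close>; what vanishes on all lines is divisible by their
  product.\<close>

definition star_form ::
    "nat \<Rightarrow> nat \<Rightarrow> (nat \<Rightarrow> nat) \<Rightarrow> (nat \<Rightarrow> 'a::comm_ring_1 \<times> 'a \<times> 'a) \<Rightarrow> star_index \<Rightarrow> 'a \<times> 'a \<times> 'a \<Rightarrow> 'a" where
  "star_form l e \<sigma> L b P = (case b of
      Inl (i, j) \<Rightarrow> coord (compl1 (\<sigma> i)) P ^ j * coord (compl2 (\<sigma> i)) P ^ (e - j) *
        (\<Prod>k\<in>{..<l} - {i}. lin (L k) P)
    | Inr (i, j) \<Rightarrow> coord 0 P ^ i * coord 1 P ^ j * coord 2 P ^ (e - 1 - i - j) *
        (\<Prod>k<l. lin (L k) P))"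

lemma finite_star_indices: "finite (star_indices l e)"
  unfolding star_indices_def using card_pairs_sum_less(2) by (intro finite_Plus) auto

text \<open>Vandermonde's identity for choosing 2 out of \<open>l + (e + 1)\<close>. The right-hand
  side counts the monomials of degree \<open>l + e - 1\<close>, so the points impose independent
  conditions.\<close>

lemma card_star_indices: "card (star_indices l e) + (l choose 2) = (l + e + 1 choose 2)"
proof -
  have "card (star_indices l e) = l * (e + 1) + (e + 1 choose 2)"
    unfolding star_indices_def using card_pairs_sum_less[of e]
    by (subst card_Plus) (auto simp: card_cartesian_product)
  moreover have "l * (e + 1) + (e + 1 choose 2) + (l choose 2) = (l + e + 1 choose 2)"
    by (induction l) (auto simp: numeral_2_eq_2)
  ultimately show ?thesis by simp
qed

lemma star_form_pform:
  assumes "b \<in> star_indices l e" "l \<ge> 1"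
  shows "pform (l + e - 1) (star_form l e \<sigma> L b)"
proof (cases b)
  case (Inl ij)
  obtain i j where ij: "ij = (i, j)" by force
  have ijl: "i < l" "j \<le> e" using assms Inl ij by (auto simp: star_indices_def)
  have "pform (1 * j + 1 * (e - j) + card ({..<l} - {i})) (\<lambda>P. coord (compl1 (\<sigma> i)) P ^ j *
      coord (compl2 (\<sigma> i)) P ^ (e - j) * (\<Prod>k\<in>{..<l} - {i}. lin (L k) P))"
    by (intro pform_mult pform_power pform_coord pform_prod_lin) auto
  moreover have "1 * j + 1 * (e - j) + card ({..<l} - {i}) = l + e - 1"
    using ijl by (auto simp: card_Diff_singleton)
  ultimately show ?thesis by (simp add: Inl ij star_form_def[abs_def])
next
  case (Inr ij)
  obtain i j where ij: "ij = (i, j)" by force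
  have ijl: "i + j < e" using assms Inr ij by (auto simp: star_indices_def)
  have "pform (1 * i + 1 * j + 1 * (e - 1 - i - j) + card {..<l}) (\<lambda>P. coord 0 P ^ i *
      coord 1 P ^ j * coord 2 P ^ (e - 1 - i - j) * (\<Prod>k<l. lin (L k) P))"
    by (intro pform_mult pform_power pform_coord pform_prod_lin) auto
  moreover have "1 * i + 1 * j + 1 * (e - 1 - i - j) + card {..<l} = l + e - 1"
    using ijl by auto
  ultimately show ?thesis by (simp add: Inr ij star_form_def[abs_def])
qed

lemma sum_star_indices:
  "(\<Sum>b\<in>star_indices l e. f b) = (\<Sum>i<l. \<Sum>j\<le>e. f (Inl (i, j))) + (\<Sum>ij | fst ij + snd ij < e. f (Inr ij))"
proof -
  have "{(a, b). a + b < e} = {ij. fst ij + snd ij < e}" by auto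
  then show ?thesis
    unfolding star_indices_def using card_pairs_sum_less(2)[of e]
    by (subst sum.Plus) (auto simp: sum.cartesian_product)
qed

text \<open>Each basis form omits at most one line, so one of the two lines through \<open>P\<close>
  is still a factor.\<close>

lemma star_form_vanishes:
  assumes "i < l" "j < l" "i \<noteq> j" "lin (L i) P = 0" "lin (L j) P = 0"
  shows "star_form l e \<sigma> L b P = 0"
proof (cases b)
  case (Inl kj)
  obtain k m where km: "kj = (k, m)" by force
  have "i \<in> {..<l} - {k} \<or> j \<in> {..<l} - {k}" using assms by auto
  then have "(\<Prod>k\<in>{..<l} - {k}. lin (L k) P) = 0" using assms(4,5) by (auto intro: prod_zero)
  then show ?thesis by (simp add: Inl km star_form_def)
next
  case (Inr kj)
  have "(\<Prod>k<l. lin (L k) P) = 0" using assms by (auto intro: prod_zero)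
  then show ?thesis by (simp add: Inr star_form_def split: prod.splits)
qed

text \<open>On the conic of points (1, t, t^2) a nonzero line restricts to a nonzero
  polynomial.\<close>

lemma lines_nonzero_somewhere:
  fixes L :: "'k \<Rightarrow> 'a::alg_closed_field \<times> 'a \<times> 'a"
  assumes "finite K" "\<And>k. k \<in> K \<Longrightarrow> L k \<noteq> (0, 0, 0)"
  shows "\<exists>P. \<forall>k\<in>K. lin (L k) P \<noteq> 0"
proof -
  have "\<exists>t. t \<notin> {} \<and> (\<forall>k\<in>K. poly [:coord 0 (L k), coord 1 (L k), coord 2 (L k):] t \<noteq> 0)"
  proof (intro common_nonroot assms(1))
    fix k assume "k \<in> K"
    then show "[:coord 0 (L k), coord 1 (L k), coord 2 (L k):] \<noteq> 0"
      using assms(2)[of k] by (cases "L k") (auto simp: coord_def)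
  qed auto
  then obtain t where "\<forall>k\<in>K. lin (L k) (1, t, t\<^sup>2) \<noteq> 0"
    by (auto simp: lin_coord coord_def algebra_simps power2_eq_square)
  then show ?thesis by blast
qed

lemma third_index: "l \<ge> 3 \<Longrightarrow> \<exists>k<l. k \<noteq> i \<and> k \<noteq> (j::nat)"
  by presburger

lemma general_position_nonzero:
  assumes "general_position l L" "l \<ge> 3" "i < l"
  shows "L i \<noteq> (0, 0, 0 :: 'a::field)"
  using general_position_D_tuple[OF assms(1,2)] assms(3) unfolding D_tuple_def
  by (elim conjE) simp

text \<open>Otherwise \<open>L k\<close> would pass through the intersection of \<open>L i\<close>
  with a third line.\<close>

lemma line_restriction_nonzero:
  fixes L :: "nat \<Rightarrow> 'a::field \<times> 'a \<times> 'a"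
  assumes gp: "general_position l L" "l \<ge> 3" and ik: "i < l" "k < l" "i \<noteq> k"
    and s: "s \<le> 2" "coord s (L i) \<noteq> 0"
  shows "[:lin (L k) (line_point s (L i) 0 1), lin (L k) (line_point s (L i) 1 0):] \<noteq> 0"
proof
  assume 0: "[:lin (L k) (line_point s (L i) 0 1), lin (L k) (line_point s (L i) 1 0):] = 0"
  obtain m where m: "m < l" "m \<noteq> i" "m \<noteq> k" using third_index[OF gp(2)] by blast
  let ?P = "cross (L i) (L m)"
  have "?P = line_point s (L i) (coord (compl1 s) ?P) (coord (compl2 s) ?P)"
    by (intro point_on_line s) simp
  then have "lin (L k) ?P = lin (L k) (line_point s (L i) 1 0) * coord (compl1 s) ?P +
      lin (L k) (line_point s (L i) 0 1) * coord (compl2 s) ?P"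
    using lin_line_point_linear by metis
  then have "lin (L k) ?P = 0" using 0 by simp
  then show False using gp(1) ik m unfolding general_position_def by blast
qed

text \<open>On line \<open>i\<close> only the forms \<open>Inl (i, j)\<close> survive; cancelling
  the other lines leaves the polynomial with coefficients \<open>c (Inl (i, j))\<close>. Once these
  are 0, a ternary form times the product of all lines remains.\<close>

lemma star_forms_independent:
  fixes L :: "nat \<Rightarrow> 'a::alg_closed_field \<times> 'a \<times> 'a"
  assumes gp: "general_position l L" "l \<ge> 3"
    and \<sigma>: "\<And>i. i < l \<Longrightarrow> \<sigma> i \<le> 2" "\<And>i. i < l \<Longrightarrow> coord (\<sigma> i) (L i) \<noteq> 0"
  shows "indep_on UNIV (star_indices l e) (star_form l e \<sigma> L)"
  unfolding indep_on_def
proof (intro allI impI)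
  fix c :: "star_index \<Rightarrow> 'a"
  assume "\<forall>P\<in>UNIV. (\<Sum>b\<in>star_indices l e. c b * star_form l e \<sigma> L b P) = 0"
  then have c: "(\<Sum>i<l. \<Sum>j\<le>e. c (Inl (i, j)) * star_form l e \<sigma> L (Inl (i, j)) P) +
      (\<Sum>ij | fst ij + snd ij < e. c (Inr ij) * star_form l e \<sigma> L (Inr ij) P) = 0" for P
    by (simp only: sum_star_indices UNIV_I Ball_def)
  have Inl0: "c (Inl (i, j)) = 0" if i: "i < l" and j: "j \<le> e" for i j
  proof -
    define Q where "Q t = line_point (\<sigma> i) (L i) t 1" for t
    define q where "q k = [:lin (L k) (line_point (\<sigma> i) (L i) 0 1), lin (L k) (line_point (\<sigma> i) (L i) 1 0):]" for k
    have qQ: "lin (L k) (Q t) = poly (q k) t" for k t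
      unfolding Q_def by (subst lin_line_point_linear) (simp add: q_def mult.commute)
    have Qi: "lin (L i) (Q t) = 0" for t
      unfolding Q_def using \<sigma>[OF i] by (intro lin_line_point)
    define p where "p = (\<Sum>j\<le>e. monom (c (Inl (i, j))) j)"
    have "poly (p * (\<Prod>k\<in>{..<l} - {i}. q k)) t = 0" for t
    proof -
      have "(\<Sum>j\<le>e. c (Inl (k, j)) * star_form l e \<sigma> L (Inl (k, j)) (Q t)) = 0"
        if "k \<in> {..<l} - {i}" for k
      proof -
        have "(\<Prod>k\<in>{..<l} - {k}. lin (L k) (Q t)) = 0"
          using that i Qi by (auto intro!: prod_zero)
        then have "star_form l e \<sigma> L (Inl (k, j)) (Q t) = 0" for j
          unfolding star_form_def by (simp only: sum.case prod.case mult_zero_right)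
        then show ?thesis by simp
      qed
      then have "(\<Sum>k<l. \<Sum>j\<le>e. c (Inl (k, j)) * star_form l e \<sigma> L (Inl (k, j)) (Q t)) =
          (\<Sum>j\<le>e. c (Inl (i, j)) * star_form l e \<sigma> L (Inl (i, j)) (Q t))"
        using i by (subst sum.remove[of _ i]) auto
      moreover have "(\<Prod>k<l. lin (L k) (Q t)) = 0" using i Qi by (auto intro!: prod_zero)
      then have "(\<Sum>ij | fst ij + snd ij < e. c (Inr ij) * star_form l e \<sigma> L (Inr ij) (Q t)) = 0"
        by (intro sum.neutral) (auto simp: star_form_def)
      ultimately have "(\<Sum>j\<le>e. c (Inl (i, j)) * star_form l e \<sigma> L (Inl (i, j)) (Q t)) = 0"
        using c[of "Q t"] by simp
      moreover have "coord (compl1 (\<sigma> i)) (Q t) = t" "coord (compl2 (\<sigma> i)) (Q t) = 1"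
        unfolding Q_def using \<sigma>(1)[OF i] by (simp_all add: line_point_coord)
      then have "(\<Sum>j\<le>e. c (Inl (i, j)) * star_form l e \<sigma> L (Inl (i, j)) (Q t)) =
          (\<Sum>j\<le>e. c (Inl (i, j)) * t ^ j) * (\<Prod>k\<in>{..<l} - {i}. poly (q k) t)"
        by (simp add: star_form_def qQ sum_distrib_left mult_ac)
      ultimately show ?thesis by (simp add: p_def poly_sum poly_prod poly_monom)
    qed
    then have "p * (\<Prod>k\<in>{..<l} - {i}. q k) = 0" by (rule poly_eq_0_if_all_roots)
    moreover have "q k \<noteq> 0" if "k \<in> {..<l} - {i}" for k
      unfolding q_def using that i \<sigma>[OF i] by (intro line_restriction_nonzero[OF gp]) auto
    ultimately have "p = 0" by auto
    then have "coeff p j = 0" by simp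
    then show ?thesis using j by (simp add: p_def coeff_sum coeff_monom)
  qed
  define G where "G P = (\<Sum>ij | fst ij + snd ij < e. c (Inr ij) *
      (coord 0 P ^ fst ij * coord 1 P ^ snd ij * coord 2 P ^ (e - 1 - fst ij - snd ij)))" for P
  have GP: "G P * (\<Prod>k<l. lin (L k) P) = 0" for P
  proof -
    have "G P * (\<Prod>k<l. lin (L k) P) =
        (\<Sum>ij | fst ij + snd ij < e. c (Inr ij) * star_form l e \<sigma> L (Inr ij) P)"
      by (simp add: G_def star_form_def sum_distrib_right mult.assoc case_prod_beta)
    then show ?thesis using c[of P] Inl0 by simp
  qed
  obtain P where P: "\<forall>k\<in>{..<l}. lin (L k) P \<noteq> 0"
    using lines_nonzero_somewhere[of "{..<l}" L] general_position_nonzero[OF gp] by blast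
  define pt where "pt x = (x 0, x 1, x 2)" for x :: "nat \<Rightarrow> 'a"
  have pt: "polynomial_map 3 (\<lambda>x. coord i (pt x))" for i
    by (cases "i = 0"; cases "i = 1") (auto simp: pt_def coord_def intro!: polynomial_map_var)
  have pmG: "polynomial_map 3 (\<lambda>x. G (pt x))" unfolding G_def
    by (intro polynomial_map_sum polynomial_map_mult polynomial_map_const polynomial_map_power pt)
  have pmL: "polynomial_map 3 (\<lambda>x. \<Prod>k<l. lin (L k) (pt x))" unfolding lin_coord
    by (intro polynomial_map_prod polynomial_map_add polynomial_map_mult polynomial_map_const pt)
  \<comment> \<open>\<open>G\<close> vanishes off the lines; joining an arbitrary point to a point
    \<open>P\<close> off the lines carries this over to all points.\<close>
  have G0: "G (pt x) = 0" for x
  proof (rule ccontr)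
    assume "G (pt x) \<noteq> 0"
    moreover have "(\<Prod>k<l. lin (L k) (pt (\<lambda>i. coord i P))) \<noteq> 0"
      using P by (simp add: pt_def coord_def)
    ultimately have "\<exists>t. G (pt (\<lambda>i. x i + t * (coord i P - x i))) \<noteq> 0 \<and>
      (\<Prod>k<l. lin (L k) (pt (\<lambda>i. x i + t * (coord i P - x i)))) \<noteq> 0"
      by (rule polynomial_map_common_nonzero[OF pmG pmL])
    then obtain t where
      "G (pt (\<lambda>i. x i + t * (coord i P - x i))) \<noteq> 0"
      "(\<Prod>k<l. lin (L k) (pt (\<lambda>i. x i + t * (coord i P - x i)))) \<noteq> 0"
      by (elim exE conjE)
    then have "G (pt (\<lambda>i. x i + t * (coord i P - x i))) *
      (\<Prod>k<l. lin (L k) (pt (\<lambda>i. x i + t * (coord i P - x i)))) \<noteq> 0"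
      by (rule no_zero_divisors)
    then show False by (rule notE) (rule GP)
  qed
  have Inr0: "c (Inr ij) = 0" if "fst ij + snd ij < e" for ij
  proof -
    define g where "g = (\<lambda>ij (i::nat). if i = 0 then fst ij else if i = 1 then snd ij else e - 1 - fst ij - snd ij)"
    have "{(a, b). a + b < e} = {ij. fst ij + snd ij < e}" by auto
    then have fin: "finite {ij. fst ij + snd ij < e}" using card_pairs_sum_less(2)[of e] by simp
    have inj: "inj_on (\<lambda>ij. restrict (g ij) {..<3}) {ij. fst ij + snd ij < e}"
    proof (rule inj_onI)
      fix ij kl :: "nat \<times> nat" assume "restrict (g ij) {..<3} = restrict (g kl) {..<3}"
      from fun_cong[OF this, of 0] fun_cong[OF this, of 1] show "ij = kl"
        by (simp add: g_def prod_eq_iff)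
    qed
    have "(\<Sum>ij | fst ij + snd ij < e. c (Inr ij) * (\<Prod>i<3. x i ^ g ij i)) = 0" for x
      using G0[of x] by (simp add: G_def pt_def g_def coord_def numeral_3_eq_3 numeral_2_eq_2)
    from monomials_independent[OF fin inj this, of ij] that show ?thesis by simp
  qed
  show "\<forall>b\<in>star_indices l e. c b = 0"
    using Inl0 Inr0 by (auto simp: star_indices_def)
qed

definition index_pairs :: "nat \<Rightarrow> (nat \<times> nat) set" where
  "index_pairs l = {(i, j). i < j \<and> j < l}"

lemma card_index_pairs: "card (index_pairs l) = (l choose 2)" "finite (index_pairs l)"
proof (induction l)
  case (Suc l)
  have eq: "index_pairs (Suc l) = index_pairs l \<union> (\<lambda>i. (i, l)) ` {..<l}"
    by (auto simp: index_pairs_def less_Suc_eq)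
  { case 2 then show ?case using Suc.IH(2) by (simp add: eq) }
  { case 1
    have "card ((\<lambda>i. (i, l)) ` {..<l}) = l" by (subst card_image) (auto simp: inj_on_def)
    moreover have "index_pairs l \<inter> (\<lambda>i. (i, l)) ` {..<l} = {}" by (auto simp: index_pairs_def)
    ultimately show ?case
      using Suc.IH unfolding eq by (subst card_Un_disjoint) (auto simp: numeral_2_eq_2) }
qed (auto simp: index_pairs_def)

text \<open>The star forms together with one form per point of the configuration, dual to evaluation at
  that point, are as many as the monomials of degree \<open>l + e - 1\<close>.\<close>

lemma star_forms_span:
  fixes L :: "nat \<Rightarrow> 'a::alg_closed_field \<times> 'a \<times> 'a"
  assumes gp: "general_position l L" "l \<ge> 3"
    and \<sigma>: "\<And>i. i < l \<Longrightarrow> \<sigma> i \<le> 2" "\<And>i. i < l \<Longrightarrow> coord (\<sigma> i) (L i) \<noteq> 0"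
    and f: "pform (l + e - 1) f" "\<And>i j. i < j \<Longrightarrow> j < l \<Longrightarrow> f (cross (L i) (L j)) = 0"
  shows "\<exists>y. \<forall>P. f P = (\<Sum>b\<in>star_indices l e. y b * star_form l e \<sigma> L b P)"
proof -
  define pt where "pt ij = cross (L (fst ij)) (L (snd ij))" for ij
  have lin_pt: "lin (L k) (pt ij) = 0 \<longleftrightarrow> k = fst ij \<or> k = snd ij"
    if "ij \<in> index_pairs l" "k < l" for ij k
  proof -
    have "lin (L k) (pt ij) \<noteq> 0" if "k \<noteq> fst ij" "k \<noteq> snd ij"
      using gp(1) \<open>ij \<in> index_pairs l\<close> \<open>k < l\<close> that
      unfolding general_position_def pt_def index_pairs_def by auto
    moreover have "lin (L (fst ij)) (pt ij) = 0" "lin (L (snd ij)) (pt ij) = 0"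
      by (simp_all add: pt_def)
    ultimately show ?thesis by auto
  qed
  have "\<exists>s. coord s (pt ij) \<noteq> 0" if "ij \<in> index_pairs l" for ij
  proof -
    obtain m where m: "m < l" "m \<noteq> fst ij" "m \<noteq> snd ij" using third_index[OF gp(2)] by blast
    then have "lin (L m) (pt ij) \<noteq> 0" using lin_pt[OF that] by blast
    then show ?thesis by (rule contrapos_np) (simp add: lin_coord)
  qed
  then obtain s where s: "\<And>ij. ij \<in> index_pairs l \<Longrightarrow> coord (s ij) (pt ij) \<noteq> 0" by metis
  \<comment> \<open>The exponent \<open>e + 1\<close> raises the product of \<open>l - 2\<close>
    lines to degree \<open>l + e - 1\<close>. The form is nonzero at its own point and vanishes at
    all the others.\<close>
  define g where "g ij P = coord (s ij) P ^ (e + 1) * (\<Prod>k\<in>{..<l} - {fst ij, snd ij}. lin (L k) P)" for ij P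
  have g_pt: "g ij (pt kl) = 0 \<longleftrightarrow> ij \<noteq> kl" if "ij \<in> index_pairs l" "kl \<in> index_pairs l" for ij kl
  proof
    assume "g ij (pt kl) = 0"
    then show "ij \<noteq> kl" using s[OF that(1)] lin_pt[OF that(1)] by (auto simp: g_def)
  next
    assume ne: "ij \<noteq> kl"
    obtain i j k l' where ijkl: "ij = (i, j)" "kl = (k, l')" by force
    have "k \<in> {..<l} - {i, j} \<or> l' \<in> {..<l} - {i, j}"
      using that ne by (auto simp: ijkl index_pairs_def)
    moreover have "lin (L k) (pt kl) = 0" "lin (L l') (pt kl) = 0" by (simp_all add: pt_def ijkl)
    ultimately have "(\<Prod>k\<in>{..<l} - {i, j}. lin (L k) (pt kl)) = 0" by (auto intro!: prod_zero)
    then show "g ij (pt kl) = 0" by (simp add: g_def ijkl)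
  qed
  have pform_g: "pform (l + e - 1) (g ij)" if "ij \<in> index_pairs l" for ij
  proof -
    have "pform (1 * (e + 1) + card ({..<l} - {fst ij, snd ij})) (g ij)"
      unfolding g_def by (intro pform_mult pform_power pform_coord pform_prod_lin) auto
    moreover have "card ({..<l} - {fst ij, snd ij}) = l - 2"
      using that by (subst card_Diff_subset) (auto simp: index_pairs_def)
    then have "1 * (e + 1) + card ({..<l} - {fst ij, snd ij}) = l + e - 1" using gp(2) by simp
    ultimately show ?thesis by (simp only:)
  qed
  \<comment> \<open>One form more than the dimension; \<open>Inr None\<close> stands for
    \<open>f\<close>. In the resulting relation, evaluation at the points removes the
    \<open>g\<close>, and independence of the star forms gives \<open>f\<close> a nonzero
    coefficient.\<close>
  define A where "A = star_indices l e <+> insert None (Some ` index_pairs l)"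
  define u where "u a = (case a of Inl b \<Rightarrow> star_form l e \<sigma> L b | Inr None \<Rightarrow> f | Inr (Some ij) \<Rightarrow> g ij)" for a
  have finA: "finite A"
    unfolding A_def using finite_star_indices card_index_pairs(2) by (intro finite_Plus) auto
  have "card A = card (star_indices l e) + (l choose 2) + 1"
    unfolding A_def using finite_star_indices card_index_pairs[of l]
    by (subst card_Plus) (auto simp: card_image)
  also have "\<dots> = card (plane_monos (l + e - 1)) + 1"
    unfolding card_star_indices card_plane_monos using gp(2) by simp
  finally have card: "card (plane_monos (l + e - 1)) < card A" by simp
  from underdetermined_system[OF finite_plane_monos finA card, of "\<lambda>a. form_coeff (l + e - 1) (u a)"]
  obtain c where c: "\<exists>a\<in>A. c a \<noteq> 0"
    "\<forall>m\<in>plane_monos (l + e - 1). (\<Sum>a\<in>A. c a * form_coeff (l + e - 1) (u a) m) = 0" by blast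
  have pform_u: "pform (l + e - 1) (u a)" if "a \<in> A" for a
    using that star_form_pform[where l = l and e = e] pform_g f(1) gp(2)
    by (auto simp: A_def u_def)
  have sum_u: "(\<Sum>a\<in>A. c a * u a P) = 0" for P
  proof -
    have "(\<Sum>a\<in>A. c a * u a P) = (\<Sum>a\<in>A. c a * curve_eval (l + e - 1) (form_coeff (l + e - 1) (u a)) P)"
      by (intro sum.cong refl) (simp only: curve_eval_form_coeff[OF pform_u])
    also have "\<dots> = (\<Sum>m\<in>plane_monos (l + e - 1). (\<Sum>a\<in>A. c a * form_coeff (l + e - 1) (u a) m) * mono3 m P)"
      unfolding curve_eval_mono3 sum_distrib_left sum_distrib_right
      by (subst sum.swap) (simp add: mult.assoc)
    finally show ?thesis using c(2) by simp
  qed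
  have rel: "(\<Sum>b\<in>star_indices l e. c (Inl b) * star_form l e \<sigma> L b P) +
      (c (Inr None) * f P + (\<Sum>ij\<in>index_pairs l. c (Inr (Some ij)) * g ij P)) = 0" for P
    using sum_u[of P] finite_star_indices card_index_pairs(2) unfolding A_def
    by (subst (asm) sum.Plus) (auto simp: u_def sum.reindex)
  have cg: "c (Inr (Some ij)) = 0" if ij: "ij \<in> index_pairs l" for ij
  proof -
    have "star_form l e \<sigma> L b (pt ij) = 0" for b
      using ij by (intro star_form_vanishes[of "fst ij" l "snd ij"])
        (auto simp: index_pairs_def pt_def)
    moreover have "f (pt ij) = 0" using ij f(2) by (auto simp: pt_def index_pairs_def)
    moreover have "(\<Sum>kl\<in>index_pairs l. c (Inr (Some kl)) * g kl (pt ij)) = c (Inr (Some ij)) * g ij (pt ij)"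
    proof -
      have "(\<Sum>kl\<in>index_pairs l - {ij}. c (Inr (Some kl)) * g kl (pt ij)) = 0"
      proof (intro sum.neutral ballI)
        fix kl assume "kl \<in> index_pairs l - {ij}"
        then have "g kl (pt ij) = 0" using g_pt[of kl ij] ij by blast
        then show "c (Inr (Some kl)) * g kl (pt ij) = 0" by simp
      qed
      then show ?thesis using ij card_index_pairs(2)[of l] by (simp add: sum.remove[of _ ij])
    qed
    ultimately have "c (Inr (Some ij)) * g ij (pt ij) = 0" using rel[of "pt ij"] by simp
    then show ?thesis using g_pt[OF ij ij] by auto
  qed
  have rel': "(\<Sum>b\<in>star_indices l e. c (Inl b) * star_form l e \<sigma> L b P) + c (Inr None) * f P = 0" for P
    using rel[of P] cg by simp
  have "c (Inr None) \<noteq> 0"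
  proof
    assume c0: "c (Inr None) = 0"
    then have "c (Inl b) = 0" if "b \<in> star_indices l e" for b
      using star_forms_independent[OF gp \<sigma>, where e = e, unfolded indep_on_def, rule_format, of "\<lambda>b. c (Inl b)" b]
        rel' that by simp
    then show False using c(1) cg c0 by (auto simp: A_def)
  qed
  then have "f P = (\<Sum>b\<in>star_indices l e. (- c (Inl b) / c (Inr None)) * star_form l e \<sigma> L b P)" for P
    using rel'[of P] by (simp add: sum_negf sum_divide_distrib[symmetric] field_simps add_eq_0_iff)
  then show ?thesis by (intro exI[of _ "\<lambda>b. - c (Inl b) / c (Inr None)"] allI)
qed

section \<open>Charts and the upper bound\<close>

definition chart_line :: "nat \<Rightarrow> 'a::one \<Rightarrow> 'a \<Rightarrow> 'a \<times> 'a \<times> 'a" where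
  "chart_line s a b = (if s = 0 then (1, a, b) else if s = 1 then (a, 1, b) else (a, b, 1))"

definition scale3 :: "'a::comm_ring_1 \<Rightarrow> 'a \<times> 'a \<times> 'a \<Rightarrow> 'a \<times> 'a \<times> 'a" where
  "scale3 r a = (r * coord 0 a, r * coord 1 a, r * coord 2 a)"

lemma coord_scale3: "coord i (scale3 r a) = r * coord i a"
  by (simp add: scale3_def coord_def)

lemma lin_scale3: "lin (scale3 r a) P = r * lin a P"
  by (simp add: lin_coord coord_scale3 algebra_simps)

lemma lin_cross_scale3:
  "lin (scale3 t c) (cross (scale3 r a) (scale3 s b)) = t * r * s * lin c (cross a b)"
  by (simp add: lin_coord cross_def scale3_def coord_def algebra_simps)

lemma general_position_scale3:
  assumes "general_position l L" "\<And>i. i < l \<Longrightarrow> r i \<noteq> (0::'a::field)"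
  shows "general_position l (\<lambda>i. scale3 (r i) (L i))"
  using assms unfolding general_position_def lin_cross_scale3 by simp

lemma scale3_chart_line:
  fixes a :: "'a::field \<times> 'a \<times> 'a"
  assumes "s \<le> 2" "coord s a \<noteq> 0"
  shows "scale3 (inverse (coord s a)) a =
    chart_line s (coord (compl1 s) a / coord s a) (coord (compl2 s) a / coord s a)"
proof -
  consider "s = 0" | "s = 1" | "s = 2" using assms(1) by linarith
  then show ?thesis using assms(2)
    by cases (auto simp: scale3_def chart_line_def compl1_def compl2_def coord_def field_simps)
qed

lemma general_position_cross_nonzero:
  assumes "general_position l L" "l \<ge> 3" "i < l" "j < l" "i \<noteq> j"
  shows "cross (L i) (L j) \<noteq> (0, 0, 0 :: 'a::field)"
proof
  assume *: "cross (L i) (L j) = (0, 0, 0)"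
  obtain k where "k < l" "k \<noteq> i" "k \<noteq> j" using third_index[OF assms(2)] by blast
  then have "lin (L k) (cross (L i) (L j)) \<noteq> 0"
    using assms unfolding general_position_def by blast
  then show False by (simp add: * lin_def)
qed

lemma star_form_polynomial_map:
  assumes "\<And>i k. i < l \<Longrightarrow> polynomial_map n (\<lambda>x. coord k (L x i))"
  shows "polynomial_map n (\<lambda>x. star_form l e \<sigma> (L x) b P)"
proof -
  have "polynomial_map n (\<lambda>x. lin (L x i) P)" if "i < l" for i
    unfolding lin_coord
    by (intro polynomial_map_add polynomial_map_mult polynomial_map_const assms that)
  then show ?thesis unfolding star_form_def
    by (cases b) (auto split: prod.splits intro!: polynomial_map_mult polynomial_map_prod
        polynomial_map_const)
qed

lemma star_dimension_upper:
  assumes "l \<ge> 3"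
  shows "\<not> irred_chain (plane_monos (l + e - 1))
    (proj_closure (plane_monos (l + e - 1))
      (S_star (l + e - 1) l :: ((nat \<Rightarrow>\<^sub>0 nat) \<Rightarrow> 'a::alg_closed_field) set))
    (Suc (2 * l + (card (star_indices l e) - 1)))"
proof -
  let ?B = "star_indices l e" and ?d = "l + e - 1"
  let ?n = "2 * l + (card ?B - 1)"
  have finB: "finite ?B" by (rule finite_star_indices)
  have "\<forall>b0. \<exists>pos. b0 \<in> ?B \<longrightarrow> bij_betw pos (?B - {b0}) {0..<card ?B - 1}"
  proof
    fix b0
    show "\<exists>pos. b0 \<in> ?B \<longrightarrow> bij_betw pos (?B - {b0}) {0..<card ?B - 1}"
      using ex_bij_betw_finite_nat[of "?B - {b0}"] finB
      by (cases "b0 \<in> ?B") (simp_all add: card_Diff_singleton)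
  qed
  then have "\<exists>pos. \<forall>b0. b0 \<in> ?B \<longrightarrow> bij_betw (pos b0) (?B - {b0}) {0..<card ?B - 1}"
    by (simp only: choice_iff)
  then obtain pos where pos: "\<And>b0. b0 \<in> ?B \<Longrightarrow> bij_betw (pos b0) (?B - {b0}) {0..<card ?B - 1}"
    by blast
  define line where "line \<sigma> x i = chart_line (\<sigma> i) (x (2 * i)) (x (2 * i + 1))"
    for \<sigma> :: "nat \<Rightarrow> nat" and x :: "nat \<Rightarrow> 'a" and i
  define y where "y b0 x b = (if b = b0 then 1 else x (2 * l + pos b0 b))"
    for b0 and x :: "nat \<Rightarrow> 'a" and b
  define f where "f s x P = (\<Sum>b\<in>?B. y (snd s) x b * star_form l e (fst s) (line (fst s) x) b P)"
    for s x P
  define \<phi> where "\<phi> s x = form_coeff ?d (f s x)" for s x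
  \<comment> \<open>A chart is a choice of the coordinate set to 1 on each line and of the basis
    form \<open>b0\<close> with coefficient 1; extensional functions make the set of choices
    finite.\<close>
  define I where "I = ({..<l} \<rightarrow>\<^sub>E {..2::nat}) \<times> ?B"
  have "finite I" unfolding I_def using finB by (simp add: finite_PiE)
  moreover have "polynomial_map ?n (\<lambda>x. \<phi> s x v)" if "s \<in> I" for s v
  proof -
    have s: "snd s \<in> ?B" using that unfolding I_def mem_Times_iff by (rule conjunct2)
    have "polynomial_map ?n (\<lambda>x. coord k (line \<sigma> x i))" if i: "i < l" for k \<sigma> i
    proof -
      have v: "polynomial_map ?n (\<lambda>x. x (2 * i))" "polynomial_map ?n (\<lambda>x. x (2 * i + 1))"
        using i by (auto intro!: polynomial_map_var)
      show ?thesis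
        unfolding line_def chart_line_def
        by (cases "k = 0"; cases "k = 1"; cases "\<sigma> i = 0"; cases "\<sigma> i = 1")
          (use v in \<open>simp_all add: coord_def polynomial_map_const\<close>)
    qed
    moreover have "polynomial_map ?n (\<lambda>x. y (snd s) x b)" if "b \<in> ?B" for b
    proof (cases "b = snd s")
      case False
      then have "pos (snd s) b < card ?B - 1"
        using bij_betwE[OF pos[OF s]] that by auto
      then show ?thesis using False by (auto simp: y_def intro!: polynomial_map_var)
    qed (auto simp: y_def intro: polynomial_map_const)
    ultimately show ?thesis unfolding \<phi>_def f_def
      by (intro form_coeff_polynomial_map polynomial_map_sum polynomial_map_mult
          star_form_polynomial_map)
  qed
  moreover have "S_star ?d l \<subseteq> cone_pts (plane_monos ?d)" unfolding S_star_def by (rule Collect_restrict)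
  moreover have "\<exists>s\<in>I. \<exists>x a. c = (\<lambda>v. a * \<phi> s x v)" if c: "c \<in> S_star ?d l" for c
  proof -
    obtain L where cone: "c \<in> cone_pts (plane_monos ?d)" and L: "D_tuple l L" "contains_star ?d l c L"
      using c unfolding S_star_def by blast
    have gpL: "general_position l L" by (rule D_tuple_general_position[OF L(1)])
    have "\<exists>s\<le>2. coord s (L i) \<noteq> 0" if "i < l" for i
    proof -
      obtain a b c where abc: "L i = (a, b, c)" by (metis surj_pair)
      then consider "a \<noteq> 0" | "b \<noteq> 0" | "c \<noteq> 0"
        using general_position_nonzero[OF gpL assms \<open>i < l\<close>] by auto
      then show ?thesis
      proof cases
        case 1
        then show ?thesis using abc by (intro exI[of _ 0]) auto
      next
        case 2
        then show ?thesis using abc by (intro exI[of _ 1]) auto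
      next
        case 3
        then show ?thesis using abc by (intro exI[of _ 2]) auto
      qed
    qed
    then have "\<forall>i. \<exists>s. i < l \<longrightarrow> s \<le> 2 \<and> coord s (L i) \<noteq> 0" by blast
    then have "\<exists>\<sigma>. \<forall>i. i < l \<longrightarrow> \<sigma> i \<le> 2 \<and> coord (\<sigma> i) (L i) \<noteq> 0" by (simp only: choice_iff)
    then obtain \<sigma>' where \<sigma>': "\<And>i. i < l \<Longrightarrow> \<sigma>' i \<le> 2" "\<And>i. i < l \<Longrightarrow> coord (\<sigma>' i) (L i) \<noteq> 0"
      by blast
    define \<sigma> where "\<sigma> = restrict \<sigma>' {..<l}"
    have \<sigma>: "\<sigma> i \<le> 2" "coord (\<sigma> i) (L i) \<noteq> 0" if "i < l" for i
      using \<sigma>' that by (auto simp: \<sigma>_def)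
    define L' where "L' i = scale3 (inverse (coord (\<sigma> i) (L i))) (L i)" for i
    have gp: "general_position l L'"
      unfolding L'_def using \<sigma> by (intro general_position_scale3 gpL) auto
    have L'_coord: "coord (\<sigma> i) (L' i) \<noteq> 0" if "i < l" for i
      using \<sigma>[OF that] by (simp add: L'_def coord_scale3)
    have "curve_eval ?d c (cross (L' i) (L' j)) = 0" if ij: "i < j" "j < l" for i j
    proof -
      have "lin (L' i) (cross (L' i) (L' j)) = 0" "lin (L' j) (cross (L' i) (L' j)) = 0" by simp_all
      then have "lin (L i) (cross (L' i) (L' j)) = 0" "lin (L j) (cross (L' i) (L' j)) = 0"
        using \<sigma>(2)[of i] \<sigma>(2)[of j] ij unfolding L'_def lin_scale3 by auto
      moreover have "cross (L' i) (L' j) \<noteq> (0, 0, 0)"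
        using ij by (intro general_position_cross_nonzero[OF gp assms]) auto
      ultimately show ?thesis
        using L(2)[unfolded contains_star_def, rule_format, of i j "cross (L' i) (L' j)"] ij by simp
    qed
    moreover have "pform ?d (curve_eval ?d c)" unfolding pform_def by blast
    ultimately obtain z where z: "\<And>P. curve_eval ?d c P = (\<Sum>b\<in>?B. z b * star_form l e \<sigma> L' b P)"
      using star_forms_span[OF gp assms \<sigma>(1) L'_coord, of e "curve_eval ?d c"] by blast
    have c_eq: "c m = form_coeff ?d (\<lambda>P. \<Sum>b\<in>?B. z b * star_form l e \<sigma> L' b P) m" for m
    proof (cases "m \<in> plane_monos ?d")
      case True
      then show ?thesis using form_coeff_curve_eval[OF True, of c] unfolding z[abs_def] by simp
    next
      case False
      then show ?thesis using cone by (simp add: form_coeff_outside cone_pts_def)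
    qed
    have "\<exists>b0\<in>?B. z b0 \<noteq> 0"
    proof (rule ccontr)
      assume "\<not> (\<exists>b0\<in>?B. z b0 \<noteq> 0)"
      then have "c m = 0" for m unfolding c_eq form_coeff_sum by simp
      then show False using cone by (auto simp: cone_pts_def)
    qed
    then obtain b0 where b0: "b0 \<in> ?B" "z b0 \<noteq> 0" by blast
    \<comment> \<open>Below \<open>2 * l\<close>, even and odd parameters are the two affine
      coordinates of a line; the later ones are the coefficients divided by \<open>z b0\<close>,
      which is the scalar restored at the end.\<close>
    define x where "x n = (if n < 2 * l then
        (if even n then coord (compl1 (\<sigma> (n div 2))) (L (n div 2)) / coord (\<sigma> (n div 2)) (L (n div 2))
         else coord (compl2 (\<sigma> (n div 2))) (L (n div 2)) / coord (\<sigma> (n div 2)) (L (n div 2)))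
        else z (inv_into (?B - {b0}) (pos b0) (n - 2 * l)) / z b0)" for n
    have line_x: "line \<sigma> x i = L' i" if "i < l" for i
      using that scale3_chart_line[OF \<sigma>(1)[OF that] \<sigma>(2)[OF that]]
      by (simp add: line_def x_def L'_def)
    have y_x: "y b0 x b = z b / z b0" if "b \<in> ?B" for b
      using that b0 bij_betw_inv_into_left[OF pos[OF b0(1)], of b]
      by (auto simp: y_def x_def)
    have "star_form l e \<sigma> (line \<sigma> x) b P = star_form l e \<sigma> L' b P" if "b \<in> ?B" for b P
      using that line_x unfolding star_form_def star_indices_def
      by (auto split: sum.splits intro!: prod.cong arg_cong2[where f = times])
    then have f_eq: "f (\<sigma>, b0) x P = (\<Sum>b\<in>?B. (z b / z b0) * star_form l e \<sigma> L' b P)" for P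
      unfolding f_def by (intro sum.cong refl) (simp add: y_x)
    have "c = (\<lambda>m. z b0 * \<phi> (\<sigma>, b0) x m)"
    proof
      fix m
      show "c m = z b0 * \<phi> (\<sigma>, b0) x m"
        unfolding \<phi>_def f_eq[abs_def] c_eq[of m] form_coeff_sum sum_distrib_left
        using b0(2) by (intro sum.cong refl) simp
    qed
    moreover have "(\<sigma>, b0) \<in> I" using b0 \<sigma>(1) by (auto simp: I_def \<sigma>_def)
    ultimately show ?thesis by blast
  qed
  ultimately show ?thesis by (rule not_irred_chain_of_charts)
qed

section \<open>Deformations of a star configuration\<close>

lemma coeff_mult_low:
  fixes p q :: "'a::comm_ring_1 poly"
  shows "coeff (p * q) 0 = coeff p 0 * coeff q 0"
    and "coeff (p * q) 1 = coeff p 0 * coeff q 1 + coeff p 1 * coeff q 0"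
    and "coeff (p * q) 2 = coeff p 0 * coeff q 2 + coeff p 1 * coeff q 1 + coeff p 2 * coeff q 0"
  by (simp_all add: coeff_mult numeral_2_eq_2 add_ac)

text \<open>Each factor moves by \<open>a j * m\<close> at first order and by \<open>y j\<close> at
  second order. Order 2 of the product consists of one second-order move or of two first-order ones,
  and the latter are read off from \<open>R\<close>.\<close>

lemma coeff_prod_perturbed:
  fixes x a y :: "'j \<Rightarrow> 'a::comm_ring_1" and m :: 'a
  assumes "finite J"
  defines "Q \<equiv> \<lambda>K. (\<Prod>j\<in>K. [:x j, a j * m, y j:])" and "R \<equiv> \<lambda>K. (\<Prod>j\<in>K. [:x j, a j:])"
  shows "coeff (Q J) 0 = (\<Prod>j\<in>J. x j)"
    and "coeff (R J) 0 = (\<Prod>j\<in>J. x j)"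
    and "coeff (Q J) 1 = m * coeff (R J) 1"
    and "coeff (Q J) 2 = (\<Sum>j\<in>J. y j * (\<Prod>k\<in>J - {j}. x k)) + m\<^sup>2 * coeff (R J) 2"
  using assms(1)
proof (induction J rule: finite_induct)
  case (insert i J)
  have Qi: "Q (insert i J) = [:x i, a i * m, y i:] * Q J" and Ri: "R (insert i J) = [:x i, a i:] * R J"
    using insert.hyps by (simp_all add: Q_def R_def)
  have "(\<Sum>j\<in>J. y j * (\<Prod>k\<in>insert i J - {j}. x k)) = x i * (\<Sum>j\<in>J. y j * (\<Prod>k\<in>J - {j}. x k))"
    unfolding sum_distrib_left
  proof (intro sum.cong refl)
    fix j assume "j \<in> J"
    then have "insert i J - {j} = insert i (J - {j})" using insert.hyps by auto
    then show "y j * (\<Prod>k\<in>insert i J - {j}. x k) = x i * (y j * (\<Prod>k\<in>J - {j}. x k))"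
      using insert.hyps by simp
  qed
  moreover have "insert i J - {i} = J" using insert.hyps by auto
  ultimately have sum_i: "(\<Sum>j\<in>insert i J. y j * (\<Prod>k\<in>insert i J - {j}. x k)) =
      y i * (\<Prod>k\<in>J. x k) + x i * (\<Sum>j\<in>J. y j * (\<Prod>k\<in>J - {j}. x k))"
    using insert.hyps by simp
  have low: "coeff [:x i, a i * m, y i:] 0 = x i" "coeff [:x i, a i * m, y i:] 1 = a i * m"
    "coeff [:x i, a i * m, y i:] 2 = y i" "coeff [:x i, a i:] 0 = x i" "coeff [:x i, a i:] 1 = a i"
    "coeff [:x i, a i:] 2 = 0"
    by (simp_all add: numeral_2_eq_2)
  { case 1 show ?case unfolding Qi coeff_mult_low low using insert by simp }
  { case 2 show ?case unfolding Ri coeff_mult_low low using insert by simp }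
  { case 3 show ?case unfolding Qi Ri coeff_mult_low low insert.IH by (simp add: algebra_simps) }
  { case 4 show ?case unfolding Qi Ri coeff_mult_low low insert.IH sum_i
      by (simp add: algebra_simps power2_eq_square) }
qed (simp_all add: Q_def R_def)

text \<open>The product rule for the derivative of the full product.\<close>

lemma coeff_sum_omit_one:
  fixes x a :: "nat \<Rightarrow> 'a::idom"
  shows "(\<Sum>i<l. a i * coeff (\<Prod>j\<in>{..<l} - {i}. [:x j, a j:]) n) =
    of_nat (Suc n) * coeff (\<Prod>j<l. [:x j, a j:]) (Suc n)"
proof -
  have "of_nat (Suc n) * coeff (\<Prod>j<l. [:x j, a j:]) (Suc n) = coeff (pderiv (\<Prod>j<l. [:x j, a j:])) n"
    by (simp add: coeff_pderiv)
  also have "pderiv (\<Prod>j<l. [:x j, a j:]) = (\<Sum>i<l. smult (a i) (\<Prod>j\<in>{..<l} - {i}. [:x j, a j:]))"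
    unfolding pderiv_prod by (intro sum.cong refl) (simp add: pderiv_pCons)
  finally show ?thesis by (simp add: coeff_sum)
qed

lemma poly_split2:
  fixes p :: "'a::comm_ring_1 poly"
  shows "\<exists>r. \<forall>t. poly p t = coeff p 0 + t * coeff p 1 + t\<^sup>2 * (coeff p 2 + t * poly r t)"
proof -
  obtain c0 p1 where "p = pCons c0 p1" by (cases p)
  moreover obtain c1 p2 where "p1 = pCons c1 p2" by (cases p1)
  moreover obtain c2 r where "p2 = pCons c2 r" by (cases p2)
  ultimately show ?thesis
    by (intro exI[of _ r]) (simp add: numeral_2_eq_2 algebra_simps)
qed

text \<open>Each power of the variable replaces one linear factor by a constant. The vanishing above
  \<open>card J\<close> covers the top coefficient in the induction.\<close>

lemma pform_coeff_prod:
  fixes L :: "'j \<Rightarrow> 'a::comm_ring_1 \<times> 'a \<times> 'a"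
  assumes "finite J"
  shows "n \<le> card J \<Longrightarrow> pform (card J - n) (\<lambda>P. coeff (\<Prod>j\<in>J. [:lin (L j) P, a j:]) n)"
    and "n > card J \<Longrightarrow> coeff (\<Prod>j\<in>J. [:lin (L j) P, a j:]) n = 0"
  using assms
proof (induction J arbitrary: n P rule: finite_induct)
  case empty
  { case 1 then show ?case using pform_const by simp }
  { case 2 then show ?case by simp }
next
  case (insert i J)
  have rec: "coeff (\<Prod>j\<in>insert i J. [:lin (L j) P, a j:]) n =
      lin (L i) P * coeff (\<Prod>j\<in>J. [:lin (L j) P, a j:]) n +
      a i * (case n of 0 \<Rightarrow> 0 | Suc n' \<Rightarrow> coeff (\<Prod>j\<in>J. [:lin (L j) P, a j:]) n')" for P n
    using insert.hyps by (simp add: coeff_pCons split: nat.split)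
  { case 1
    have A: "pform (card (insert i J) - n) (\<lambda>P. lin (L i) P * coeff (\<Prod>j\<in>J. [:lin (L j) P, a j:]) n)"
    proof (cases "n \<le> card J")
      case True
      then have "pform (1 + (card J - n)) (\<lambda>P. lin (L i) P * coeff (\<Prod>j\<in>J. [:lin (L j) P, a j:]) n)"
        by (intro pform_mult pform_lin insert.IH)
      then show ?thesis using True insert.hyps by (simp add: Suc_diff_le)
    next
      case False
      then show ?thesis using insert.IH(2) by (simp add: pform_zero)
    qed
    have B: "pform (card (insert i J) - n)
        (\<lambda>P. a i * (case n of 0 \<Rightarrow> 0 | Suc n' \<Rightarrow> coeff (\<Prod>j\<in>J. [:lin (L j) P, a j:]) n'))"
    proof (cases n)
      case 0
      then show ?thesis by (simp add: pform_zero)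
    next
      case (Suc n')
      then have "pform (card J - n') (\<lambda>P. coeff (\<Prod>j\<in>J. [:lin (L j) P, a j:]) n')"
        using 1 insert.hyps by (intro insert.IH) auto
      then show ?thesis using Suc insert.hyps by (simp add: pform_scale)
    qed
    show ?case unfolding rec using A B by (rule pform_add) }
  { case 2
    then obtain n' where n': "n = Suc n'" "n' > card J"
      using insert.hyps by (cases n) auto
    then show ?case
      unfolding rec using insert.IH(2)[of n P] insert.IH(2)[of n' P] by simp }
qed

text \<open>Parameters \<open>0, \<dots>, 2 l - 1\<close> move the lines. In characteristic 2 the first three of them
  translate all lines by multiples of a common linear form; in these directions the curve moves
  only to second order, so they get weight 1 and enter the leading term through their squares.\<close>

definition drift :: "bool \<Rightarrow> (nat \<Rightarrow> 'a::field) \<Rightarrow> 'a \<times> 'a \<times> 'a" where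
  "drift h x = (if h then (x 0, x 1, x 2) else (0, 0, 0))"

definition shift :: "bool \<Rightarrow> (nat \<Rightarrow> 'a::field) \<Rightarrow> nat \<Rightarrow> 'a \<times> 'a \<times> 'a" where
  "shift h x j = (if j = 0 then (if h then (0, 0, 0) else (0, x 0, x 1))
     else if j = 1 then (if h then 0 else x 2, 0, x 3)
     else if j = 2 then (x 4, x 5, 0) else (0, x (2 * j), x (2 * j + 1)))"

text \<open>In characteristic 2 the square of a linear form is linear in the squares of its
  coefficients; \<open>z i\<close> stands for such a square.\<close>

definition drift_square :: "bool \<Rightarrow> (nat \<Rightarrow> 'a::field) \<Rightarrow> 'a \<times> 'a \<times> 'a \<Rightarrow> 'a" where
  "drift_square h z P = (if h then z 0 * (coord 0 P)\<^sup>2 + z 1 * (coord 1 P)\<^sup>2 + z 2 * (coord 2 P)\<^sup>2 else 0)"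

definition weight :: "bool \<Rightarrow> nat \<Rightarrow> nat" where "weight h i = (if h \<and> i < 3 then 1 else 2)"
definition pexp :: "bool \<Rightarrow> nat \<Rightarrow> nat" where "pexp h i = (if h \<and> i < 3 then 2 else 1)"

lemma drift_scaled: "lin (drift h (\<lambda>i. t ^ weight h i * x i)) P = t * lin (drift h x) P"
  by (simp add: drift_def lin_def weight_def algebra_simps)

lemma shift_scaled: "lin (shift h (\<lambda>i. t ^ weight h i * x i) j) P = t\<^sup>2 * lin (shift h x j) P"
  by (auto simp: shift_def lin_def weight_def algebra_simps)

lemma shift_ex: "shift h (\<lambda>i. x i ^ pexp h i) j = shift h x j"
  by (auto simp: shift_def pexp_def)

lemma square_add_char2:
  fixes x y :: "'a::field"
  assumes "(2::'a) = 0"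
  shows "(x + y)\<^sup>2 = x\<^sup>2 + y\<^sup>2"
  using assms by (simp add: power2_sum)

lemma drift_square_ex:
  assumes "h \<Longrightarrow> (2::'a::field) = 0"
  shows "(lin (drift h x) P)\<^sup>2 = drift_square h (\<lambda>i. x i ^ pexp h i) (P :: 'a \<times> 'a \<times> 'a)"
proof (cases h)
  case True
  then show ?thesis using assms
    by (simp add: lin_coord drift_def drift_square_def pexp_def square_add_char2 power_mult_distrib)
qed (simp add: drift_def drift_square_def lin_def)

lemma shift_linear:
  "lin (shift h (\<lambda>i. z i + c * z' i) j) P = lin (shift h z j) P + c * lin (shift h z' j) P"
  by (auto simp: shift_def lin_def algebra_simps)

lemma drift_square_linear:
  "drift_square h (\<lambda>i. z i + c * z' i) P = drift_square h z P + c * drift_square h z' P"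
  by (simp add: drift_square_def algebra_simps)

text \<open>Serves to write leading terms as combinations of those in the single parameter
  directions.\<close>

lemma linear_unit_expansion:
  fixes T :: "(nat \<Rightarrow> 'a::comm_ring_1) \<Rightarrow> 'a"
  assumes lin: "\<And>z z' c. T (\<lambda>i. z i + c * z' i) = T z + c * T z'"
    and dep: "\<And>z z'. (\<And>i. i < n \<Longrightarrow> z i = z' i) \<Longrightarrow> T z = T z'"
  shows "T z = (\<Sum>k<n. z k * T (\<lambda>i. if i = k then 1 else 0))"
proof -
  have T0: "T (\<lambda>_. 0) = 0" using lin[of "\<lambda>_. 0" 1 "\<lambda>_. 0"] by simp
  have "T (\<lambda>i. if i < m then z i else 0) = (\<Sum>k<m. z k * T (\<lambda>i. if i = k then 1 else 0))" for m
  proof (induction m)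
    case (Suc m)
    have "(\<lambda>i. if i < Suc m then z i else 0) =
        (\<lambda>i. (if i < m then z i else 0) + z m * (if i = m then 1 else 0))"
      by (auto simp: fun_eq_iff less_Suc_eq)
    then show ?case using Suc lin[of "\<lambda>i. if i < m then z i else 0" "z m"] by simp
  qed (simp add: T0)
  moreover have "T z = T (\<lambda>i. if i < n then z i else 0)" by (intro dep) simp
  ultimately show ?thesis by simp
qed

lemma star_form_line_poly:
  assumes "\<And>k. k < l \<Longrightarrow> \<exists>p. \<forall>t. lin (L t k) P = poly p t"
  shows "\<exists>q. \<forall>t. star_form l e \<sigma> (L t) b P = poly q (t::'a::comm_ring_1)"
proof -
  have "\<forall>k. \<exists>p. k < l \<longrightarrow> (\<forall>t. lin (L t k) P = poly p t)" using assms by blast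
  then have "\<exists>p. \<forall>k. k < l \<longrightarrow> (\<forall>t. lin (L t k) P = poly (p k) t)" by (simp only: choice_iff)
  then obtain p where p: "\<And>k t. k < l \<Longrightarrow> lin (L t k) P = poly (p k) t" by blast
  show ?thesis
  proof (cases b)
    case (Inl ij)
    show ?thesis
      by (intro exI[of _ "smult (coord (compl1 (\<sigma> (fst ij))) P ^ snd ij *
          coord (compl2 (\<sigma> (fst ij))) P ^ (e - snd ij)) (\<Prod>k\<in>{..<l} - {fst ij}. p k)"])
        (simp add: Inl star_form_def p poly_prod case_prod_beta)
  next
    case (Inr ij)
    show ?thesis
      by (intro exI[of _ "smult (coord 0 P ^ fst ij * coord 1 P ^ snd ij *
          coord 2 P ^ (e - 1 - fst ij - snd ij)) (\<Prod>k<l. p k)"])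
        (simp add: Inr star_form_def p poly_prod case_prod_beta)
  qed
qed

section \<open>Moving the lines of a rigid configuration\<close>

text \<open>The expression in \<open>infinitesimally_rigid\<close> is the second-order term of the
  moving curve at the intersection of lines \<open>i\<close> and \<open>j\<close>, divided by
  nonzero factors; its vanishing must force all line parameters to be 0. The line \<open>ell\<close>
  misses the points, so that its power can be cancelled there.\<close>

locale star_deformation =
  fixes l e :: nat and h :: bool and L :: "nat \<Rightarrow> 'a::alg_closed_field \<times> 'a \<times> 'a"
    and a :: "nat \<Rightarrow> 'a" and \<sigma> :: "nat \<Rightarrow> nat" and ell :: "'a \<times> 'a \<times> 'a"
  assumes gp: "general_position l L" and l3: "l \<ge> 3"
    and \<sigma>: "\<And>i. i < l \<Longrightarrow> \<sigma> i \<le> 2" "\<And>i. i < l \<Longrightarrow> coord (\<sigma> i) (L i) \<noteq> 0"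
    and ell: "\<And>i j. i < j \<Longrightarrow> j < l \<Longrightarrow> lin ell (cross (L i) (L j)) \<noteq> 0"
    and a0: "a 0 \<noteq> 0"
    and char2: "h \<Longrightarrow> (2::'a) = 0"
    and infinitesimally_rigid: "\<And>z n. n < 2 * l \<Longrightarrow>
      (\<And>i j. i < j \<Longrightarrow> j < l \<Longrightarrow>
        a i * lin (shift h z j) (cross (L i) (L j)) + a j * lin (shift h z i) (cross (L i) (L j)) +
        a i * a j * drift_square h z (cross (L i) (L j)) *
          (\<Sum>k\<in>{..<l} - {i, j}. a k / lin (L k) (cross (L i) (L j))) = 0) \<Longrightarrow> z n = 0"
begin

abbreviation "d \<equiv> l + e - 1"
abbreviation "B \<equiv> star_indices l e"

definition moved :: "(nat \<Rightarrow> 'a) \<Rightarrow> nat \<Rightarrow> 'a \<times> 'a \<times> 'a" where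
  "moved x j = (coord 0 (L j) + a j * coord 0 (drift h x) + coord 0 (shift h x j),
     coord 1 (L j) + a j * coord 1 (drift h x) + coord 1 (shift h x j),
     coord 2 (L j) + a j * coord 2 (drift h x) + coord 2 (shift h x j))"

lemma lin_moved: "lin (moved x j) P = lin (L j) P + a j * lin (drift h x) P + lin (shift h x j) P"
  by (simp add: moved_def lin_coord algebra_simps)

lemma moved_0: "moved (\<lambda>_. 0) j = L j"
  by (cases "L j") (simp add: moved_def drift_def shift_def coord_def)

definition tail :: "'a \<times> 'a \<times> 'a \<Rightarrow> 'a" where "tail P = lin ell P ^ e"

definition base_curve :: "'a \<times> 'a \<times> 'a \<Rightarrow> 'a" where
  "base_curve P = tail P * (\<Sum>i<l. a i * (\<Prod>j\<in>{..<l} - {i}. lin (L j) P))"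

lemma pform_tail: "pform e tail"
  using pform_power[OF pform_lin, of e ell] by (simp add: tail_def[abs_def])

lemma pform_omit_one: "i < l \<Longrightarrow> pform (l - 1) (\<lambda>P. \<Prod>j\<in>{..<l} - {i}. lin (M j) P)"
  using pform_prod_lin[of "{..<l} - {i}" M] by (simp add: card_Diff_singleton)

lemma degree_eq: "e + (l - 1) = d" using l3 by simp

lemma pform_omit_sum:
  "pform d (\<lambda>P. tail P * (\<Sum>i<l. a i * (\<Prod>j\<in>{..<l} - {i}. lin (M j) P)))"
  unfolding degree_eq[symmetric]
  by (intro pform_mult pform_tail pform_sum pform_scale pform_omit_one) auto

lemma pform_base_curve: "pform d base_curve"
  unfolding base_curve_def[abs_def] by (rule pform_omit_sum)

lemma base_curve_vanishes: "i < j \<Longrightarrow> j < l \<Longrightarrow> base_curve (cross (L i) (L j)) = 0"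
proof -
  assume ij: "i < j" "j < l"
  have "(\<Prod>m\<in>{..<l} - {k}. lin (L m) (cross (L i) (L j))) = 0" for k
  proof -
    have "i \<in> {..<l} - {k} \<or> j \<in> {..<l} - {k}" using ij by auto
    then show ?thesis
    proof
      assume "i \<in> {..<l} - {k}"
      then show ?thesis by (intro prod_zero bexI[of _ i]) auto
    next
      assume "j \<in> {..<l} - {k}"
      then show ?thesis by (intro prod_zero bexI[of _ j]) auto
    qed
  qed
  then show ?thesis unfolding base_curve_def by (simp only: mult_zero_right sum.neutral_const)
qed

lemma base_curve_nonzero: "\<exists>P. base_curve P \<noteq> 0"
proof -
  define Q where "Q t = line_point (\<sigma> 0) (L 0) t 1" for t
  define q where "q b = [:lin b (line_point (\<sigma> 0) (L 0) 0 1), lin b (line_point (\<sigma> 0) (L 0) 1 0):]" for b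
  have qQ: "lin b (Q t) = poly (q b) t" for b t
    unfolding Q_def by (subst lin_line_point_linear) (simp add: q_def mult.commute)
  have l0: "0 < l" using l3 by simp
  have "q ell \<noteq> 0"
  proof
    assume "q ell = 0"
    then have "lin ell (line_point (\<sigma> 0) (L 0) x y) = 0" for x y
      by (subst lin_line_point_linear) (simp add: q_def)
    moreover have "cross (L 0) (L 1) = line_point (\<sigma> 0) (L 0)
        (coord (compl1 (\<sigma> 0)) (cross (L 0) (L 1))) (coord (compl2 (\<sigma> 0)) (cross (L 0) (L 1)))"
      by (intro point_on_line \<sigma> l0) simp
    ultimately have "lin ell (cross (L 0) (L 1)) = 0" by metis
    then show False using ell[of 0 1] l3 by simp
  qed
  moreover have "q (L k) \<noteq> 0" if "k \<in> {..<l} - {0}" for k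
    unfolding q_def using that l0 \<sigma>[OF l0] by (intro line_restriction_nonzero[OF gp l3]) auto
  ultimately have "\<exists>t. t \<notin> {} \<and> (\<forall>b\<in>insert ell (L ` ({..<l} - {0})). poly (q b) t \<noteq> 0)"
    by (intro common_nonroot) blast+
  then obtain t where t: "lin ell (Q t) \<noteq> 0" "\<And>k. k \<in> {..<l} - {0} \<Longrightarrow> lin (L k) (Q t) \<noteq> 0"
    by (auto simp: qQ)
  have Q0: "lin (L 0) (Q t) = 0" unfolding Q_def using \<sigma>[OF l0] by (intro lin_line_point)
  have "(\<Prod>j\<in>{..<l} - {i}. lin (L j) (Q t)) = 0" if "i \<in> {..<l} - {0}" for i
    using that Q0 l0 by (intro prod_zero bexI[of _ 0]) auto
  then have "(\<Sum>i\<in>{..<l} - {0}. a i * (\<Prod>j\<in>{..<l} - {i}. lin (L j) (Q t))) = 0"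
    by (intro sum.neutral ballI) (simp only: mult_zero_right)
  then have "(\<Sum>i<l. a i * (\<Prod>j\<in>{..<l} - {i}. lin (L j) (Q t))) =
      a 0 * (\<Prod>j\<in>{..<l} - {0}. lin (L j) (Q t))"
    using l0 by (subst sum.remove[of _ 0]) (simp_all only: finite_lessThan lessThan_iff add_0_right)
  then have "base_curve (Q t) \<noteq> 0"
    using t a0 unfolding base_curve_def tail_def by simp
  then show ?thesis by blast
qed

text \<open>The coefficient is the sum over triples of lines of the product of their weights times
  the product of the remaining lines; with its factor 3 it multiplies the squared drift at order
  2.\<close>

definition triple_coeff :: "'a \<times> 'a \<times> 'a \<Rightarrow> 'a" where
  "triple_coeff P = 3 * coeff (\<Prod>j<l. [:lin (L j) P, a j:]) 3"

text \<open>The t^2-coefficient of the moving base curve, made linear by taking the squares of the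
  drift parameters as variables.\<close>

definition line_tangent :: "(nat \<Rightarrow> 'a) \<Rightarrow> 'a \<times> 'a \<times> 'a \<Rightarrow> 'a" where
  "line_tangent z P = tail P *
     ((\<Sum>i<l. a i * (\<Sum>j\<in>{..<l} - {i}. lin (shift h z j) P * (\<Prod>k\<in>{..<l} - {i} - {j}. lin (L k) P))) +
      drift_square h z P * triple_coeff P)"

lemma pform_line_tangent: "pform d (line_tangent z)"
proof -
  have "pform (l - 1) (\<lambda>P. lin (shift h z j) P * (\<Prod>k\<in>{..<l} - {i} - {j}. lin (L k) P))"
    if "i \<in> {..<l}" "j \<in> {..<l} - {i}" for i j
  proof -
    have "card ({..<l} - {i} - {j}) = l - 1 - 1" using that by (simp add: card_Diff_singleton)
    then have "1 + card ({..<l} - {i} - {j}) = l - 1" using l3 by simp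
    then show ?thesis
      using pform_mult[OF pform_lin[of "shift h z j"] pform_prod_lin[of "{..<l} - {i} - {j}" L]]
      by (simp only: finite_Diff finite_lessThan)
  qed
  then have A: "pform (l - 1) (\<lambda>P. \<Sum>i<l. a i * (\<Sum>j\<in>{..<l} - {i}. lin (shift h z j) P *
      (\<Prod>k\<in>{..<l} - {i} - {j}. lin (L k) P)))"
    by (intro pform_sum pform_scale)
  have "pform (2 + (l - 3)) (\<lambda>P. drift_square h z P * triple_coeff P)"
  proof (intro pform_mult)
    have "pform 2 (\<lambda>P. z 0 * (coord 0 P)\<^sup>2 + z 1 * (coord 1 P)\<^sup>2 + z 2 * (coord 2 P)\<^sup>2)"
      using pform_power[OF pform_coord, of 2] by (intro pform_add pform_scale) simp_all
    then show "pform 2 (drift_square h z)"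
      unfolding drift_square_def[abs_def] by (cases h) (simp_all add: pform_zero)
    show "pform (l - 3) triple_coeff"
      unfolding triple_coeff_def[abs_def]
      using pform_coeff_prod(1)[of "{..<l}" 3 L a] l3 by (intro pform_scale) simp
  qed
  moreover have "2 + (l - 3) = l - 1" using l3 by simp
  ultimately have "pform (l - 1) (\<lambda>P. drift_square h z P * triple_coeff P)" by (simp only:)
  with A show ?thesis
    unfolding line_tangent_def[abs_def] degree_eq[symmetric]
    by (intro pform_mult pform_tail pform_add)
qed

lemma line_tangent_linear:
  "line_tangent (\<lambda>i. z i + c * z' i) P = line_tangent z P + c * line_tangent z' P"
  unfolding line_tangent_def shift_linear drift_square_linear
  by (simp add: algebra_simps sum.distrib sum_distrib_left)

lemma shift_cong:
  assumes "j < l" "\<And>i. i < 2 * l \<Longrightarrow> z i = z' i"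
  shows "shift h z j = shift h z' j"
  using assms l3 unfolding shift_def by auto

lemma drift_square_cong:
  assumes "\<And>i. i < 2 * l \<Longrightarrow> z i = z' i"
  shows "drift_square h z P = drift_square h z' P"
  using assms l3 unfolding drift_square_def by auto

lemma line_tangent_cong:
  assumes "\<And>i. i < 2 * l \<Longrightarrow> z i = z' i"
  shows "line_tangent z P = line_tangent z' P"
proof -
  have "shift h z j = shift h z' j" if "j < l" for j using that assms by (rule shift_cong)
  moreover have "drift_square h z P = drift_square h z' P" using assms by (rule drift_square_cong)
  ultimately show ?thesis unfolding line_tangent_def by simp
qed

text \<open>At the common point of \<open>L i\<close> and \<open>L j\<close> a product survives only
  if both lines are missing from it: this singles out one pair, and the triples formed by
  \<open>i\<close>, \<open>j\<close> and a third line \<open>k\<close>.\<close>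

lemma line_tangent_at_point:
  assumes ij: "i < j" "j < l"
  defines "P \<equiv> cross (L i) (L j)"
  shows "line_tangent z P = tail P * (\<Prod>k\<in>{..<l} - {i, j}. lin (L k) P) *
    (a i * lin (shift h z j) P + a j * lin (shift h z i) P +
     a i * a j * drift_square h z P * (\<Sum>k\<in>{..<l} - {i, j}. a k / lin (L k) P))"
proof -
  let ?R = "\<Prod>k\<in>{..<l} - {i, j}. lin (L k) P"
  let ?K = "{..<l} - {i, j}"
  have Pij: "lin (L i) P = 0" "lin (L j) P = 0" by (simp_all add: P_def)
  have Pk: "lin (L k) P \<noteq> 0" if "k \<in> ?K" for k
    using gp that ij unfolding general_position_def P_def by auto
  define T where "T k m = lin (shift h z m) P * (\<Prod>n\<in>{..<l} - {k} - {m}. lin (L n) P)" for k m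
  have T0: "T k m = 0" if "\<not> (k = i \<and> m = j)" "\<not> (k = j \<and> m = i)" for k m
  proof -
    have "i \<in> {..<l} - {k} - {m} \<or> j \<in> {..<l} - {k} - {m}" using that ij by auto
    then have "(\<Prod>n\<in>{..<l} - {k} - {m}. lin (L n) P) = 0" using Pij by (auto intro!: prod_zero)
    then show ?thesis by (simp add: T_def)
  qed
  have sets: "{..<l} - {i} - {j} = ?K" "{..<l} - {j} - {i} = ?K" by auto
  have Ti: "(\<Sum>m\<in>{..<l} - {i}. T i m) = lin (shift h z j) P * ?R"
  proof -
    have "(\<Sum>m\<in>{..<l} - {i}. T i m) = T i j + (\<Sum>m\<in>{..<l} - {i} - {j}. T i m)"
      using ij by (intro sum.remove) auto
    also have "(\<Sum>m\<in>{..<l} - {i} - {j}. T i m) = 0" using ij by (intro sum.neutral) (auto intro!: T0)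
    finally show ?thesis by (simp add: T_def sets)
  qed
  have Tj: "(\<Sum>m\<in>{..<l} - {j}. T j m) = lin (shift h z i) P * ?R"
  proof -
    have "(\<Sum>m\<in>{..<l} - {j}. T j m) = T j i + (\<Sum>m\<in>{..<l} - {j} - {i}. T j m)"
      using ij by (intro sum.remove) auto
    also have "(\<Sum>m\<in>{..<l} - {j} - {i}. T j m) = 0" using ij by (intro sum.neutral) (auto intro!: T0)
    finally show ?thesis by (simp add: T_def sets)
  qed
  have Tk: "(\<Sum>m\<in>{..<l} - {k}. T k m) = 0" if "k \<in> ?K" for k
    using that by (intro sum.neutral) (auto intro!: T0)
  have "(\<Sum>k<l. a k * (\<Sum>m\<in>{..<l} - {k}. T k m)) =
      a i * (\<Sum>m\<in>{..<l} - {i}. T i m) + (\<Sum>k\<in>{..<l} - {i}. a k * (\<Sum>m\<in>{..<l} - {k}. T k m))"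
    using ij by (intro sum.remove) auto
  also have "(\<Sum>k\<in>{..<l} - {i}. a k * (\<Sum>m\<in>{..<l} - {k}. T k m)) =
      a j * (\<Sum>m\<in>{..<l} - {j}. T j m) + (\<Sum>k\<in>{..<l} - {i} - {j}. a k * (\<Sum>m\<in>{..<l} - {k}. T k m))"
    using ij by (intro sum.remove) auto
  also have "(\<Sum>k\<in>{..<l} - {i} - {j}. a k * (\<Sum>m\<in>{..<l} - {k}. T k m)) = 0"
    unfolding sets using Tk by (intro sum.neutral) auto
  finally have first: "(\<Sum>k<l. a k * (\<Sum>m\<in>{..<l} - {k}. T k m)) =
      (a i * lin (shift h z j) P + a j * lin (shift h z i) P) * ?R"
    by (simp add: Ti Tj algebra_simps)
  have "drift_square h z P * triple_coeff P =
      drift_square h z P * (a i * a j * (?R * (\<Sum>k\<in>?K. a k / lin (L k) P)))"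
  proof (cases h)
    case True
    \<comment> \<open>Drift occurs in characteristic 2 only, where the factor of
      \<open>triple_coeff\<close> is 1.\<close>
    then have three: "(3::'a) = 1" using char2 by (metis add.right_neutral numeral_plus_one one_plus_numeral
          semiring_norm(3) numeral_Bit1 mult_2 mult_zero_left one_add_one add_0)
    let ?q = "\<lambda>k. [:lin (L k) P, a k:]"
    have "(\<Prod>k<l. ?q k) = ?q i * (\<Prod>k\<in>{..<l} - {i}. ?q k)" using ij by (intro prod.remove) auto
    also have "(\<Prod>k\<in>{..<l} - {i}. ?q k) = ?q j * (\<Prod>k\<in>{..<l} - {i} - {j}. ?q k)"
      using ij by (intro prod.remove) auto
    \<comment> \<open>Both lines through \<open>P\<close> lose their constant term, so coefficient 3
      of the product becomes coefficient 1 of the remaining factors.\<close>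
    also have "?q i * (?q j * (\<Prod>k\<in>{..<l} - {i} - {j}. ?q k)) = monom (a i * a j) 2 * (\<Prod>k\<in>?K. ?q k)"
      unfolding Pij sets by (simp add: monom_altdef numeral_2_eq_2 mult_ac)
    finally have "triple_coeff P = a i * a j * coeff (\<Prod>k\<in>?K. ?q k) 1"
      by (simp add: triple_coeff_def three coeff_monom_mult numeral_3_eq_3 numeral_2_eq_2)
    also have "coeff (\<Prod>k\<in>?K. ?q k) 1 = coeff (pderiv (\<Prod>k\<in>?K. ?q k)) 0"
      by (simp add: coeff_pderiv)
    also have "\<dots> = (\<Sum>k\<in>?K. a k * (\<Prod>m\<in>?K - {k}. lin (L m) P))"
      unfolding pderiv_prod coeff_sum
      by (intro sum.cong refl) (simp add: coeff_mult_low pderiv_pCons poly_0_coeff_0[symmetric] poly_prod)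
    also have "\<dots> = (\<Sum>k\<in>?K. ?R * (a k / lin (L k) P))"
    proof (intro sum.cong refl)
      fix k assume k: "k \<in> ?K"
      then have "?R = lin (L k) P * (\<Prod>m\<in>?K - {k}. lin (L m) P)" by (intro prod.remove) auto
      then show "a k * (\<Prod>m\<in>?K - {k}. lin (L m) P) = ?R * (a k / lin (L k) P)"
        using Pk[OF k] by simp
    qed
    finally show ?thesis by (simp add: sum_distrib_left)
  qed (simp add: drift_square_def)
  then have "line_tangent z P = tail P * ((a i * lin (shift h z j) P + a j * lin (shift h z i) P) * ?R +
      drift_square h z P * (a i * a j * (?R * (\<Sum>k\<in>?K. a k / lin (L k) P))))"
    unfolding line_tangent_def T_def[symmetric] first by (simp only:)
  then show ?thesis by (simp only:) (simp add: algebra_simps)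
qed

lemma moved_expansion:
  "\<exists>r. \<forall>t. (\<Sum>i<l. a i * (\<Prod>j\<in>{..<l} - {i}. lin (moved (\<lambda>n. t ^ weight h n * x n) j) P)) * tail P =
     base_curve P + t\<^sup>2 * (line_tangent (\<lambda>n. x n ^ pexp h n) P + t * poly r t)"
proof -
  let ?m = "lin (drift h x) P"
  define q where "q j = [:lin (L j) P, a j * ?m, lin (shift h x j) P:]" for j
  define b where "b j = [:lin (L j) P, a j:]" for j
  define p where "p = (\<Sum>i<l. smult (a i) (\<Prod>j\<in>{..<l} - {i}. q j))"
  have q: "lin (moved (\<lambda>n. t ^ weight h n * x n) j) P = poly (q j) t" for t j
    unfolding lin_moved drift_scaled shift_scaled by (simp add: q_def algebra_simps power2_eq_square)
  have p: "(\<Sum>i<l. a i * (\<Prod>j\<in>{..<l} - {i}. lin (moved (\<lambda>n. t ^ weight h n * x n) j) P)) = poly p t" for t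
    by (simp add: p_def poly_sum poly_prod q)
  have low: "coeff (\<Prod>j\<in>J. q j) 0 = (\<Prod>j\<in>J. lin (L j) P)"
    "coeff (\<Prod>j\<in>J. q j) 1 = ?m * coeff (\<Prod>j\<in>J. b j) 1"
    "coeff (\<Prod>j\<in>J. q j) 2 = (\<Sum>j\<in>J. lin (shift h x j) P * (\<Prod>k\<in>J - {j}. lin (L k) P)) +
        ?m\<^sup>2 * coeff (\<Prod>j\<in>J. b j) 2" if "finite J" for J
    unfolding q_def b_def
    by (rule coeff_prod_perturbed(1)[OF that] coeff_prod_perturbed(3)[OF that]
        coeff_prod_perturbed(4)[OF that])+
  have c0: "tail P * coeff p 0 = base_curve P"
    unfolding p_def base_curve_def by (simp add: coeff_sum low)
  \<comment> \<open>Without drift nothing moves at order 1; with drift this coefficient is twice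
    another one and 2 is 0.\<close>
  have c1: "coeff p 1 = 0"
  proof -
    have "coeff p 1 = ?m * (\<Sum>i<l. a i * coeff (\<Prod>j\<in>{..<l} - {i}. b j) 1)"
      unfolding p_def coeff_sum coeff_smult sum_distrib_left
      by (intro sum.cong refl) (subst low(2), simp_all add: mult_ac)
    also have "\<dots> = ?m * (2 * coeff (\<Prod>j<l. b j) 2)"
      unfolding b_def coeff_sum_omit_one by (simp add: numeral_2_eq_2)
    also have "\<dots> = 0" using char2 by (cases h) (simp_all add: drift_def lin_def)
    finally show ?thesis .
  qed
  have c2: "tail P * coeff p 2 = line_tangent (\<lambda>n. x n ^ pexp h n) P"
  proof -
    have "coeff p 2 = (\<Sum>i<l. a i * (\<Sum>j\<in>{..<l} - {i}. lin (shift h x j) P *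
        (\<Prod>k\<in>{..<l} - {i} - {j}. lin (L k) P))) + ?m\<^sup>2 * (\<Sum>i<l. a i * coeff (\<Prod>j\<in>{..<l} - {i}. b j) 2)"
      unfolding p_def coeff_sum coeff_smult sum_distrib_left[of "?m\<^sup>2"] sum.distrib[symmetric]
      by (intro sum.cong refl) (subst low(3), simp_all add: algebra_simps)
    also have "(\<Sum>i<l. a i * coeff (\<Prod>j\<in>{..<l} - {i}. b j) 2) = triple_coeff P"
      unfolding b_def coeff_sum_omit_one triple_coeff_def by (simp add: numeral_3_eq_3 numeral_2_eq_2)
    also have "?m\<^sup>2 = drift_square h (\<lambda>n. x n ^ pexp h n) P"
      by (rule drift_square_ex[OF char2])
    finally show ?thesis unfolding line_tangent_def shift_ex by simp
  qed
  obtain r where r: "\<And>t. poly p t = coeff p 0 + t * coeff p 1 + t\<^sup>2 * (coeff p 2 + t * poly r t)"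
    using poly_split2[of p] by blast
  show ?thesis
  proof (intro exI[of _ "smult (tail P) r"] allI)
    fix t
    show "(\<Sum>i<l. a i * (\<Prod>j\<in>{..<l} - {i}. lin (moved (\<lambda>n. t ^ weight h n * x n) j) P)) * tail P =
        base_curve P + t\<^sup>2 * (line_tangent (\<lambda>n. x n ^ pexp h n) P + t * poly (smult (tail P) r) t)"
      unfolding p r c1 c0[symmetric] c2[symmetric] by (simp add: algebra_simps)
  qed
qed

end

section \<open>The parametrised family of curves\<close>

text \<open>\<open>b0\<close> is a basis form occurring in the base curve. Leaving it out as a
  direction keeps the base curve independent of the remaining directions, which accounts for the
  scaling of the curve.\<close>

locale star_chart = star_deformation +
  fixes b0 :: star_index and pos :: "star_index \<Rightarrow> nat" and base_coord :: "star_index \<Rightarrow> 'a"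
  assumes b0: "b0 \<in> B" "base_coord b0 \<noteq> 0"
    and base_coord: "\<And>P. base_curve P = (\<Sum>b\<in>B. base_coord b * star_form l e \<sigma> L b P)"
    and pos: "bij_betw pos (B - {b0}) {0..<card B - 1}"
begin

abbreviation "N \<equiv> 2 * l + (card B - 1)"

text \<open>The added star forms belong to the moved lines, so that the whole curve contains the
  moved star.\<close>

definition curve :: "(nat \<Rightarrow> 'a) \<Rightarrow> 'a \<times> 'a \<times> 'a \<Rightarrow> 'a" where
  "curve x P = (\<Sum>i<l. a i * (\<Prod>j\<in>{..<l} - {i}. lin (moved x j) P)) * tail P +
     (\<Sum>b\<in>B - {b0}. x (2 * l + pos b) * star_form l e \<sigma> (moved x) b P)"

definition tangent :: "(nat \<Rightarrow> 'a) \<Rightarrow> 'a \<times> 'a \<times> 'a \<Rightarrow> 'a" where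
  "tangent z P = line_tangent z P + (\<Sum>b\<in>B - {b0}. z (2 * l + pos b) * star_form l e \<sigma> L b P)"

text \<open>The base point of the family followed by its leading terms in the \<open>N\<close>
  parameter directions, as required of \<open>u\<close> in
  \<open>irred_chain_of_immersion\<close>.\<close>

definition frame :: "nat \<Rightarrow> 'a \<times> 'a \<times> 'a \<Rightarrow> 'a" where
  "frame i = (case i of 0 \<Rightarrow> base_curve | Suc k \<Rightarrow> tangent (\<lambda>n. if n = k then 1 else 0))"

lemma pos_less: "b \<in> B - {b0} \<Longrightarrow> pos b < card B - 1"
  using bij_betwE[OF pos] by auto

lemma pform_star: "b \<in> B \<Longrightarrow> pform d (star_form l e \<sigma> M b)"
  using l3 by (intro star_form_pform) auto

lemma pform_curve: "pform d (curve x)"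
proof -
  have "pform d (\<lambda>P. (\<Sum>i<l. a i * (\<Prod>j\<in>{..<l} - {i}. lin (moved x j) P)) * tail P)"
    using pform_omit_sum[of "moved x"] by (simp add: mult.commute)
  then show ?thesis unfolding curve_def[abs_def]
    by (intro pform_add pform_sum pform_scale pform_star) auto
qed

lemma pform_tangent: "pform d (tangent z)"
  unfolding tangent_def[abs_def]
  by (intro pform_add pform_line_tangent pform_sum pform_scale pform_star) auto

lemma pform_frame: "pform d (frame i)"
  unfolding frame_def by (cases i) (simp_all only: nat.case pform_base_curve pform_tangent)

lemma tangent_expansion: "tangent z P = (\<Sum>k<N. z k * frame (Suc k) P)"
  unfolding frame_def nat.case
proof (rule linear_unit_expansion)
  fix z z' :: "nat \<Rightarrow> 'a" and c
  show "tangent (\<lambda>i. z i + c * z' i) P = tangent z P + c * tangent z' P"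
    unfolding tangent_def line_tangent_linear
    by (simp add: algebra_simps sum.distrib sum_distrib_left)
next
  fix z z' :: "nat \<Rightarrow> 'a"
  assume eq: "\<And>i. i < N \<Longrightarrow> z i = z' i"
  have "line_tangent z P = line_tangent z' P" using eq by (intro line_tangent_cong) auto
  moreover have "(\<Sum>b\<in>B - {b0}. z (2 * l + pos b) * star_form l e \<sigma> L b P) =
      (\<Sum>b\<in>B - {b0}. z' (2 * l + pos b) * star_form l e \<sigma> L b P)"
    using eq pos_less by (intro sum.cong refl) simp
  ultimately show "tangent z P = tangent z' P" by (simp only: tangent_def)
qed

lemma curve_expansion:
  "\<exists>p. \<forall>t. curve (\<lambda>n. t ^ weight h n * x n) P =
     base_curve P + t\<^sup>2 * (tangent (\<lambda>n. x n ^ pexp h n) P + t * poly p t)"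
proof -
  let ?x = "\<lambda>t n. t ^ weight h n * x n"
  \<comment> \<open>The star coordinates already carry the factor t^2, so moving the lines inside
    the star forms is felt only from order 3 on.\<close>
  have "\<exists>r. \<forall>t. star_form l e \<sigma> (moved (?x t)) b P = star_form l e \<sigma> L b P + t * poly r t" for b
  proof -
    have "\<exists>q. \<forall>t. star_form l e \<sigma> (moved (?x t)) b P = poly q t"
    proof (rule star_form_line_poly)
      fix k
      show "\<exists>p. \<forall>t. lin (moved (?x t) k) P = poly p t"
        unfolding lin_moved drift_scaled shift_scaled
        by (intro exI[of _ "[:lin (L k) P, a k * lin (drift h x) P, lin (shift h x k) P:]"])
          (simp add: algebra_simps power2_eq_square)
    qed
    then obtain q where q: "\<And>t. star_form l e \<sigma> (moved (?x t)) b P = poly q t" by blast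
    obtain c r where qr: "q = pCons c r" by (cases q)
    have "?x 0 = (\<lambda>_. 0)" by (auto simp: weight_def)
    then have "moved (?x 0) = L" using moved_0 by auto
    then have "c = star_form l e \<sigma> L b P" using q[of 0] qr by simp
    then show ?thesis using q qr by (intro exI[of _ r]) simp
  qed
  then have "\<exists>r. \<forall>b t. star_form l e \<sigma> (moved (?x t)) b P = star_form l e \<sigma> L b P + t * poly (r b) t"
    by (intro choice allI)
  then obtain r where
    r: "\<And>b t. star_form l e \<sigma> (moved (?x t)) b P = star_form l e \<sigma> L b P + t * poly (r b) t" by blast
  obtain r0 where r0: "\<And>t. (\<Sum>i<l. a i * (\<Prod>j\<in>{..<l} - {i}. lin (moved (?x t) j) P)) * tail P =
      base_curve P + t\<^sup>2 * (line_tangent (\<lambda>n. x n ^ pexp h n) P + t * poly r0 t)"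
    using moved_expansion[of x P] by blast
  have high: "weight h (2 * l + n) = 2" "pexp h (2 * l + n) = 1" for n
    using l3 by (auto simp: weight_def pexp_def)
  show ?thesis
  proof (intro exI[of _ "r0 + (\<Sum>b\<in>B - {b0}. smult (x (2 * l + pos b)) (r b))"] allI)
    fix t
    show "curve (?x t) P = base_curve P + t\<^sup>2 * (tangent (\<lambda>n. x n ^ pexp h n) P +
        t * poly (r0 + (\<Sum>b\<in>B - {b0}. smult (x (2 * l + pos b)) (r b))) t)"
      unfolding curve_def r0 r tangent_def high
      by (simp add: poly_sum algebra_simps sum.distrib sum_distrib_left)
  qed
qed

lemma form_coeff_curve_expansion:
  "\<exists>p. \<forall>t. form_coeff d (curve (\<lambda>n. t ^ weight h n * x n)) v = form_coeff d (frame 0) v +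
     t\<^sup>2 * ((\<Sum>k<N. x k ^ pexp h k * form_coeff d (frame (Suc k)) v) + t * poly p t)"
proof -
  obtain X m where X: "\<And>f :: 'a \<times> 'a \<times> 'a \<Rightarrow> 'a. form_coeff d f v = (\<Sum>P\<in>X. m P * f P)"
    using finite_functional_form_coeff[of d v, where 'a='a] unfolding finite_functional_def by blast
  have "\<forall>P. \<exists>p. \<forall>t. curve (\<lambda>n. t ^ weight h n * x n) P =
      base_curve P + t\<^sup>2 * (tangent (\<lambda>n. x n ^ pexp h n) P + t * poly p t)"
    using curve_expansion by blast
  then have "\<exists>p. \<forall>P t. curve (\<lambda>n. t ^ weight h n * x n) P =
      base_curve P + t\<^sup>2 * (tangent (\<lambda>n. x n ^ pexp h n) P + t * poly (p P) t)"
    by (simp only: choice_iff)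
  then obtain p where p: "\<And>P t. curve (\<lambda>n. t ^ weight h n * x n) P =
      base_curve P + t\<^sup>2 * (tangent (\<lambda>n. x n ^ pexp h n) P + t * poly (p P) t)" by blast
  have "(\<Sum>k<N. x k ^ pexp h k * form_coeff d (frame (Suc k)) v) =
      (\<Sum>P\<in>X. m P * tangent (\<lambda>n. x n ^ pexp h n) P)"
    unfolding X[symmetric] tangent_expansion[abs_def] form_coeff_sum ..
  moreover have "form_coeff d (curve (\<lambda>n. t ^ weight h n * x n)) v = (\<Sum>P\<in>X. m P * base_curve P) +
      t\<^sup>2 * ((\<Sum>P\<in>X. m P * tangent (\<lambda>n. x n ^ pexp h n) P) + t * (\<Sum>P\<in>X. m P * poly (p P) t))" for t
    unfolding X p by (simp add: algebra_simps sum.distrib sum_distrib_left)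
  moreover have "form_coeff d (frame 0) v = (\<Sum>P\<in>X. m P * base_curve P)"
    by (simp only: X frame_def nat.case)
  ultimately show ?thesis
    by (intro exI[of _ "\<Sum>P\<in>X. smult (m P) (p P)"]) (simp add: poly_sum)
qed

lemma polynomial_map_moved:
  assumes "j < l"
  shows "polynomial_map N (\<lambda>x. coord k (moved x j))"
proof -
  have v: "polynomial_map N (\<lambda>x. x i)" if "i < 2 * l" for i
    using that by (intro polynomial_map_var) simp
  have drift: "polynomial_map N (\<lambda>x. coord k (drift h x))" for k
    using l3 by (cases h; cases "k = 0"; cases "k = 1")
      (simp_all add: drift_def coord_def v[simplified] polynomial_map_const)
  have shift: "polynomial_map N (\<lambda>x. coord k (shift h x j))" for k
    using l3 assms by (cases h; cases "j = 0"; cases "j = 1"; cases "j = 2"; cases "k = 0"; cases "k = 1")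
      (simp_all add: shift_def coord_def v[simplified] polynomial_map_const)
  have "coord k (moved x j) = coord k (L j) + a j * coord k (drift h x) + coord k (shift h x j)" for x
    by (simp add: moved_def coord_def)
  then show ?thesis
    by (simp only:) (intro polynomial_map_add polynomial_map_mult polynomial_map_const drift shift)
qed

lemma polynomial_map_lin_moved: "j < l \<Longrightarrow> polynomial_map N (\<lambda>x. lin (moved x j) P)"
  unfolding lin_coord
  by (intro polynomial_map_add polynomial_map_mult polynomial_map_const polynomial_map_moved)

lemma polynomial_map_curve: "polynomial_map N (\<lambda>x. curve x P)"
proof -
  have "polynomial_map N (\<lambda>x. x (2 * l + pos b))" if "b \<in> B - {b0}" for b
    using pos_less[OF that] by (intro polynomial_map_var) simp
  then show ?thesis unfolding curve_def
    by (intro polynomial_map_add polynomial_map_mult polynomial_map_sum polynomial_map_const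
        polynomial_map_prod polynomial_map_lin_moved star_form_polynomial_map polynomial_map_moved) auto
qed

text \<open>Evaluation at the points of the star removes the base curve and the star forms, and
  rigidity then removes the line parameters. What remains is a relation among star forms of the
  unmoved lines, in which \<open>b0\<close> occurs only through the base curve.\<close>

lemma frame_independent: "indep_on (plane_monos d) {..N} (\<lambda>i. form_coeff d (frame i))"
  unfolding indep_on_def
proof (intro allI impI)
  fix c assume c: "\<forall>m\<in>plane_monos d. (\<Sum>i\<in>{..N}. c i * form_coeff d (frame i) m) = 0"
  define z where "z k = c (Suc k)" for k
  have "(\<Sum>i\<le>N. c i * frame i P) = 0" for P
  proof -
    have "pform d (\<lambda>P. \<Sum>i\<le>N. c i * frame i P)"
      by (intro pform_sum pform_scale pform_frame)
    then have "(\<Sum>i\<le>N. c i * frame i P) = curve_eval d (form_coeff d (\<lambda>P. \<Sum>i\<le>N. c i * frame i P)) P"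
      by (simp only: curve_eval_form_coeff)
    also have "\<dots> = 0" using c unfolding curve_eval_def form_coeff_sum by simp
    finally show ?thesis .
  qed
  then have rel: "c 0 * base_curve P + tangent z P = 0" for P
    unfolding tangent_expansion[of z P] z_def sum.atMost_shift by (simp add: frame_def)
  have z0: "z n = 0" if "n < 2 * l" for n
    using that
  proof (rule infinitesimally_rigid)
    fix i j assume ij: "i < j" "j < l"
    let ?P = "cross (L i) (L j)"
    have "star_form l e \<sigma> L b ?P = 0" for b
      using ij by (intro star_form_vanishes[of i l j]) auto
    then have "line_tangent z ?P = 0"
      using rel[of ?P] by (simp add: tangent_def base_curve_vanishes[OF ij])
    moreover have "tail ?P \<noteq> 0" using ell[OF ij] by (simp add: tail_def)
    moreover have "(\<Prod>k\<in>{..<l} - {i, j}. lin (L k) ?P) \<noteq> 0"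
      using gp ij unfolding general_position_def by (subst prod_zero_iff) auto
    ultimately show "a i * lin (shift h z j) ?P + a j * lin (shift h z i) ?P +
        a i * a j * drift_square h z ?P * (\<Sum>k\<in>{..<l} - {i, j}. a k / lin (L k) ?P) = 0"
      unfolding line_tangent_at_point[OF ij] by simp
  qed
  have "line_tangent z P = 0" for P
  proof -
    have "line_tangent z P = line_tangent (\<lambda>_. 0) P" using z0 by (intro line_tangent_cong) simp
    also have "\<dots> = 0" using line_tangent_linear[of "\<lambda>_. 0" "-1" "\<lambda>_. 0" P] by simp
    finally show ?thesis .
  qed
  then have rel': "c 0 * base_curve P + (\<Sum>b\<in>B - {b0}. z (2 * l + pos b) * star_form l e \<sigma> L b P) = 0" for P
    using rel[of P] by (simp add: tangent_def)
  define y where "y b = c 0 * base_coord b + (if b = b0 then 0 else z (2 * l + pos b))" for b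
  have "(\<Sum>b\<in>B. y b * star_form l e \<sigma> L b P) = 0" for P
  proof -
    have "(\<Sum>b\<in>B. (if b = b0 then 0 else z (2 * l + pos b)) * star_form l e \<sigma> L b P) =
        (\<Sum>b\<in>B - {b0}. z (2 * l + pos b) * star_form l e \<sigma> L b P)"
      using finite_star_indices by (intro sum.mono_neutral_cong_right) auto
    then show ?thesis
      using rel'[of P] unfolding y_def base_coord
      by (simp add: distrib_right sum.distrib sum_distrib_left mult.assoc)
  qed
  then have y0: "y b = 0" if "b \<in> B" for b
    using star_forms_independent[OF gp l3 \<sigma>, where e = e, unfolded indep_on_def, rule_format, of y b] that
    by simp
  have c0: "c 0 = 0" using y0[OF b0(1)] b0(2) by (simp add: y_def)
  have "z (2 * l + n) = 0" if "n < card B - 1" for n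
  proof -
    have "n \<in> pos ` (B - {b0})"
      using bij_betw_imp_surj_on[OF pos] that by simp
    then obtain b where "b \<in> B - {b0}" "pos b = n" by (elim imageE) simp
    then show ?thesis using y0[of b] by (simp add: y_def c0)
  qed
  then have "z n = 0" if "n < N" for n
  proof (cases "n < 2 * l")
    case False
    then obtain k where "n = 2 * l + k" using le_Suc_ex not_less by blast
    then show ?thesis using that \<open>\<And>n. n < card B - 1 \<Longrightarrow> z (2 * l + n) = 0\<close>[of k] by simp
  qed (rule z0)
  then have z: "c (Suc n) = 0" if "n < N" for n using that by (simp only: z_def)
  show "\<forall>i\<in>{..N}. c i = 0"
  proof
    fix i assume "i \<in> {..N}"
    then show "c i = 0" by (cases i) (use c0 z in \<open>simp_all only: atMost_iff Suc_le_eq\<close>)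
  qed
qed

lemma curve_in_star:
  assumes "general_position l (moved x)" "form_coeff d (curve x) v \<noteq> 0"
  shows "form_coeff d (curve x) \<in> S_star d l"
proof -
  have "form_coeff d (curve x) \<in> cone_pts (plane_monos d)"
    using assms(2) by (auto simp: cone_pts_def form_coeff_outside)
  moreover have "D_tuple l (moved x)" using assms(1) l3 by (rule general_position_D_tuple)
  moreover have "contains_star d l (form_coeff d (curve x)) (moved x)"
    unfolding contains_star_def curve_eval_form_coeff[OF pform_curve]
  proof (intro allI impI)
    fix i j p
    assume ij: "i < l" "j < l" "i < j" and p: "p \<noteq> (0, 0, 0) \<and> lin (moved x i) p = 0 \<and> lin (moved x j) p = 0"
    have "(\<Prod>m\<in>{..<l} - {k}. lin (moved x m) p) = 0" for k
    proof (cases "i = k")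
      case True
      then show ?thesis using ij p by (intro prod_zero bexI[of _ j]) auto
    next
      case False
      then show ?thesis using ij p by (intro prod_zero bexI[of _ i]) auto
    qed
    moreover have "star_form l e \<sigma> (moved x) b p = 0" for b
      using ij p by (intro star_form_vanishes[of i l j]) auto
    ultimately show "curve x p = 0"
      unfolding curve_def by (simp only: mult_zero_right mult_zero_left sum.neutral_const add_0_left)
  qed
  ultimately show ?thesis unfolding S_star_def by blast
qed

theorem irred_chain_star:
  "irred_chain (plane_monos d) (proj_closure (plane_monos d) (S_star d l :: ((nat \<Rightarrow>\<^sub>0 nat) \<Rightarrow> 'a) set)) N"
proof (rule irred_chain_of_immersion[where u = "\<lambda>i. form_coeff d (frame i)"
      and \<phi> = "\<lambda>x. form_coeff d (curve x)" and w = "weight h" and e = "pexp h"])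
  show "polynomial_map N (\<lambda>x. form_coeff d (curve x) v)" for v
    by (intro form_coeff_polynomial_map polynomial_map_curve)
  show "form_coeff d (curve x) v = 0" if "v \<notin> plane_monos d" for x v
    using that by (rule form_coeff_outside)
  show "indep_on (plane_monos d) {..N} (\<lambda>i. form_coeff d (frame i))" by (rule frame_independent)
  show "1 \<le> pexp h i" for i by (simp add: pexp_def)
  show "\<exists>p. \<forall>t. form_coeff d (curve (\<lambda>i. t ^ weight h i * x i)) v = form_coeff d (frame 0) v +
     t\<^sup>2 * ((\<Sum>i<N. x i ^ pexp h i * form_coeff d (frame (Suc i)) v) + t * poly p t)" for x v
    by (rule form_coeff_curve_expansion)
next
  fix x :: "nat \<Rightarrow> 'a" and f :: "((nat \<Rightarrow>\<^sub>0 nat) \<Rightarrow> 'a) \<Rightarrow> 'a" and k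
  assume f: "hform k f" "\<And>c. c \<in> S_star d l \<Longrightarrow> f c = 0"
  have curve0: "curve (\<lambda>_. 0) = base_curve"
    by (rule ext) (simp add: curve_def base_curve_def moved_0 mult.commute)
  obtain v where v: "form_coeff d (curve (\<lambda>_. 0)) v \<noteq> 0"
  proof -
    obtain P where "base_curve P \<noteq> 0" using base_curve_nonzero by blast
    then have "curve_eval d (form_coeff d base_curve) P \<noteq> 0"
      by (simp only: curve_eval_form_coeff[OF pform_base_curve] not_False_eq_True)
    then obtain v where "form_coeff d base_curve v \<noteq> 0"
      unfolding curve_eval_def by (metis (no_types, lifting) mult_zero_left sum.neutral)
    then show thesis using that by (simp add: curve0)
  qed
  define T where "T = {(i, j, k). i < l \<and> j < l \<and> k < l \<and> i \<noteq> j \<and> j \<noteq> k \<and> i \<noteq> k}"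
  have "finite T"
    by (rule finite_subset[of _ "{..<l} \<times> {..<l} \<times> {..<l}"]) (auto simp: T_def)
  \<comment> \<open>Where \<open>q\<close> and one coefficient are nonzero, the curve lies in
    \<open>S_star\<close>. Both are nonzero at the origin, so by density a form vanishing on
    \<open>S_star\<close> vanishes on the whole family.\<close>
  define q where "q x = (\<Prod>(i, j, k)\<in>T. lin (moved x k) (cross (moved x i) (moved x j)))" for x
  have gp_q: "general_position l (moved x) \<longleftrightarrow> q x \<noteq> 0" for x
    unfolding q_def using \<open>finite T\<close>
    by (auto simp: prod_zero_iff T_def general_position_def)
  have "polynomial_map N q"
  proof -
    have "polynomial_map N (\<lambda>x. lin (moved x k) (cross (moved x i) (moved x j)))"
      if "i < l" "j < l" "k < l" for i j k
    proof -
      have eq: "lin (moved x k) (cross (moved x i) (moved x j)) =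
        coord 0 (moved x k) * (coord 1 (moved x i) * coord 2 (moved x j) + (-1) * (coord 2 (moved x i) * coord 1 (moved x j))) +
        coord 1 (moved x k) * (coord 2 (moved x i) * coord 0 (moved x j) + (-1) * (coord 0 (moved x i) * coord 2 (moved x j))) +
        coord 2 (moved x k) * (coord 0 (moved x i) * coord 1 (moved x j) + (-1) * (coord 1 (moved x i) * coord 0 (moved x j)))"
        for x by (simp add: lin_def cross_def coord_def)
      show ?thesis unfolding eq
        by (intro polynomial_map_add polynomial_map_mult polynomial_map_const polynomial_map_moved that)
    qed
    then show ?thesis unfolding q_def[abs_def]
      by (intro polynomial_map_prod) (auto simp: T_def)
  qed
  then have pm: "polynomial_map N (\<lambda>x. q x * form_coeff d (curve x) v)"
    by (intro polynomial_map_mult form_coeff_polynomial_map polynomial_map_curve)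
  have "moved (\<lambda>_. 0) = L" using moved_0 by auto
  then have q0: "q (\<lambda>_. 0) * form_coeff d (curve (\<lambda>_. 0)) v \<noteq> 0"
    using gp gp_q[of "\<lambda>_. 0"] v by simp
  have pmf: "polynomial_map N (\<lambda>x. f (form_coeff d (curve x)))"
    by (intro hform_polynomial_map[OF f(1)] form_coeff_polynomial_map polynomial_map_curve)
  show "f (form_coeff d (curve x)) = 0"
  proof (rule ccontr)
    assume "f (form_coeff d (curve x)) \<noteq> 0"
    from polynomial_map_common_nonzero[OF pmf pm this q0] obtain y where
      y: "f (form_coeff d (curve y)) \<noteq> 0" "q y * form_coeff d (curve y) v \<noteq> 0" by blast
    then have "form_coeff d (curve y) \<in> S_star d l"
      using gp_q[of y] by (intro curve_in_star[of y v]) auto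
    then show False using f(2) y(1) by blast
  qed
qed

end

lemma (in star_deformation) irred_chain_deformation:
  "irred_chain (plane_monos d) (proj_closure (plane_monos d) (S_star d l :: ((nat \<Rightarrow>\<^sub>0 nat) \<Rightarrow> 'a) set))
     (2 * l + (card B - 1))"
proof -
  obtain c where c: "\<And>P. base_curve P = (\<Sum>b\<in>B. c b * star_form l e \<sigma> L b P)"
    using star_forms_span[OF gp l3 \<sigma> pform_base_curve base_curve_vanishes] by blast
  obtain P where "base_curve P \<noteq> 0" using base_curve_nonzero by blast
  then have "\<exists>b\<in>B. c b * star_form l e \<sigma> L b P \<noteq> 0"
    unfolding c by (rule contrapos_np) (intro sum.neutral, blast)
  then obtain b0 where b0: "b0 \<in> B" "c b0 \<noteq> 0" by auto
  obtain pos where "bij_betw pos (B - {b0}) {0..<card B - 1}"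
    using ex_bij_betw_finite_nat[of "B - {b0}"] finite_star_indices b0 by (auto simp: card_Diff_singleton)
  then interpret star_chart l e h L a \<sigma> ell b0 pos c
    using b0 c by unfold_locales
  show ?thesis by (rule irred_chain_star)
qed

section \<open>A rigid configuration\<close>

text \<open>The determinant is alternating, so increasing triples suffice.\<close>

lemma general_positionI:
  fixes L :: "nat \<Rightarrow> 'a::field \<times> 'a \<times> 'a"
  assumes "\<And>i j k. i < j \<Longrightarrow> j < k \<Longrightarrow> k < l \<Longrightarrow> lin (L k) (cross (L i) (L j)) \<noteq> 0"
  shows "general_position l L"
  unfolding general_position_def
proof (intro allI impI)
  fix i j k assume *: "i < l" "j < l" "k < l" "i \<noteq> j \<and> j \<noteq> k \<and> i \<noteq> k"
  have rot: "lin c (cross a b) = lin a (cross b c)" and swap: "lin c (cross a b) = - lin c (cross b a)"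
    for a b c :: "'a \<times> 'a \<times> 'a"
    by (simp_all add: lin_coord cross_def coord_def algebra_simps)
  consider "i < j" "j < k" | "j < k" "k < i" | "k < i" "i < j" | "j < i" "i < k" | "i < k" "k < j" | "k < j" "j < i"
    using * by linarith
  then show "lin (L k) (cross (L i) (L j)) \<noteq> 0"
  proof cases
    case 1
    then show ?thesis using assms * by blast
  next
    case 2
    then show ?thesis using assms[of j k i] * rot[of "L k" "L i" "L j"] by simp
  next
    case 3
    then show ?thesis using assms[of k i j] * rot[of "L k" "L i" "L j"] rot[of "L i" "L j" "L k"] by simp
  next
    case 4
    then show ?thesis using assms[of j i k] * swap[of "L k" "L i" "L j"] by simp
  next
    case 5
    then show ?thesis using assms[of i k j] * swap[of "L k" "L i" "L j"] rot[of "L k" "L j" "L i"]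
      by simp
  next
    case 6
    then show ?thesis using assms[of k j i] * swap[of "L k" "L i" "L j"] rot[of "L k" "L j" "L i"]
        rot[of "L j" "L i" "L k"] by simp
  qed
qed

text \<open>The factors \<open>lam\<close> do not change the lines, but they change the base curve.\<close>

definition base_lines :: "(nat \<Rightarrow> 'a::comm_ring_1) \<Rightarrow> (nat \<Rightarrow> 'a) \<Rightarrow> nat \<Rightarrow> 'a \<times> 'a \<times> 'a" where
  "base_lines lam s j = (if j = 0 then (1, 0, 0) else if j = 1 then (0, 1, 0) else if j = 2 then (0, 0, 1)
     else (lam j, lam j * s j, lam j * (s j)\<^sup>2))"

lemma general_position_base_lines:
  fixes s :: "nat \<Rightarrow> 'a::field"
  assumes lam: "\<And>j. lam j \<noteq> 0" and s0: "\<And>j. j \<ge> 3 \<Longrightarrow> s j \<noteq> 0"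
    and s2: "\<And>i j. 3 \<le> i \<Longrightarrow> i < j \<Longrightarrow> (s i)\<^sup>2 \<noteq> (s j)\<^sup>2"
  shows "general_position l (base_lines lam s)"
proof (rule general_positionI)
  fix i j k :: nat assume ijk: "i < j" "j < k" "k < l"
  have s1: "s i \<noteq> s j" if "3 \<le> i" "i < j" for i j using s2[OF that] by auto
  have "(i = 0 \<and> j = 1 \<and> k = 2) \<or> (i = 0 \<and> j = 1 \<and> k \<ge> 3) \<or> (i = 0 \<and> j = 2 \<and> k \<ge> 3) \<or>
      (i = 1 \<and> j = 2 \<and> k \<ge> 3) \<or> (i = 0 \<and> j \<ge> 3 \<and> k \<ge> 3) \<or> (i = 1 \<and> j \<ge> 3 \<and> k \<ge> 3) \<or>
      (i = 2 \<and> j \<ge> 3 \<and> k \<ge> 3) \<or> (i \<ge> 3 \<and> j \<ge> 3 \<and> k \<ge> 3)"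
    using ijk by presburger
  then show "lin (base_lines lam s k) (cross (base_lines lam s i) (base_lines lam s j)) \<noteq> 0"
  proof (elim disjE conjE, goal_cases)
    case 5
    have "lin (base_lines lam s k) (cross (base_lines lam s i) (base_lines lam s j)) =
        lam j * lam k * s j * s k * (s k - s j)"
      using 5 by (simp add: base_lines_def cross_def coord_def lin_def algebra_simps power2_eq_square)
    then show ?case using 5 lam s0 s1[of j k] ijk by simp
  next
    case 6
    have "lin (base_lines lam s k) (cross (base_lines lam s i) (base_lines lam s j)) =
        lam j * lam k * ((s j)\<^sup>2 - (s k)\<^sup>2)"
      using 6 by (simp add: base_lines_def cross_def coord_def lin_def algebra_simps power2_eq_square)
    then show ?case using 6 lam s2[of j k] ijk by simp
  next
    case 7
    have "lin (base_lines lam s k) (cross (base_lines lam s i) (base_lines lam s j)) =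
        lam j * lam k * (s k - s j)"
      using 7 by (simp add: base_lines_def cross_def coord_def lin_def algebra_simps power2_eq_square)
    then show ?case using 7 lam s1[of j k] ijk by simp
  next
    case 8
    have "lin (base_lines lam s k) (cross (base_lines lam s i) (base_lines lam s j)) =
        lam i * lam j * lam k * ((s j - s i) * (s k - s i) * (s k - s j))"
      using 8 by (simp add: base_lines_def cross_def coord_def lin_def algebra_simps power2_eq_square)
    then show ?case using 8 lam s1[of j k] s1[of i k] s1[of i j] ijk by simp
  qed (use lam s0 in \<open>simp_all add: base_lines_def cross_def coord_def lin_def\<close>)
qed

section \<open>Rigidity of six lines\<close>

definition core :: "nat \<Rightarrow> 'a::zero_neq_one" where "core j = (if j < 6 then 1 else 0)"

definition tangency :: "bool \<Rightarrow> nat \<Rightarrow> (nat \<Rightarrow> 'a::field \<times> 'a \<times> 'a) \<Rightarrow> (nat \<Rightarrow> 'a) \<Rightarrow> nat \<Rightarrow> nat \<Rightarrow> 'a" where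
  "tangency h l L z i j =
     core i * lin (shift h z j) (cross (L i) (L j)) + core j * lin (shift h z i) (cross (L i) (L j)) +
     core i * core j * drift_square h z (cross (L i) (L j)) *
       (\<Sum>k\<in>{..<l} - {i, j}. core k / lin (L k) (cross (L i) (L j)))"

text \<open>\<open>core j = 0\<close> leaves only the shift of line \<open>j\<close>, which thus
  vanishes at two points of that line; its first coordinate being frozen, it is 0.\<close>

lemma tangency_outer:
  fixes s :: "nat \<Rightarrow> 'a::field"
  assumes "lam j \<noteq> 0" "s j \<noteq> 0" "6 \<le> j"
    and "tangency h l (base_lines lam s) z 0 j = 0" "tangency h l (base_lines lam s) z 1 j = 0"
  shows "z (2 * j) = 0" "z (2 * j + 1) = 0"
proof -
  show r: "z (2 * j + 1) = 0"
    using assms by (simp add: tangency_def core_def base_lines_def cross_def coord_def lin_def shift_def)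
  show "z (2 * j) = 0"
    using assms r by (simp add: tangency_def core_def base_lines_def cross_def coord_def lin_def shift_def)
qed

lemma core_cases:
  fixes n l :: nat
  assumes "n < 2 * l"
  shows "n < 6 \<or> (\<exists>j. 3 \<le> j \<and> j < l \<and> (n = 2 * j \<or> n = 2 * j + 1))"
proof (cases "n < 6")
  case False
  then have "3 \<le> n div 2" "n div 2 < l" "n = 2 * (n div 2) \<or> n = 2 * (n div 2) + 1"
    using assms by presburger+
  then show ?thesis by blast
qed simp

lemma rigid_odd:
  fixes s :: "nat \<Rightarrow> 'a::field"
  assumes two: "(2::'a) \<noteq> 0" and "l \<ge> 6"
    and s0: "\<And>j. j \<ge> 3 \<Longrightarrow> s j \<noteq> 0" and s2: "\<And>i j. 3 \<le> i \<Longrightarrow> i < j \<Longrightarrow> (s i)\<^sup>2 \<noteq> (s j)\<^sup>2"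
    and E: "\<And>i j. i < j \<Longrightarrow> j < l \<Longrightarrow> tangency False l (base_lines (\<lambda>_. 1) s) z i j = 0"
    and n: "n < 2 * l"
  shows "z n = 0"
proof -
  note defs = tangency_def core_def base_lines_def cross_def coord_def lin_def shift_def drift_square_def
  have e01: "z 1 + z 3 = 0" using E[of 0 1] \<open>l \<ge> 6\<close> by (simp add: defs algebra_simps)
  have "- z 5 = z 0" using E[of 0 2] \<open>l \<ge> 6\<close> by (simp add: defs)
  then have e02: "z 0 + z 5 = 0" using add.left_inverse[of "z 5"] by simp
  have e12: "z 2 + z 4 = 0" using E[of 1 2] \<open>l \<ge> 6\<close> by (simp add: defs algebra_simps)
  have ej: "s j * (z 1 + z (2 * j + 1)) = (s j)\<^sup>2 * (z 0 + z (2 * j))"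
    "(s j)\<^sup>2 * z 2 = z 3 + z (2 * j + 1)" "s j * z 4 = z 5 + z (2 * j)" if "3 \<le> j" "j < 6" for j
    using that E[of 0 j] E[of 1 j] E[of 2 j] \<open>l \<ge> 6\<close> by (simp_all add: defs algebra_simps)
  \<comment> \<open>The elimination produces the factor 2; in characteristic 2 it leaves no
    condition, which is the failure of first-order rigidity.\<close>
  have key: "(s j)\<^sup>2 * z 2 - s j * z 0 + z 1 = 0" if j: "3 \<le> j" "j < 6" for j
  proof -
    have z345: "z 3 = - z 1" "z 4 = - z 2" "z 5 = - z 0"
      using e01 e02 e12 by (simp_all add: eq_neg_iff_add_eq_0 add.commute)
    have "z (2 * j + 1) = (s j)\<^sup>2 * z 2 + z 1" "z (2 * j) = z 0 - s j * z 2"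
      using ej(2,3)[OF j] unfolding z345 by (simp_all add: algebra_simps)
    then have "2 * s j * ((s j)\<^sup>2 * z 2 - s j * z 0 + z 1) = 0"
      using ej(1)[OF j] by algebra
    then show ?thesis using two s0[OF j(1)] by simp
  qed
  have s1: "s i \<noteq> s j" if "3 \<le> i" "i < j" for i j using s2[OF that] by auto
  define p where "p = [:z 1, - z 0, z 2:]"
  have "{s 3, s 4, s 5} \<subseteq> {x. poly p x = 0}"
    using key[of 3] key[of 4] key[of 5] by (auto simp: p_def algebra_simps power2_eq_square)
  moreover have "card {s 3, s 4, s 5} = 3"
    using s1[of 3 4] s1[of 3 5] s1[of 4 5] by simp
  ultimately have "p = 0"
    using card_poly_roots_bound[of p] card_mono[OF poly_roots_finite[of p], of "{s 3, s 4, s 5}"]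
      degree_pCons_le[of "z 1" "[:- z 0, z 2:]"] degree_pCons_le[of "- z 0" "[:z 2:]"]
    by (cases "p = 0") (auto simp: p_def)
  then have z: "z 0 = 0" "z 1 = 0" "z 2 = 0" by (auto simp: p_def)
  then have z': "z 3 = 0" "z 4 = 0" "z 5 = 0" using e01 e02 e12 by auto
  have "z (2 * j) = 0 \<and> z (2 * j + 1) = 0" if j: "3 \<le> j" "j < l" for j
  proof (cases "j < 6")
    case True
    then show ?thesis using ej(2,3)[OF j(1)] z z' by simp
  next
    case False
    then show ?thesis
      using tangency_outer[of "\<lambda>_. 1" j s False l z] s0[OF j(1)] E[of 0 j] E[of 1 j] j by simp
  qed
  moreover have "n = 0 \<or> n = 1 \<or> n = 2 \<or> n = 3 \<or> n = 4 \<or> n = 5" if "n < 6" using that by linarith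
  ultimately show ?thesis using core_cases[OF n] z z' by blast
qed

lemma sum_core:
  assumes "l \<ge> 6" "i < 6" "j < 6"
  shows "(\<Sum>k\<in>{..<l} - {i, j}. core k / f k) = (\<Sum>k\<in>{0,1,2,3,4,5} - {i, j}. 1 / (f k :: 'a::field))"
proof -
  have "{0,1,2,3,4,5} = {..<6::nat}"
    by (rule set_eqI, simp only: insert_iff empty_iff lessThan_iff) presburger
  moreover have "(\<Sum>k\<in>{..<l} - {i, j}. core k / f k) = (\<Sum>k\<in>{..<6} - {i, j}. 1 / f k)"
  proof (rule sum.mono_neutral_cong_right)
    show "{..<6} - {i, j} \<subseteq> {..<l} - {i, j}" using assms by auto
  qed (auto simp: core_def)
  ultimately show ?thesis by (simp only:)
qed

text \<open>The constants are chosen so that eliminating the shifts leaves a Vandermonde system for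
  \<open>z 0, z 1, z 2\<close> in the elements \<open>1, \<omega>, \<omega>\<^sup>2\<close> of the field with four elements; for
  \<open>lam = (\<lambda>_. 1)\<close> that system is singular.\<close>

lemma rigid_char2:
  fixes s :: "nat \<Rightarrow> 'a::field"
  assumes two: "(2::'a) = 0" and "l \<ge> 6" and om: "\<omega>\<^sup>2 = \<omega> + 1"
    and lam: "lam = (\<lambda>j. if j = 3 then \<omega> else 1)"
    and s: "s 3 = 1" "s 4 = \<omega>" "s 5 = \<omega> + 1"
    and s0: "\<And>j. j \<ge> 3 \<Longrightarrow> s j \<noteq> 0"
    and E: "\<And>i j. i < j \<Longrightarrow> j < l \<Longrightarrow> tangency True l (base_lines lam s) z i j = 0"
    and n: "n < 2 * l"
  shows "z n = 0"
proof -
  let ?L = "base_lines lam s"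
  have dbl: "x + x = 0" for x :: 'a using two by (metis mult_2 mult_zero_left)
  have neg: "- x = x" for x :: 'a using dbl[of x] by (simp add: neg_eq_iff_add_eq_0)
  have om0: "\<omega> \<noteq> 0" "\<omega> + 1 \<noteq> 0" using om by auto
  have omm: "\<omega> * \<omega> = \<omega> + 1" using om by (simp add: power2_eq_square)
  have dbl': "x + (x + y) = y" for x y :: 'a by (simp only: add.assoc[symmetric] dbl add_0_left)
  have omm': "\<omega> * (\<omega> * x) = \<omega> * x + x" for x
    by (simp only: mult.assoc[symmetric] omm distrib_right mult_1_left)
  have "(3::'a) = 2 + 1" by simp
  then have three: "(3::'a) = 1" by (simp only: two add_0_left)
  note ring2 = algebra_simps omm omm' dbl dbl' two three
  \<comment> \<open>All determinants below are nonzero elements of the field with four elements, so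
    these two inverses cover every reciprocal that occurs.\<close>
  have inv: "1 / \<omega> = \<omega> + 1" "1 / (\<omega> + 1) = \<omega>"
    using om0 omm two by (simp_all add: divide_eq_eq algebra_simps)
  have lines: "?L 0 = (1, 0, 0)" "?L 1 = (0, 1, 0)" "?L 2 = (0, 0, 1)" "?L 3 = (\<omega>, \<omega>, \<omega>)"
    "?L 4 = (1, \<omega>, \<omega> + 1)" "?L 5 = (1, \<omega> + 1, \<omega>)"
    using om omm two by (simp_all add: base_lines_def lam s power2_eq_square algebra_simps)
  have eq: "lin (shift True z j) (cross (?L i) (?L j)) + lin (shift True z i) (cross (?L i) (?L j)) +
      drift_square True z (cross (?L i) (?L j)) * (1 / lin (?L a) (cross (?L i) (?L j)) +
        1 / lin (?L b) (cross (?L i) (?L j)) + 1 / lin (?L c) (cross (?L i) (?L j)) +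
        1 / lin (?L d) (cross (?L i) (?L j))) = 0"
    if "i < j" "j < 6" "{0,1,2,3,4,5} - {i, j} = {a, b, c, d}" "distinct [a, b, c, d]" for i j a b c d
  proof -
    let ?f = "\<lambda>k. lin (?L k) (cross (?L i) (?L j))"
    have "(\<Sum>k\<in>{..<l} - {i, j}. core k / ?f k) = (\<Sum>k\<in>{a, b, c, d}. 1 / ?f k)"
      using sum_core[of l i j ?f] \<open>l \<ge> 6\<close> that by simp
    also have "\<dots> = 1 / ?f a + 1 / ?f b + 1 / ?f c + 1 / ?f d"
      using that(4) by (simp add: add.assoc)
    finally have "(\<Sum>k\<in>{..<l} - {i, j}. core k / ?f k) = 1 / ?f a + 1 / ?f b + 1 / ?f c + 1 / ?f d" .
    moreover have "core i = (1::'a)" "core j = (1::'a)" using that by (simp_all add: core_def)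
    moreover have "tangency True l ?L z i j = 0" using that \<open>l \<ge> 6\<close> by (intro E) auto
    ultimately show ?thesis unfolding tangency_def by (simp only: mult_1_left)
  qed
  have sh: "shift True z 0 = (0, 0, 0)" "shift True z 1 = (0, 0, z 3)" "shift True z 2 = (z 4, z 5, 0)"
    "shift True z 3 = (0, z 6, z 7)" "shift True z 4 = (0, z 8, z 9)" "shift True z 5 = (0, z 10, z 11)"
    by (simp_all add: shift_def)
  have sq: "drift_square True z (a, b, c) = z 0 * (a * a) + z 1 * (b * b) + z 2 * (c * c)" for a b c
    by (simp add: drift_square_def coord_def power2_eq_square)
  \<comment> \<open>Each of the twelve computations finds the point, then the values of the four
    other lines there; the sum of their reciprocals is the coefficient of the squared drift.\<close>
  have e01: "z 3 + (\<omega> + 1) * z 2 = 0"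
  proof -
    have c: "cross (?L 0) (?L 1) = (0, 0, 1)"
      unfolding lines cross_def by (simp add: coord_def neg)
    have v: "lin (?L 2) (0, 0, 1) = 1" "lin (?L 3) (0, 0, 1) = \<omega>"
      "lin (?L 4) (0, 0, 1) = (\<omega> + 1)" "lin (?L 5) (0, 0, 1) = \<omega>"
      unfolding lines lin_def fst_conv snd_conv by ((simp; fail) | simp add: ring2)+
    have "lin (shift True z 1) (0, 0, 1) + lin (shift True z 0) (0, 0, 1) +
        drift_square True z (0, 0, 1) * (1 + (\<omega> + 1) + \<omega> + (\<omega> + 1)) = 0"
      by (rule eq[of 0 1 2 3 4 5, unfolded c v inv div_by_1]) auto
    then show ?thesis unfolding sh sq lin_def fst_conv snd_conv by (simp add: ring2)
  qed
  have e02: "z 5 + (\<omega> + 1) * z 1 = 0"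
  proof -
    have c: "cross (?L 0) (?L 2) = (0, 1, 0)"
      unfolding lines cross_def by (simp add: coord_def neg)
    have v: "lin (?L 1) (0, 1, 0) = 1" "lin (?L 3) (0, 1, 0) = \<omega>"
      "lin (?L 4) (0, 1, 0) = \<omega>" "lin (?L 5) (0, 1, 0) = (\<omega> + 1)"
      unfolding lines lin_def fst_conv snd_conv by ((simp; fail) | simp add: ring2)+
    have "lin (shift True z 2) (0, 1, 0) + lin (shift True z 0) (0, 1, 0) +
        drift_square True z (0, 1, 0) * (1 + (\<omega> + 1) + (\<omega> + 1) + \<omega>) = 0"
      by (rule eq[of 0 2 1 3 4 5, unfolded c v inv div_by_1]) auto
    then show ?thesis unfolding sh sq lin_def fst_conv snd_conv by (simp add: ring2)
  qed
  have e03: "\<omega> * z 6 + \<omega> * z 7 = 0"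
  proof -
    have c: "cross (?L 0) (?L 3) = (0, \<omega>, \<omega>)"
      unfolding lines cross_def by (simp add: coord_def neg)
    have v: "lin (?L 1) (0, \<omega>, \<omega>) = \<omega>" "lin (?L 2) (0, \<omega>, \<omega>) = \<omega>"
      "lin (?L 4) (0, \<omega>, \<omega>) = \<omega>" "lin (?L 5) (0, \<omega>, \<omega>) = \<omega>"
      unfolding lines lin_def fst_conv snd_conv by ((simp; fail) | simp add: ring2)+
    have "lin (shift True z 3) (0, \<omega>, \<omega>) + lin (shift True z 0) (0, \<omega>, \<omega>) +
        drift_square True z (0, \<omega>, \<omega>) * ((\<omega> + 1) + (\<omega> + 1) + (\<omega> + 1) + (\<omega> + 1)) = 0"
      by (rule eq[of 0 3 1 2 4 5, unfolded c v inv div_by_1]) auto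
    then show ?thesis unfolding sh sq lin_def fst_conv snd_conv by (simp add: ring2)
  qed
  have e04: "(\<omega> + 1) * z 8 + \<omega> * z 9 + z 1 + \<omega> * z 2 = 0"
  proof -
    have c: "cross (?L 0) (?L 4) = (0, (\<omega> + 1), \<omega>)"
      unfolding lines cross_def by (simp add: coord_def neg)
    have v: "lin (?L 1) (0, (\<omega> + 1), \<omega>) = (\<omega> + 1)" "lin (?L 2) (0, (\<omega> + 1), \<omega>) = \<omega>"
      "lin (?L 3) (0, (\<omega> + 1), \<omega>) = \<omega>" "lin (?L 5) (0, (\<omega> + 1), \<omega>) = 1"
      unfolding lines lin_def fst_conv snd_conv by ((simp; fail) | simp add: ring2)+
    have "lin (shift True z 4) (0, (\<omega> + 1), \<omega>) + lin (shift True z 0) (0, (\<omega> + 1), \<omega>) +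
        drift_square True z (0, (\<omega> + 1), \<omega>) * (\<omega> + (\<omega> + 1) + (\<omega> + 1) + 1) = 0"
      by (rule eq[of 0 4 1 2 3 5, unfolded c v inv div_by_1]) auto
    then show ?thesis unfolding sh sq lin_def fst_conv snd_conv by (simp add: ring2)
  qed
  have e05: "\<omega> * z 10 + (\<omega> + 1) * z 11 + \<omega> * z 1 + z 2 = 0"
  proof -
    have c: "cross (?L 0) (?L 5) = (0, \<omega>, (\<omega> + 1))"
      unfolding lines cross_def by (simp add: coord_def neg)
    have v: "lin (?L 1) (0, \<omega>, (\<omega> + 1)) = \<omega>" "lin (?L 2) (0, \<omega>, (\<omega> + 1)) = (\<omega> + 1)"
      "lin (?L 3) (0, \<omega>, (\<omega> + 1)) = \<omega>" "lin (?L 4) (0, \<omega>, (\<omega> + 1)) = 1"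
      unfolding lines lin_def fst_conv snd_conv by ((simp; fail) | simp add: ring2)+
    have "lin (shift True z 5) (0, \<omega>, (\<omega> + 1)) + lin (shift True z 0) (0, \<omega>, (\<omega> + 1)) +
        drift_square True z (0, \<omega>, (\<omega> + 1)) * ((\<omega> + 1) + \<omega> + (\<omega> + 1) + 1) = 0"
      by (rule eq[of 0 5 1 2 3 4, unfolded c v inv div_by_1]) auto
    then show ?thesis unfolding sh sq lin_def fst_conv snd_conv by (simp add: ring2)
  qed
  have e12: "z 4 + \<omega> * z 0 = 0"
  proof -
    have c: "cross (?L 1) (?L 2) = (1, 0, 0)"
      unfolding lines cross_def by (simp add: coord_def neg)
    have v: "lin (?L 0) (1, 0, 0) = 1" "lin (?L 3) (1, 0, 0) = \<omega>"
      "lin (?L 4) (1, 0, 0) = 1" "lin (?L 5) (1, 0, 0) = 1"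
      unfolding lines lin_def fst_conv snd_conv by ((simp; fail) | simp add: ring2)+
    have "lin (shift True z 2) (1, 0, 0) + lin (shift True z 1) (1, 0, 0) +
        drift_square True z (1, 0, 0) * (1 + (\<omega> + 1) + 1 + 1) = 0"
      by (rule eq[of 1 2 0 3 4 5, unfolded c v inv div_by_1]) auto
    then show ?thesis unfolding sh sq lin_def fst_conv snd_conv by (simp add: ring2)
  qed
  have e13: "\<omega> * z 3 + \<omega> * z 7 + \<omega> * z 0 + \<omega> * z 2 = 0"
  proof -
    have c: "cross (?L 1) (?L 3) = (\<omega>, 0, \<omega>)"
      unfolding lines cross_def by (simp add: coord_def neg)
    have v: "lin (?L 0) (\<omega>, 0, \<omega>) = \<omega>" "lin (?L 2) (\<omega>, 0, \<omega>) = \<omega>"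
      "lin (?L 4) (\<omega>, 0, \<omega>) = (\<omega> + 1)" "lin (?L 5) (\<omega>, 0, \<omega>) = 1"
      unfolding lines lin_def fst_conv snd_conv by ((simp; fail) | simp add: ring2)+
    have "lin (shift True z 3) (\<omega>, 0, \<omega>) + lin (shift True z 1) (\<omega>, 0, \<omega>) +
        drift_square True z (\<omega>, 0, \<omega>) * ((\<omega> + 1) + (\<omega> + 1) + \<omega> + 1) = 0"
      by (rule eq[of 1 3 0 2 4 5, unfolded c v inv div_by_1]) auto
    then show ?thesis unfolding sh sq lin_def fst_conv snd_conv by (simp add: ring2)
  qed
  have e14: "z 3 + z 9 = 0"
  proof -
    have c: "cross (?L 1) (?L 4) = ((\<omega> + 1), 0, 1)"
      unfolding lines cross_def by (simp add: coord_def neg)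
    have v: "lin (?L 0) ((\<omega> + 1), 0, 1) = (\<omega> + 1)" "lin (?L 2) ((\<omega> + 1), 0, 1) = 1"
      "lin (?L 3) ((\<omega> + 1), 0, 1) = (\<omega> + 1)" "lin (?L 5) ((\<omega> + 1), 0, 1) = 1"
      unfolding lines lin_def fst_conv snd_conv by ((simp; fail) | simp add: ring2)+
    have "lin (shift True z 4) ((\<omega> + 1), 0, 1) + lin (shift True z 1) ((\<omega> + 1), 0, 1) +
        drift_square True z ((\<omega> + 1), 0, 1) * (\<omega> + 1 + \<omega> + 1) = 0"
      by (rule eq[of 1 4 0 2 3 5, unfolded c v inv div_by_1]) auto
    then show ?thesis unfolding sh sq lin_def fst_conv snd_conv by (simp add: ring2)
  qed
  have e15: "z 3 + z 11 + z 0 + \<omega> * z 2 = 0"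
  proof -
    have c: "cross (?L 1) (?L 5) = (\<omega>, 0, 1)"
      unfolding lines cross_def by (simp add: coord_def neg)
    have v: "lin (?L 0) (\<omega>, 0, 1) = \<omega>" "lin (?L 2) (\<omega>, 0, 1) = 1"
      "lin (?L 3) (\<omega>, 0, 1) = 1" "lin (?L 4) (\<omega>, 0, 1) = 1"
      unfolding lines lin_def fst_conv snd_conv by ((simp; fail) | simp add: ring2)+
    have "lin (shift True z 5) (\<omega>, 0, 1) + lin (shift True z 1) (\<omega>, 0, 1) +
        drift_square True z (\<omega>, 0, 1) * ((\<omega> + 1) + 1 + 1 + 1) = 0"
      by (rule eq[of 1 5 0 2 3 4, unfolded c v inv div_by_1]) auto
    then show ?thesis unfolding sh sq lin_def fst_conv snd_conv by (simp add: ring2)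
  qed
  have e23: "\<omega> * z 4 + \<omega> * z 5 + \<omega> * z 6 + \<omega> * z 0 + \<omega> * z 1 = 0"
  proof -
    have c: "cross (?L 2) (?L 3) = (\<omega>, \<omega>, 0)"
      unfolding lines cross_def by (simp add: coord_def neg)
    have v: "lin (?L 0) (\<omega>, \<omega>, 0) = \<omega>" "lin (?L 1) (\<omega>, \<omega>, 0) = \<omega>"
      "lin (?L 4) (\<omega>, \<omega>, 0) = 1" "lin (?L 5) (\<omega>, \<omega>, 0) = (\<omega> + 1)"
      unfolding lines lin_def fst_conv snd_conv by ((simp; fail) | simp add: ring2)+
    have "lin (shift True z 3) (\<omega>, \<omega>, 0) + lin (shift True z 2) (\<omega>, \<omega>, 0) +
        drift_square True z (\<omega>, \<omega>, 0) * ((\<omega> + 1) + (\<omega> + 1) + 1 + \<omega>) = 0"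
      by (rule eq[of 2 3 0 1 4 5, unfolded c v inv div_by_1]) auto
    then show ?thesis unfolding sh sq lin_def fst_conv snd_conv by (simp add: ring2)
  qed
  have e24: "\<omega> * z 4 + z 5 + z 8 + z 0 + \<omega> * z 1 = 0"
  proof -
    have c: "cross (?L 2) (?L 4) = (\<omega>, 1, 0)"
      unfolding lines cross_def by (simp add: coord_def neg)
    have v: "lin (?L 0) (\<omega>, 1, 0) = \<omega>" "lin (?L 1) (\<omega>, 1, 0) = 1"
      "lin (?L 3) (\<omega>, 1, 0) = 1" "lin (?L 5) (\<omega>, 1, 0) = 1"
      unfolding lines lin_def fst_conv snd_conv by ((simp; fail) | simp add: ring2)+
    have "lin (shift True z 4) (\<omega>, 1, 0) + lin (shift True z 2) (\<omega>, 1, 0) +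
        drift_square True z (\<omega>, 1, 0) * ((\<omega> + 1) + 1 + 1 + 1) = 0"
      by (rule eq[of 2 4 0 1 3 5, unfolded c v inv div_by_1]) auto
    then show ?thesis unfolding sh sq lin_def fst_conv snd_conv by (simp add: ring2)
  qed
  have e25: "(\<omega> + 1) * z 4 + z 5 + z 10 = 0"
  proof -
    have c: "cross (?L 2) (?L 5) = ((\<omega> + 1), 1, 0)"
      unfolding lines cross_def by (simp add: coord_def neg)
    have v: "lin (?L 0) ((\<omega> + 1), 1, 0) = (\<omega> + 1)" "lin (?L 1) ((\<omega> + 1), 1, 0) = 1"
      "lin (?L 3) ((\<omega> + 1), 1, 0) = (\<omega> + 1)" "lin (?L 4) ((\<omega> + 1), 1, 0) = 1"
      unfolding lines lin_def fst_conv snd_conv by ((simp; fail) | simp add: ring2)+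
    have "lin (shift True z 5) ((\<omega> + 1), 1, 0) + lin (shift True z 2) ((\<omega> + 1), 1, 0) +
        drift_square True z ((\<omega> + 1), 1, 0) * (\<omega> + 1 + \<omega> + 1) = 0"
      by (rule eq[of 2 5 0 1 3 4, unfolded c v inv div_by_1]) auto
    then show ?thesis unfolding sh sq lin_def fst_conv snd_conv by (simp add: ring2)
  qed
  have "z 0 + z 1 + z 2 =
      \<omega> * (\<omega> * z 6 + \<omega> * z 7) + \<omega> * (\<omega> * z 3 + \<omega> * z 7 + \<omega> * z 0 + \<omega> * z 2) + \<omega> * (\<omega> * z 4 + \<omega> * z 5 + \<omega> * z 6 + \<omega> * z 0 + \<omega> * z 1) + (\<omega> + 1) * (z 3 + (\<omega> + 1) * z 2) + (\<omega> + 1) * (z 5 + (\<omega> + 1) * z 1) + (\<omega> + 1) * (z 4 + \<omega> * z 0)"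
    by (simp add: ring2)
  then have r1: "z 0 + z 1 + z 2 = 0"
    by (simp only: e03 e13 e23 e01 e02 e12 mult_zero_right add_0_left)
  have "z 0 + \<omega> * z 1 + (\<omega> + 1) * z 2 =
      1 * ((\<omega> + 1) * z 8 + \<omega> * z 9 + z 1 + \<omega> * z 2) + \<omega> * (z 3 + z 9) + (\<omega> + 1) * (\<omega> * z 4 + z 5 + z 8 + z 0 + \<omega> * z 1) + \<omega> * (z 3 + (\<omega> + 1) * z 2) + (\<omega> + 1) * (z 5 + (\<omega> + 1) * z 1) + 1 * (z 4 + \<omega> * z 0)"
    by (simp add: ring2)
  then have r2: "z 0 + \<omega> * z 1 + (\<omega> + 1) * z 2 = 0"
    by (simp only: e04 e14 e24 e01 e02 e12 mult_zero_right add_0_left)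
  have "z 0 + (\<omega> + 1) * z 1 + \<omega> * z 2 =
      1 * (\<omega> * z 10 + (\<omega> + 1) * z 11 + \<omega> * z 1 + z 2) + (\<omega> + 1) * (z 3 + z 11 + z 0 + \<omega> * z 2) + \<omega> * ((\<omega> + 1) * z 4 + z 5 + z 10) + (\<omega> + 1) * (z 3 + (\<omega> + 1) * z 2) + \<omega> * (z 5 + (\<omega> + 1) * z 1) + 1 * (z 4 + \<omega> * z 0)"
    by (simp add: ring2)
  then have r3: "z 0 + (\<omega> + 1) * z 1 + \<omega> * z 2 = 0"
    by (simp only: e05 e15 e25 e01 e02 e12 mult_zero_right add_0_left)
  \<comment> \<open>The multipliers here and in the next two steps are the rows of the inverse
    Fourier matrix of order 3, whose factor 1/3 is 1.\<close>
  have "z 0 = (z 0 + z 1 + z 2) + 1 * (z 0 + \<omega> * z 1 + (\<omega> + 1) * z 2) + 1 * (z 0 + (\<omega> + 1) * z 1 + \<omega> * z 2)"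
    by (simp add: ring2)
  then have z0: "z 0 = 0" by (simp only: r1 r2 r3 mult_zero_right add_0_left)
  have "z 1 = (z 0 + z 1 + z 2) + (\<omega> + 1) * (z 0 + \<omega> * z 1 + (\<omega> + 1) * z 2) + \<omega> * (z 0 + (\<omega> + 1) * z 1 + \<omega> * z 2)"
    by (simp add: ring2)
  then have z1: "z 1 = 0" by (simp only: r1 r2 r3 mult_zero_right add_0_left)
  have "z 2 = (z 0 + z 1 + z 2) + \<omega> * (z 0 + \<omega> * z 1 + (\<omega> + 1) * z 2) + (\<omega> + 1) * (z 0 + (\<omega> + 1) * z 1 + \<omega> * z 2)"
    by (simp add: ring2)
  then have z2: "z 2 = 0" by (simp only: r1 r2 r3 mult_zero_right add_0_left)
  note z012 = z0 z1 z2
  have z345: "z 3 = 0" "z 4 = 0" "z 5 = 0"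
    using e01 e02 e12 unfolding z012 by simp_all
  have z6: "z 6 = 0" "z 7 = 0" "z 8 = 0" "z 9 = 0" "z 10 = 0" "z 11 = 0"
    using e13 e14 e15 e23 e24 e25 om0 unfolding z012 z345 by simp_all
  have "z (2 * j) = 0 \<and> z (2 * j + 1) = 0" if j: "3 \<le> j" "j < l" for j
  proof (cases "j < 6")
    case True
    then have "j = 3 \<or> j = 4 \<or> j = 5" using j by linarith
    then show ?thesis using z6 by auto
  next
    case False
    then show ?thesis
      using tangency_outer[of lam j s True l z] s0[OF j(1)] E[of 0 j] E[of 1 j] j
      by (simp add: lam)
  qed
  moreover have "n = 0 \<or> n = 1 \<or> n = 2 \<or> n = 3 \<or> n = 4 \<or> n = 5" if "n < 6" using that by linarith
  ultimately show ?thesis using core_cases[OF n] z012 z345 by blast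
qed

section \<open>The lower bound in all characteristics\<close>

text \<open>By duality: the points are read as lines, and a point off all of them is read as a line,
  \<open>lin\<close> being symmetric.\<close>

lemma auxiliary_line:
  fixes L :: "nat \<Rightarrow> 'a::alg_closed_field \<times> 'a \<times> 'a"
  assumes "general_position l L" "l \<ge> 3"
  shows "\<exists>b. \<forall>i j. i < j \<longrightarrow> j < l \<longrightarrow> lin b (cross (L i) (L j)) \<noteq> 0"
proof -
  have "\<exists>P. \<forall>ij\<in>index_pairs l. lin (cross (L (fst ij)) (L (snd ij))) P \<noteq> 0"
    using card_index_pairs(2) general_position_cross_nonzero[OF assms]
    by (intro lines_nonzero_somewhere) (auto simp: index_pairs_def)
  then obtain P where P: "\<And>ij. ij \<in> index_pairs l \<Longrightarrow> lin (cross (L (fst ij)) (L (snd ij))) P \<noteq> 0"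
    by blast
  have "lin P b = lin b P" for b by (simp add: lin_def mult.commute)
  then show ?thesis using P[of "(i, j)" for i j]
    by (intro exI[of _ P]) (simp add: index_pairs_def)
qed

lemma star_dimension_lower_base_lines:
  fixes s :: "nat \<Rightarrow> 'a::alg_closed_field"
  assumes lam: "\<And>j. lam j \<noteq> 0" and s0: "\<And>j. j \<ge> 3 \<Longrightarrow> s j \<noteq> 0"
    and s2: "\<And>i j. 3 \<le> i \<Longrightarrow> i < j \<Longrightarrow> (s i)\<^sup>2 \<noteq> (s j)\<^sup>2"
    and "l \<ge> 3" and h: "h \<Longrightarrow> (2::'a) = 0"
    and rigid: "\<And>z n. n < 2 * l \<Longrightarrow>
      (\<And>i j. i < j \<Longrightarrow> j < l \<Longrightarrow> tangency h l (base_lines lam s) z i j = 0) \<Longrightarrow> z n = 0"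
  shows "irred_chain (plane_monos (l + e - 1))
    (proj_closure (plane_monos (l + e - 1)) (S_star (l + e - 1) l :: ((nat \<Rightarrow>\<^sub>0 nat) \<Rightarrow> 'a) set))
    (2 * l + (card (star_indices l e) - 1))"
proof -
  have gp: "general_position l (base_lines lam s)"
    using lam s0 s2 by (rule general_position_base_lines)
  obtain b where b: "\<And>i j. i < j \<Longrightarrow> j < l \<Longrightarrow> lin b (cross (base_lines lam s i) (base_lines lam s j)) \<noteq> 0"
    using auxiliary_line[OF gp \<open>l \<ge> 3\<close>] by blast
  define \<sigma> :: "nat \<Rightarrow> nat" where "\<sigma> j = (if j = 1 then 1 else if j = 2 then 2 else 0)" for j
  interpret star_deformation l e h "base_lines lam s" core \<sigma> b
  proof
    show "\<sigma> i \<le> 2" for i by (simp add: \<sigma>_def)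
    show "coord (\<sigma> i) (base_lines lam s i) \<noteq> 0" for i
      using lam by (simp add: \<sigma>_def base_lines_def coord_def)
    show "core 0 \<noteq> (0::'a)" by (simp add: core_def)
    show "z n = 0" if "n < 2 * l" "\<And>i j. i < j \<Longrightarrow> j < l \<Longrightarrow>
        core i * lin (shift h z j) (cross (base_lines lam s i) (base_lines lam s j)) +
        core j * lin (shift h z i) (cross (base_lines lam s i) (base_lines lam s j)) +
        core i * core j * drift_square h z (cross (base_lines lam s i) (base_lines lam s j)) *
          (\<Sum>k\<in>{..<l} - {i, j}. core k / lin (base_lines lam s k) (cross (base_lines lam s i) (base_lines lam s j))) = 0"
      for z n
      using that unfolding tangency_def[symmetric] by (rule rigid)
  qed (fact gp \<open>l \<ge> 3\<close> b h)+
  show ?thesis by (rule irred_chain_deformation)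
qed

lemma infinite_avoiding_sequence:
  fixes X :: "'a::alg_closed_field set"
  assumes "finite X"
  obtains t :: "nat \<Rightarrow> 'a" where "inj t" "\<And>j. t j \<notin> X"
proof -
  have "infinite (UNIV - X)"
    using assms infinite_UNIV_alg_closed[where 'a='a] by (simp add: Diff_infinite_finite)
  then obtain t :: "nat \<Rightarrow> 'a" where "inj t" "range t \<subseteq> UNIV - X"
    using infinite_countable_subset by blast
  then show thesis using that by blast
qed

lemma star_dimension_lower:
  assumes "l \<ge> 6"
  shows "irred_chain (plane_monos (l + e - 1))
    (proj_closure (plane_monos (l + e - 1))
      (S_star (l + e - 1) l :: ((nat \<Rightarrow>\<^sub>0 nat) \<Rightarrow> 'a::alg_closed_field) set))
    (2 * l + (card (star_indices l e) - 1))"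
proof (cases "(2::'a) = 0")
  case False
  obtain t :: "nat \<Rightarrow> 'a" where t: "inj t" "\<And>j. t j \<notin> {0}"
    using infinite_avoiding_sequence[of "{0}"] by auto
  \<comment> \<open>Square roots of distinct nonzero elements have the distinct squares that general
    position requires.\<close>
  have "\<exists>r. r\<^sup>2 = t j" for j using nth_root_exists[of 2 "t j"] by auto
  then obtain s where s: "\<And>j. (s j)\<^sup>2 = t j" by metis
  have s0: "s j \<noteq> 0" for j using s[of j] t(2)[of j] by auto
  have s2: "(s i)\<^sup>2 \<noteq> (s j)\<^sup>2" if "i < j" for i j
    using that injD[OF t(1), of i j] by (auto simp: s)
  show ?thesis
  proof (rule star_dimension_lower_base_lines[where h = False and lam = "\<lambda>_. 1" and s = s])
    fix z :: "nat \<Rightarrow> 'a" and n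
    assume "n < 2 * l" "\<And>i j. i < j \<Longrightarrow> j < l \<Longrightarrow> tangency False l (base_lines (\<lambda>_. 1) s) z i j = 0"
    then show "z n = 0"
      by (intro rigid_odd[OF False assms s0 s2, where z = z and n = n])
  qed (use assms s0 s2 in auto)
next
  case True
  \<comment> \<open>A root of this polynomial generates the field with four elements.\<close>
  have "degree [:1, 1, 1::'a:] > 0" by simp
  then obtain \<omega> :: 'a where "poly [:1, 1, 1:] \<omega> = 0" using alg_closed_imp_poly_has_root by blast
  then have sum0: "1 + \<omega> + \<omega>\<^sup>2 = 0" by (simp add: power2_eq_square algebra_simps)
  have dbl: "x + x = 0" for x :: 'a using True by (metis mult_2 mult_zero_left)
  have neg: "- x = x" for x :: 'a using dbl[of x] by (simp add: neg_eq_iff_add_eq_0)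
  have om: "\<omega>\<^sup>2 = \<omega> + 1"  proof -
    have "\<omega>\<^sup>2 + (\<omega> + 1) = 0" using sum0 by (simp only: add_ac)
    then show ?thesis by (simp only: eq_neg_iff_add_eq_0[symmetric] neg)
  qed
  have om0: "\<omega> \<noteq> 0" "\<omega> \<noteq> 1" "\<omega> + 1 \<noteq> 0" using om dbl[of 1] by auto
  obtain t :: "nat \<Rightarrow> 'a" where t: "inj t" "\<And>j. t j \<notin> {0, 1, \<omega>, \<omega> + 1}"
    using infinite_avoiding_sequence[of "{0, 1, \<omega>, \<omega> + 1}"] by auto
  \<comment> \<open>The outer parameters avoid that field, hence the core values; squaring is
    injective in characteristic 2, so distinct parameters suffice.\<close>
  define s where "s j = (if j = 3 then 1 else if j = 4 then \<omega> else if j = 5 then \<omega> + 1 else t j)" for j :: nat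
  define lam :: "nat \<Rightarrow> 'a" where "lam = (\<lambda>j. if j = 3 then \<omega> else 1)"
  have s0: "s j \<noteq> 0" for j using om0 t(2)[of j] by (auto simp: s_def)
  have s_inj: "s i \<noteq> s j" if "i < j" for i j
    using that om0 t(2)[of i] t(2)[of j] injD[OF t(1), of i j] by (auto simp: s_def)
  have s2: "(s i)\<^sup>2 \<noteq> (s j)\<^sup>2" if "i < j" for i j
  proof
    assume "(s i)\<^sup>2 = (s j)\<^sup>2"
    then have "(s i + s j)\<^sup>2 = 0" using dbl by (simp add: square_add_char2[OF True])
    then have "s i = - s j" by (simp add: eq_neg_iff_add_eq_0)
    then show False using s_inj[OF that] neg by simp
  qed
  show ?thesis
  proof (rule star_dimension_lower_base_lines[where h = True and lam = lam and s = s])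
    fix z :: "nat \<Rightarrow> 'a" and n
    assume "n < 2 * l" "\<And>i j. i < j \<Longrightarrow> j < l \<Longrightarrow> tangency True l (base_lines lam s) z i j = 0"
    then show "z n = 0"
    proof (intro rigid_char2[OF True assms om lam_def, where s = s and z = z and n = n])
      show "s 3 = 1" "s 4 = \<omega>" "s 5 = \<omega> + 1" by (simp_all add: s_def)
      show "s j \<noteq> 0" for j by (rule s0)
    qed
  qed (use assms om0 s0 s2 True in \<open>auto simp: lam_def\<close>)
qed

theorem theorem4p1:
  fixes l d :: nat
  assumes "l \<ge> 7" and "d \<ge> l - 1"
  shows "proj_dim_eq (plane_monos d)
           (proj_closure (plane_monos d) (S_star d l :: ((nat \<Rightarrow>\<^sub>0 nat) \<Rightarrow> 'a::alg_closed_field) set))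
           ((d + 2 choose 2) - (l choose 2) + 2 * l - 1)"
proof -
  \<comment> \<open>\<open>e\<close> is the excess over degree \<open>l - 1\<close>, the degree of a
    product omitting one line; \<open>d \<ge> l - 1\<close> makes the subtraction exact.\<close>
  define e where "e = d + 1 - l"
  have d: "d = l + e - 1" using assms by (simp add: e_def)
  \<comment> \<open>The basis is nonempty, so that subtracting 1 from its size is not
    truncated.\<close>
  have "Inl (0, 0) \<in> star_indices l e" using assms by (auto simp: star_indices_def)
  then have "card (star_indices l e) > 0" using finite_star_indices by (auto simp: card_gt_0_iff)
  moreover have "d + 2 = l + e + 1" using d assms by simp
  then have "card (star_indices l e) + (l choose 2) = (d + 2 choose 2)"
    using card_star_indices[of l e] by simp
  ultimately have N: "(d + 2 choose 2) - (l choose 2) + 2 * l - 1 = 2 * l + (card (star_indices l e) - 1)"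
    by simp
  have "l \<ge> 6" "l \<ge> 3" using assms by simp_all
  then show ?thesis
    unfolding proj_dim_eq_def N
    using star_dimension_lower[of l e, folded d] star_dimension_upper[of l e, folded d] by blast
qed

end
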